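(* Let $S$ be a generic surface in a 3-manifold $M$, with no non-trivial closed double arcs, with double arcs $DA_0,\dots,DA_{N-1}$ and triple values $TV_0,\dots,TV_{K-1}$, where at each $TV_k$ the three arc segments are indexed $TV_k^1,TV_k^2,TV_k^3$ and at each double arc one of the two strips is named the $0$-strip and the other the $1$-strip. Let $j(k,l)$ and $s(k,l)$ be the resulting index function and parameters. Then a lifting attempt is successful if and only if its corresponding vector $x=(x_0,\dots,x_{N-1})\in\{0,1\}^N$ satisfies the 3-sat formula $$\bigwedge_{k=0}^{K-1}\Big(\big((x_{j(k,1)}\leftrightarrow s(k,1))\vee(x_{j(k,2)}\leftrightarrow s(k,2))\vee(x_{j(k,3)}\leftrightarrow s(k,3))\big)\wedge\big((x_{j(k,1)}\leftrightarrow\neg s(k,1))\vee(x_{j(k,2)}\leftrightarrow\neg s(k,2))\vee(x_{j(k,3)}\leftrightarrow\neg s(k,3))\big)\Big),$$ and in particular the surface is liftable if and only if this formula is satisfiable.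
   Context: All manifolds and maps are PL. A generic surface in a 3-manifold $M$ is the image $S=i(F)$ of a proper PL map $i:F\to M$ from a compact surface $F$ such that every $p\in S$ has a neighborhood $N(p)$ for which $(N(p),N(p)\cap S)$ is homeomorphic to one of: ($D^3$, the union of 1, 2 or 3 coordinate planes) (regular, double, triple value); ($D^3$, a cone over a figure-8 curve in $\partial D^3$) (branch value); ($D^3\cap\{z\ge0\}$, the union of one or two of the $xz$ and $yz$ planes) (RB, DB value). A lifting is a proper one-to-one (locally flat) PL map $k=(i,h):F\to M\times\mathbb{R}$; $S$ is liftable if a lifting exists. A double arc is an immersed 1-manifold obtained by following a curve of double values, going straight through triple values; it is open (ending at DB or branch values) or closed. Along a double arc two strips of surface cross. A closed arc is trivial if going once around it returns each strip to itself, non-trivial if it interchanges the two strips. A lifting attempt (for a surface without non-trivial closed arcs) is a choice, at each double arc, of which of the two strips is higher; it is successful if some lifting $(i,h)$ realizes it (at each double value, the preimage in the chosen strip has larger $h$). Vector of a lifting attempt: $x_j=0$ if the $0$-strip is chosen to be higher at $DA_j$, and $x_j=1$ if the $1$-strip is. At $TV_k$ three sheets meet and each two cross along one of three segments $TV_k^1,TV_k^2,TV_k^3$ of double arcs. $j(k,l)$ is the index $j$ of the double arc $DA_j$ containing $TV_k^l$. Denote by $D_k^{\{a,b\}}$ the sheet containing $TV_k^a$ and $TV_k^b$. Along $TV_k^l$ each of the two sheets containing it is part of one of the two strips of $DA_{j(k,l)}$. Set: $s(k,1)=0$ if along $TV_k^1$ the sheet $D_k^{\{1,3\}}$ lies in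 the $0$-strip and $D_k^{\{1,2\}}$ in the $1$-strip, and $s(k,1)=1$ if it is the other way around; $s(k,2)=0$ if along $TV_k^2$ the sheet $D_k^{\{1,2\}}$ lies in the $0$-strip and $D_k^{\{2,3\}}$ in the $1$-strip, and $1$ otherwise; $s(k,3)=0$ if along $TV_k^3$ the sheet $D_k^{\{2,3\}}$ lies in the $0$-strip and $D_k^{\{1,3\}}$ in the $1$-strip, and $1$ otherwise. Here $x\leftrightarrow 1$ is the literal $x$ and $x\leftrightarrow 0$ is the literal $\neg x$.
   Formalization: In "generic surface" the local models are required of the sheets of i, not only of the image S: over each N(p) the preimage is one disc per plane, and a branch value has one preimage; otherwise S^2 covering RP^2 in RP^3 would be generic with an empty formula, yet not liftable. *)

theory Defs
  imports "HOL-Analysis.Analysis"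
begin

section \<open>PL topology in Euclidean spaces\<close>

text \<open>PL manifolds are taken to be Euclidean polyhedra, so every chart and every map below is a
  piecewise linear map between subsets of Euclidean spaces.\<close>

definition nbhd_in :: "'a::topological_space set \<Rightarrow> 'a \<Rightarrow> 'a set \<Rightarrow> bool" where
  "nbhd_in X p N \<longleftrightarrow> N \<subseteq> X \<and> (\<exists>V. openin (top_of_set X) V \<and> p \<in> V \<and> V \<subseteq> N)"

definition affine_map_on :: "'a::real_vector set \<Rightarrow> ('a \<Rightarrow> 'b::real_vector) \<Rightarrow> bool" where
  "affine_map_on C f \<longleftrightarrow> (\<exists>L b. linear L \<and> (\<forall>x\<in>C. f x = L x + b))"

text \<open>Every point of the domain has a neighbourhood that is a finite union of polytopes on each of
  which the map is affine.  In particular the domain is a (locally compact) polyhedron.\<close>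

definition pl_map_on :: "'a::euclidean_space set \<Rightarrow> ('a \<Rightarrow> 'b::euclidean_space) \<Rightarrow> bool" where
  "pl_map_on X f \<longleftrightarrow> continuous_on X f \<and>
     (\<forall>x\<in>X. \<exists>\<C>. finite \<C> \<and> nbhd_in X x (\<Union>\<C>) \<and> (\<forall>C\<in>\<C>. polytope C \<and> affine_map_on C f))"

definition pl_homeomorphism ::
  "'a::euclidean_space set \<Rightarrow> 'b::euclidean_space set \<Rightarrow> ('a \<Rightarrow> 'b) \<Rightarrow> ('b \<Rightarrow> 'a) \<Rightarrow> bool" where
  "pl_homeomorphism X Y f g \<longleftrightarrow> homeomorphism X Y f g \<and> pl_map_on X f \<and> pl_map_on Y g"

text \<open>The cube \<open>cbox (-1) 1\<close> is the standard PL ball.  Manifolds may have boundary.\<close>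

definition pl_ball :: "(real^'n) set" where
  "pl_ball = cbox (-1) 1"

definition pl_manifold :: "'n::finite itself \<Rightarrow> 'a::euclidean_space set \<Rightarrow> bool" where
  "pl_manifold n M \<longleftrightarrow>
     (\<forall>p\<in>M. \<exists>N (f :: 'a \<Rightarrow> real^'n) g. nbhd_in M p N \<and> pl_homeomorphism N pl_ball f g)"

definition mf_interior :: "'n::finite itself \<Rightarrow> 'a::euclidean_space set \<Rightarrow> 'a set" where
  "mf_interior n M = {p \<in> M. \<exists>N (f :: 'a \<Rightarrow> real^'n) g.
     nbhd_in M p N \<and> pl_homeomorphism N pl_ball f g \<and> f p \<in> box (-1) 1}"

definition mf_boundary :: "'n::finite itself \<Rightarrow> 'a::euclidean_space set \<Rightarrow> 'a set" where
  "mf_boundary n M = M - mf_interior n M"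

text \<open>Properness: exactly the boundary goes to the boundary.  The domain is compact in all uses,
  so that preimages of compact sets are automatically compact.\<close>

definition proper_pl_map :: "'m::finite itself \<Rightarrow> 'n::finite itself \<Rightarrow>
    'a::euclidean_space set \<Rightarrow> 'b::euclidean_space set \<Rightarrow> ('a \<Rightarrow> 'b) \<Rightarrow> bool" where
  "proper_pl_map m n F M f \<longleftrightarrow> pl_map_on F f \<and> f ` F \<subseteq> M \<and>
     (\<forall>x\<in>F. f x \<in> mf_boundary n M \<longleftrightarrow> x \<in> mf_boundary m F)"

text \<open>Local flatness of a 2-dimensional subset of a 4-manifold at a point: the pair is locally the
  standard ball pair, or the standard half ball pair.\<close>

definition locally_flat_at :: "'a::euclidean_space set \<Rightarrow> 'a set \<Rightarrow> 'a \<Rightarrow> bool" where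
  "locally_flat_at W T p \<longleftrightarrow>
     (\<exists>N (f :: 'a \<Rightarrow> real^4) g B. nbhd_in W p N \<and> (B = pl_ball \<or> B = pl_ball \<inter> {v. 0 \<le> v$1}) \<and>
        pl_homeomorphism N B f g \<and> f p = 0 \<and> f ` (N \<inter> T) = B \<inter> {v. v$3 = 0 \<and> v$4 = 0})"


section \<open>Generic surfaces\<close>

definition half_ball :: "(real^3) set" where
  "half_ball = pl_ball \<inter> {v. 0 \<le> v$3}"

text \<open>Near \<open>p\<close> the surface consists of the coordinate planes \<open>{v. v$l = 0}\<close> with \<open>l \<in> L\<close>.  The
  sets \<open>U l\<close> express that these planes are the sheets of the map \<open>i\<close>, and not only that they make
  up its image: they exclude, for instance, double coverings of an embedded surface and sheets
  that are bent along their line of contact.\<close>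

definition planes_at :: "'m::euclidean_space set \<Rightarrow> 'f::euclidean_space set \<Rightarrow> ('f \<Rightarrow> 'm) \<Rightarrow>
    (real^3) set \<Rightarrow> 3 set \<Rightarrow> 'm \<Rightarrow> bool" where
  "planes_at M F i B L p \<longleftrightarrow>
     (\<exists>N f g. nbhd_in M p N \<and> pl_homeomorphism N B f g \<and> f p = 0 \<and>
        f ` (N \<inter> i ` F) = (\<Union>l\<in>L. B \<inter> {v. v$l = 0}) \<and>
        (\<exists>U. disjoint_family_on U L \<and> (\<Union>l\<in>L. U l) = {x \<in> F. i x \<in> N} \<and>
           (\<forall>l\<in>L. \<exists>u. pl_homeomorphism (U l) (B \<inter> {v. v$l = 0}) (f \<circ> i) u)))"

definition regular_value where
  "regular_value M F i p \<longleftrightarrow> planes_at M F i pl_ball {1} p"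

definition double_value where
  "double_value M F i p \<longleftrightarrow> planes_at M F i pl_ball {1, 2} p"

definition triple_value where
  "triple_value M F i p \<longleftrightarrow> planes_at M F i pl_ball {1, 2, 3} p"

definition RB_value where
  "RB_value M F i p \<longleftrightarrow> planes_at M F i half_ball {2} p"

definition DB_value where
  "DB_value M F i p \<longleftrightarrow> planes_at M F i half_ball {1, 2} p"

text \<open>A figure-8 in the top face of the cube: the two diagonals of a square and two opposite sides
  of it.\<close>

definition figure_eight :: "(real^3) set" where
  "figure_eight = {v. v$3 = 1 \<and>
     (\<bar>v$1\<bar> = \<bar>v$2\<bar> \<and> \<bar>v$1\<bar> \<le> 1/2 \<or> \<bar>v$1\<bar> = 1/2 \<and> \<bar>v$2\<bar> \<le> 1/2)}"

definition figure_eight_cone :: "(real^3) set" where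
  "figure_eight_cone = {t *\<^sub>R v | t v. 0 \<le> t \<and> t \<le> 1 \<and> v \<in> figure_eight}"

text \<open>The points of the cone near \<open>p\<close> other than \<open>p\<close> are regular or double values, so the sheets of
  \<open>i\<close> are already prescribed there; with a single point over \<open>p\<close>, the part of \<open>F\<close> over the
  cone is a disc.\<close>

definition branch_value ::
    "'m::euclidean_space set \<Rightarrow> 'f::euclidean_space set \<Rightarrow> ('f \<Rightarrow> 'm) \<Rightarrow> 'm \<Rightarrow> bool" where
  "branch_value M F i p \<longleftrightarrow>
     (\<exists>N f g. nbhd_in M p N \<and> pl_homeomorphism N pl_ball f g \<and> f p = 0 \<and>
        f ` (N \<inter> i ` F) = figure_eight_cone) \<and>
     (\<exists>!x. x \<in> F \<and> i x = p)"

text \<open>The generic surface is \<open>i ` F\<close>.\<close>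

definition generic_surface ::
    "'m::euclidean_space set \<Rightarrow> 'f::euclidean_space set \<Rightarrow> ('f \<Rightarrow> 'm) \<Rightarrow> bool" where
  "generic_surface M F i \<longleftrightarrow>
     pl_manifold TYPE(2) F \<and> compact F \<and> proper_pl_map TYPE(2) TYPE(3) F M i \<and>
     (\<forall>p\<in>i ` F. regular_value M F i p \<or> double_value M F i p \<or> triple_value M F i p \<or>
        branch_value M F i p \<or> RB_value M F i p \<or> DB_value M F i p)"


section \<open>Liftings\<close>

definition lifting ::
    "'m::euclidean_space set \<Rightarrow> 'f::euclidean_space set \<Rightarrow> ('f \<Rightarrow> 'm) \<Rightarrow> ('f \<Rightarrow> real) \<Rightarrow> bool" where
  "lifting M F i h \<longleftrightarrow>
     (let k = (\<lambda>x. (i x, h x)); W = M \<times> (UNIV :: real set) in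
        proper_pl_map TYPE(2) TYPE(4) F W k \<and> inj_on k F \<and>
        (\<forall>p\<in>k ` F. locally_flat_at W (k ` F) p))"

definition liftable ::
    "'m::euclidean_space set \<Rightarrow> 'f::euclidean_space set \<Rightarrow> ('f \<Rightarrow> 'm) \<Rightarrow> bool" where
  "liftable M F i \<longleftrightarrow> (\<exists>h. lifting M F i h)"


section \<open>Double arcs and strips\<close>

text \<open>Over a point where two sheets cross lie two points \<open>x \<noteq> y\<close> of \<open>F\<close>, one on each of the sheets.
  A point of an immersed double arc is the unordered pair of \<open>x\<close> and \<open>y\<close>; at a triple value there
  are three such pairs, and keeping to the same two sheets means going straight through.  An ordered
  pair \<open>(x, y)\<close> in addition singles out one of the two crossing strips, the one through \<open>x\<close>; the
  other strip passes through \<open>y\<close>.\<close>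

definition double_pairs :: "'f set \<Rightarrow> ('f \<Rightarrow> 'm) \<Rightarrow> ('f \<times> 'f) set" where
  "double_pairs F i = {(x, y). x \<in> F \<and> y \<in> F \<and> x \<noteq> y \<and> i x = i y}"

text \<open>A strip is represented by the pairs met when following a double arc along it.\<close>

definition strip_through ::
    "'f::topological_space set \<Rightarrow> ('f \<Rightarrow> 'm) \<Rightarrow> 'f \<times> 'f \<Rightarrow> ('f \<times> 'f) set" where
  "strip_through F i e = path_component_set (double_pairs F i) e"

text \<open>A double arc is represented by the symmetric set of all ordered pairs over it.\<close>

definition double_arcs :: "'f::topological_space set \<Rightarrow> ('f \<Rightarrow> 'm) \<Rightarrow> ('f \<times> 'f) set set" where
  "double_arcs F i =
     {strip_through F i (x, y) \<union> strip_through F i (y, x) | x y. (x, y) \<in> double_pairs F i}"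

definition strips ::
    "'f::topological_space set \<Rightarrow> ('f \<Rightarrow> 'm) \<Rightarrow> ('f \<times> 'f) set \<Rightarrow> ('f \<times> 'f) set set" where
  "strips F i A = strip_through F i ` A"

text \<open>A double arc is open iff it ends at DB or branch values.\<close>

definition closed_arc :: "'m::euclidean_space set \<Rightarrow> 'f::euclidean_space set \<Rightarrow> ('f \<Rightarrow> 'm) \<Rightarrow>
    ('f \<times> 'f) set \<Rightarrow> bool" where
  "closed_arc M F i A \<longleftrightarrow>
     \<not> (\<exists>p \<in> closure ((\<lambda>(x, y). i x) ` A). DB_value M F i p \<or> branch_value M F i p)"

text \<open>The strips are interchanged when one can follow the arc from \<open>(x, y)\<close> to \<open>(y, x)\<close>.\<close>

definition trivial_arc ::
    "'f::topological_space set \<Rightarrow> ('f \<Rightarrow> 'm) \<Rightarrow> ('f \<times> 'f) set \<Rightarrow> bool" where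
  "trivial_arc F i A \<longleftrightarrow> (\<forall>(x, y) \<in> A. (y, x) \<notin> strip_through F i (x, y))"


section \<open>Lifting attempts\<close>

text \<open>A lifting attempt assigns to each double arc its higher strip.\<close>

definition lifting_attempt :: "'f::topological_space set \<Rightarrow> ('f \<Rightarrow> 'm) \<Rightarrow>
    (('f \<times> 'f) set \<Rightarrow> ('f \<times> 'f) set) \<Rightarrow> bool" where
  "lifting_attempt F i att \<longleftrightarrow> (\<forall>A \<in> double_arcs F i. att A \<in> strips F i A)"

definition successful :: "'m::euclidean_space set \<Rightarrow> 'f::euclidean_space set \<Rightarrow> ('f \<Rightarrow> 'm) \<Rightarrow>
    (('f \<times> 'f) set \<Rightarrow> ('f \<times> 'f) set) \<Rightarrow> bool" where
  "successful M F i att \<longleftrightarrow>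
     (\<exists>h. lifting M F i h \<and> (\<forall>A \<in> double_arcs F i. \<forall>(x, y) \<in> att A. h y < h x))"

text \<open>Truth values encode \<open>{0, 1}\<close>, with \<open>False\<close> for 0 and \<open>True\<close> for 1.\<close>

definition attempt_vector :: "(nat \<Rightarrow> 'a) \<Rightarrow> (nat \<Rightarrow> nat \<Rightarrow> 'b) \<Rightarrow> ('a \<Rightarrow> 'b) \<Rightarrow> nat \<Rightarrow> bool" where
  "attempt_vector DA strip att j \<longleftrightarrow> att (DA j) = strip j 1"


section \<open>Triple values\<close>

text \<open>The three sheets at a triple value \<open>p\<close> correspond to the three points of \<open>F\<close> over \<open>p\<close>, and a
  segment of a double arc through \<open>p\<close> to the pair of sheets that cross along it.\<close>

definition segments :: "'f set \<Rightarrow> ('f \<Rightarrow> 'm) \<Rightarrow> 'm \<Rightarrow> 'f set set" where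
  "segments F i p = {{x, y} | x y. (x, y) \<in> double_pairs F i \<and> i x = p}"

text \<open>With \<open>\<sigma> l\<close> the \<open>l\<close>-th segment, \<open>sheet \<sigma> a b\<close> is the sheet containing the segments \<open>a\<close> and \<open>b\<close>.\<close>

definition sheet :: "(nat \<Rightarrow> 'f set) \<Rightarrow> nat \<Rightarrow> nat \<Rightarrow> 'f" where
  "sheet \<sigma> a b = (THE x. x \<in> \<sigma> a \<and> x \<in> \<sigma> b)"

definition arc_index :: "nat \<Rightarrow> (nat \<Rightarrow> ('f \<times> 'f) set) \<Rightarrow> (nat \<Rightarrow> 'f set) \<Rightarrow> nat \<Rightarrow> nat" where
  "arc_index N DA \<sigma> l = (THE j. j < N \<and> (\<exists>x y. \<sigma> l = {x, y} \<and> (x, y) \<in> DA j))"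

text \<open>\<open>first_sheet \<sigma> l\<close> and \<open>second_sheet \<sigma> l\<close> are the two sheets crossing along segment \<open>l\<close>, in the
  cyclic order in which they enter the definition of \<open>s(k, l)\<close>.\<close>

definition first_sheet :: "(nat \<Rightarrow> 'f set) \<Rightarrow> nat \<Rightarrow> 'f" where
  "first_sheet \<sigma> l = (if l = 1 then sheet \<sigma> 1 3 else if l = 2 then sheet \<sigma> 1 2 else sheet \<sigma> 2 3)"

definition second_sheet :: "(nat \<Rightarrow> 'f set) \<Rightarrow> nat \<Rightarrow> 'f" where
  "second_sheet \<sigma> l = (if l = 1 then sheet \<sigma> 1 2 else if l = 2 then sheet \<sigma> 2 3 else sheet \<sigma> 1 3)"

definition strip_parameter :: "nat \<Rightarrow> (nat \<Rightarrow> ('f \<times> 'f) set) \<Rightarrow> (nat \<Rightarrow> nat \<Rightarrow> ('f \<times> 'f) set) \<Rightarrow>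
    (nat \<Rightarrow> 'f set) \<Rightarrow> nat \<Rightarrow> bool" where
  "strip_parameter N DA strip \<sigma> l \<longleftrightarrow>
     \<not> ((first_sheet \<sigma> l, second_sheet \<sigma> l) \<in> strip (arc_index N DA \<sigma> l) 0 \<and>
        (second_sheet \<sigma> l, first_sheet \<sigma> l) \<in> strip (arc_index N DA \<sigma> l) 1)"

text \<open>Only entries of \<open>x\<close> at indices of double arcs occur, so \<open>x\<close> may be a total function.\<close>

definition lifting_formula ::
    "nat \<Rightarrow> (nat \<Rightarrow> nat \<Rightarrow> nat) \<Rightarrow> (nat \<Rightarrow> nat \<Rightarrow> bool) \<Rightarrow> (nat \<Rightarrow> bool) \<Rightarrow> bool" where
  "lifting_formula K j s x \<longleftrightarrow>
     (\<forall>k<K. ((x (j k 1) \<longleftrightarrow> s k 1) \<or> (x (j k 2) \<longleftrightarrow> s k 2) \<or> (x (j k 3) \<longleftrightarrow> s k 3)) \<and>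
            ((x (j k 1) \<longleftrightarrow> \<not> s k 1) \<or> (x (j k 2) \<longleftrightarrow> \<not> s k 2) \<or> (x (j k 3) \<longleftrightarrow> \<not> s k 3)))"

end

theory Submission
  imports Defs
begin

text \<open>A lifting orders the three points over a triple value linearly, so the choices at its three
  segments are not cyclic; the formula says exactly this.

  For the converse, being a height function that respects the chosen order at the double pairs is
  preserved by sums, so it suffices to find nonnegative functions with small support that respect the
  order wherever they do not vanish.  Near a value whose sheets are planes such a function is constant
  on each sheet, the acyclicity being needed at triple values only.  Near a branch value it is
  \<open>v$2 * v$3 / (2 * v$1)\<close> up to sign, extended to the axis of the cone over the figure-8: then the
  lifted cone is the graph of a piecewise linear function over a plane, and hence locally flat.  That
  the two sheets of the surface crossing in the axis are the two diagonal planes follows from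
  invariance of domain and from the position of the four half-planes around the axis.\<close>

section \<open>Piecewise linear maps\<close>

text \<open>Everything has to stay piecewise linear. These operations treat all points over one
  value alike and so keep their order wherever the result is not zero. Sums then glue, but local
  flatness is not stable under sums. At values with plane sheets it is automatic, since an injective
  piecewise linear lift is near each such point the graph over one sheet. At a branch value the
  exact form of the height matters; as branch values are isolated, supports are chosen so small that
  only one summand is nonzero near each of them. The other obstacle is that a branch value
  prescribes, besides the single point over it, only the image, not how \<open>F\<close> is
  distributed over the cone. This is recovered topologically: local embeddability in the plane tells
  single sheets from crossing ones, and being a multiple value is a notion that can be compared
  between the chart of the cone and the charts of nearby values.\<close>

definition pl_at :: "'a::euclidean_space set \<Rightarrow> ('a \<Rightarrow> 'b::euclidean_space) \<Rightarrow> 'a \<Rightarrow> bool" where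
  "pl_at X f x \<longleftrightarrow>
     (\<exists>\<C>. finite \<C> \<and> nbhd_in X x (\<Union>\<C>) \<and> (\<forall>C\<in>\<C>. polytope C \<and> affine_map_on C f))"

lemma pl_map_on_iff: "pl_map_on X f \<longleftrightarrow> continuous_on X f \<and> (\<forall>x\<in>X. pl_at X f x)"
  by (simp add: pl_map_on_def pl_at_def)

lemma pl_map_on_continuous: "pl_map_on X f \<Longrightarrow> continuous_on X f"
  by (simp add: pl_map_on_def)

lemma affine_map_on_subset: "affine_map_on C f \<Longrightarrow> D \<subseteq> C \<Longrightarrow> affine_map_on D f"
  unfolding affine_map_on_def by blast

lemma affine_map_on_cong: "affine_map_on C f \<Longrightarrow> (\<And>x. x \<in> C \<Longrightarrow> f x = g x) \<Longrightarrow> affine_map_on C g"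
  unfolding affine_map_on_def by metis

lemma affine_map_on_compose:
  assumes "affine_map_on C f" "affine_map_on D g" "f ` C \<subseteq> D"
  shows "affine_map_on C (\<lambda>x. g (f x))"
proof -
  obtain L b where L: "linear L" "\<And>x. x \<in> C \<Longrightarrow> f x = L x + b"
    using assms unfolding affine_map_on_def by blast
  obtain L' b' where L': "linear L'" "\<And>x. x \<in> D \<Longrightarrow> g x = L' x + b'"
    using assms unfolding affine_map_on_def by blast
  have "linear (L' \<circ> L)" using L(1) L'(1) linear_compose by blast
  moreover have "g (f x) = (L' \<circ> L) x + (L' b + b')" if "x \<in> C" for x
    using L'(2)[of "f x"] assms(3) L(2)[OF that] that by (auto simp: linear_add[OF L'(1)])
  ultimately show ?thesis unfolding affine_map_on_def by blast
qed

lemma affine_map_on_pair: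
  assumes "affine_map_on C f" "affine_map_on C g"
  shows "affine_map_on C (\<lambda>x. (f x, g x))"
proof -
  obtain L b where L: "linear L" "\<And>x. x \<in> C \<Longrightarrow> f x = L x + b"
    using assms unfolding affine_map_on_def by blast
  obtain L' b' where L': "linear L'" "\<And>x. x \<in> C \<Longrightarrow> g x = L' x + b'"
    using assms unfolding affine_map_on_def by blast
  have "linear (\<lambda>x. (L x, L' x))"
    using L(1) L'(1) by (intro linearI) (auto simp: linear_add linear_scale)
  moreover have "(f x, g x) = (L x, L' x) + (b, b')" if "x \<in> C" for x
    using L(2) L'(2) that by auto
  ultimately show ?thesis unfolding affine_map_on_def by blast
qed

lemma affine_map_on_affine: "linear L \<Longrightarrow> affine_map_on C (\<lambda>x. L x + b)"
  unfolding affine_map_on_def by blast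

text \<open>The graph of \<open>f\<close> over \<open>C\<close> with values in \<open>D\<close> is
  the polytope \<open>C \<times> D\<close> cut by an affine subspace, and the set in question is its
  projection to the first factor.\<close>

lemma polytope_affine_preimage:
  fixes f :: "'a::euclidean_space \<Rightarrow> 'b::euclidean_space"
  assumes "polytope C" "affine_map_on C f" "polytope D"
  shows "polytope (C \<inter> f -` D)"
proof -
  obtain L b where L: "linear L" "\<And>x. x \<in> C \<Longrightarrow> f x = L x + b"
    using assms unfolding affine_map_on_def by blast
  let ?A = "{z :: 'a \<times> 'b. L (fst z) + b - snd z = 0}"
  have "affine ?A"
    unfolding affine_def
  proof (intro ballI allI impI)
    fix x y :: "'a \<times> 'b" and u v :: real
    assume x: "x \<in> ?A" and y: "y \<in> ?A" and uv: "u + v = 1"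
    have "L (fst (u *\<^sub>R x + v *\<^sub>R y)) + b - snd (u *\<^sub>R x + v *\<^sub>R y)
        = u *\<^sub>R (L (fst x) + b - snd x) + v *\<^sub>R (L (fst y) + b - snd y) + (b - (u + v) *\<^sub>R b)"
      by (simp add: linear_add[OF L(1)] linear_scale[OF L(1)] algebra_simps)
    then show "u *\<^sub>R x + v *\<^sub>R y \<in> ?A" using x y uv by simp
  qed
  then have "polyhedron ?A" by (rule affine_imp_polyhedron)
  moreover have "polytope (C \<times> D)" using assms by (simp add: polytope_Times)
  ultimately have "polytope ((C \<times> D) \<inter> ?A)"
    by (simp add: bounded_Int polytope_eq_bounded_polyhedron)
  then have "polytope (fst ` ((C \<times> D) \<inter> ?A))"
    by (rule polytope_linear_image[rotated]) (rule linear_fst)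
  moreover have "fst ` ((C \<times> D) \<inter> ?A) = C \<inter> f -` D"
  proof -
    have "x \<in> fst ` ((C \<times> D) \<inter> ?A)" if "x \<in> C" "f x \<in> D" for x
      using that L(2)[OF that(1)] by (intro image_eqI[of _ _ "(x, f x)"]) auto
    moreover have "f x \<in> D" if "x \<in> C" "y \<in> D" "L x + b - y = 0" for x y
      using that L(2)[OF that(1)] by simp
    ultimately show ?thesis by fastforce
  qed
  ultimately show ?thesis by simp
qed

text \<open>The composite is taken on the largest set where it makes sense; the point is that this
  set is again covered locally by polytopes. With \<open>g\<close> the identity this shows that
  preimages and intersections are admissible domains.\<close>

lemma pl_map_on_compose:
  fixes f :: "'a::euclidean_space \<Rightarrow> 'b::euclidean_space" and g :: "'b \<Rightarrow> 'c::euclidean_space"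
  assumes f: "pl_map_on X f" and g: "pl_map_on Y g"
  shows "pl_map_on {x \<in> X. f x \<in> Y} (\<lambda>x. g (f x))"
proof -
  let ?Z = "{x \<in> X. f x \<in> Y}"
  have contf: "continuous_on ?Z f"
    using pl_map_on_continuous[OF f] by (rule continuous_on_subset) auto
  have "continuous_on ?Z (\<lambda>x. g (f x))"
    by (rule continuous_on_compose2[OF pl_map_on_continuous[OF g] contf]) auto
  moreover have "pl_at ?Z (\<lambda>x. g (f x)) x" if x: "x \<in> ?Z" for x
  proof -
    obtain \<C> where C: "finite \<C>" "nbhd_in X x (\<Union>\<C>)"
        "\<And>C. C \<in> \<C> \<Longrightarrow> polytope C" "\<And>C. C \<in> \<C> \<Longrightarrow> affine_map_on C f"
      using f x unfolding pl_map_on_def by (metis (no_types, lifting) mem_Collect_eq)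
    obtain \<D> where D: "finite \<D>" "nbhd_in Y (f x) (\<Union>\<D>)"
        "\<And>C. C \<in> \<D> \<Longrightarrow> polytope C" "\<And>C. C \<in> \<D> \<Longrightarrow> affine_map_on C g"
      using g x unfolding pl_map_on_def by (metis (no_types, lifting) mem_Collect_eq)
    obtain V where V: "openin (top_of_set X) V" "x \<in> V" "V \<subseteq> \<Union>\<C>" and CX: "\<Union>\<C> \<subseteq> X"
      using C(2) unfolding nbhd_in_def by blast
    obtain V' where V': "openin (top_of_set Y) V'" "f x \<in> V'" "V' \<subseteq> \<Union>\<D>" and DY: "\<Union>\<D> \<subseteq> Y"
      using D(2) unfolding nbhd_in_def by blast
    define \<E> where "\<E> = (\<lambda>(C, D). C \<inter> f -` D) ` (\<C> \<times> \<D>)"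
    have fin: "finite \<E>" using C(1) D(1) by (simp add: \<E>_def)
    have UE: "\<Union>\<E> = {z \<in> \<Union>\<C>. f z \<in> \<Union>\<D>}" unfolding \<E>_def by auto
    have op: "openin (top_of_set ?Z) ((?Z \<inter> V) \<inter> (?Z \<inter> f -` V'))"
    proof (rule openin_Int)
      show "openin (top_of_set ?Z) (?Z \<inter> V)"
        using V(1) unfolding openin_open by blast
      show "openin (top_of_set ?Z) (?Z \<inter> f -` V')"
        by (rule continuous_openin_preimage[OF contf _ V'(1)]) auto
    qed
    have "nbhd_in ?Z x (\<Union>\<E>)"
      unfolding nbhd_in_def
    proof (intro conjI exI)
      show "\<Union>\<E> \<subseteq> ?Z" using CX DY UE by auto
      show "openin (top_of_set ?Z) ((?Z \<inter> V) \<inter> (?Z \<inter> f -` V'))" by (rule op)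
      show "x \<in> (?Z \<inter> V) \<inter> (?Z \<inter> f -` V')" using x V V' by auto
      show "(?Z \<inter> V) \<inter> (?Z \<inter> f -` V') \<subseteq> \<Union>\<E>" using V V' UE by auto
    qed
    moreover have "polytope E \<and> affine_map_on E (\<lambda>x. g (f x))" if "E \<in> \<E>" for E
    proof -
      obtain C' D' where E: "E = C' \<inter> f -` D'" "C' \<in> \<C>" "D' \<in> \<D>" using \<open>E \<in> \<E>\<close> unfolding \<E>_def by auto
      have "affine_map_on E f" using C(4)[OF E(2)] E(1) affine_map_on_subset by blast
      then have "affine_map_on E (\<lambda>x. g (f x))"
        using affine_map_on_compose[of E f D' g] D(4)[OF E(3)] E(1) by auto
      then show ?thesis using polytope_affine_preimage[OF C(3,4)[OF E(2)] D(3)[OF E(3)]] E(1) by auto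
    qed
    ultimately show ?thesis unfolding pl_at_def using fin by blast
  qed
  ultimately show ?thesis by (simp add: pl_map_on_iff)
qed

lemma pl_map_on_compose':
  assumes "pl_map_on X f" "pl_map_on Y g" "f ` X \<subseteq> Y"
  shows "pl_map_on X (\<lambda>x. g (f x))"
proof -
  have "{x \<in> X. f x \<in> Y} = X" using assms(3) by auto
  then show ?thesis using pl_map_on_compose[OF assms(1,2)] by simp
qed

lemma pl_map_on_pair:
  fixes f :: "'a::euclidean_space \<Rightarrow> 'b::euclidean_space" and g :: "'a \<Rightarrow> 'c::euclidean_space"
  assumes f: "pl_map_on X f" and g: "pl_map_on X g"
  shows "pl_map_on X (\<lambda>x. (f x, g x))"
proof -
  have "continuous_on X (\<lambda>x. (f x, g x))"
    using f g by (intro continuous_on_Pair) (auto dest: pl_map_on_continuous)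
  moreover have "pl_at X (\<lambda>x. (f x, g x)) x" if x: "x \<in> X" for x
  proof -
    obtain \<C> where C: "finite \<C>" "nbhd_in X x (\<Union>\<C>)"
        "\<And>C. C \<in> \<C> \<Longrightarrow> polytope C" "\<And>C. C \<in> \<C> \<Longrightarrow> affine_map_on C f"
      using f x unfolding pl_map_on_def by (metis (no_types, lifting))
    obtain \<D> where D: "finite \<D>" "nbhd_in X x (\<Union>\<D>)"
        "\<And>C. C \<in> \<D> \<Longrightarrow> polytope C" "\<And>C. C \<in> \<D> \<Longrightarrow> affine_map_on C g"
      using g x unfolding pl_map_on_def by (metis (no_types, lifting))
    define \<E> where "\<E> = (\<lambda>(C, D). C \<inter> D) ` (\<C> \<times> \<D>)"
    have UE: "\<Union>\<E> = \<Union>\<C> \<inter> \<Union>\<D>" unfolding \<E>_def by auto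
    have "nbhd_in X x (\<Union>\<E>)" unfolding UE nbhd_in_def
    proof (intro conjI)
      show "\<Union>\<C> \<inter> \<Union>\<D> \<subseteq> X" using C(2) unfolding nbhd_in_def by blast
      obtain V where V: "openin (top_of_set X) V" "x \<in> V" "V \<subseteq> \<Union>\<C>"
        using C(2) unfolding nbhd_in_def by blast
      obtain W where W: "openin (top_of_set X) W" "x \<in> W" "W \<subseteq> \<Union>\<D>"
        using D(2) unfolding nbhd_in_def by blast
      show "\<exists>V. openin (top_of_set X) V \<and> x \<in> V \<and> V \<subseteq> \<Union>\<C> \<inter> \<Union>\<D>"
        using V W by (intro exI[of _ "V \<inter> W"]) (auto intro: openin_Int)
    qed
    moreover have "polytope E \<and> affine_map_on E (\<lambda>x. (f x, g x))" if "E \<in> \<E>" for E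
    proof -
      obtain C' D' where E: "E = C' \<inter> D'" "C' \<in> \<C>" "D' \<in> \<D>" using \<open>E \<in> \<E>\<close> unfolding \<E>_def by auto
      then show ?thesis
        by (metis C(3,4) D(3,4) affine_map_on_pair affine_map_on_subset inf_le1 inf_le2 polytope_Int)
    qed
    moreover have "finite \<E>" using C(1) D(1) by (simp add: \<E>_def)
    ultimately show ?thesis unfolding pl_at_def by blast
  qed
  ultimately show ?thesis by (simp add: pl_map_on_iff)
qed

lemma nbhd_in_unit_cbox: "nbhd_in UNIV (x::'a::euclidean_space) (cbox (x - One) (x + One))"
proof -
  have "x \<in> box (x - One) (x + One)" by (auto simp: mem_box inner_simps)
  then show ?thesis unfolding nbhd_in_def using box_subset_cbox open_box
    by (metis open_openin subset_UNIV subtopology_UNIV)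
qed

lemma pl_map_on_linear:
  fixes L :: "'a::euclidean_space \<Rightarrow> 'b::euclidean_space"
  assumes "linear L" shows "pl_map_on UNIV L"
proof -
  have "pl_at UNIV L x" for x
    unfolding pl_at_def
    by (rule exI[of _ "{cbox (x - One) (x + One)}"])
      (use nbhd_in_unit_cbox affine_map_on_affine[OF assms, of _ 0] polytope_interval in auto)
  then show ?thesis using assms by (simp add: pl_map_on_iff linear_continuous_on linear_linear)
qed

lemma pl_map_on_linear_o:
  fixes L :: "'a::euclidean_space \<Rightarrow> 'b::euclidean_space"
  assumes "linear L" "pl_map_on X f" shows "pl_map_on X (\<lambda>x. L (f x))"
  by (rule pl_map_on_compose'[OF assms(2) pl_map_on_linear[OF assms(1)]]) auto

text \<open>Even a constant is \<open>pl_map_on X\<close> only if \<open>X\<close> is locally a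
  finite union of polytopes; a given map \<open>g\<close> on \<open>X\<close> serves as the witness.
  The same device appears in \<open>pl_map_on_sum\<close>, \<open>pl_map_on_vec\<close> and
  \<open>pl_map_on_id\<close>.\<close>

lemma pl_map_on_const:
  assumes "pl_map_on X (g::'a::euclidean_space \<Rightarrow> 'b::euclidean_space)"
  shows "pl_map_on X (\<lambda>x. c :: 'c::euclidean_space)"
proof -
  have "affine_map_on C (\<lambda>x. c)" for C :: "'a set"
    using affine_map_on_affine[OF linear_zero, of C c] by simp
  then show ?thesis using assms unfolding pl_map_on_def by (metis continuous_on_const)
qed

lemma pl_map_on_add:
  fixes f g :: "'a::euclidean_space \<Rightarrow> 'b::euclidean_space"
  assumes "pl_map_on X f" "pl_map_on X g" shows "pl_map_on X (\<lambda>x. f x + g x)"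
proof -
  have "linear (\<lambda>z::'b \<times> 'b. fst z + snd z)" by (intro linearI) (auto simp: algebra_simps)
  from pl_map_on_linear_o[OF this pl_map_on_pair[OF assms]] show ?thesis by simp
qed

lemma pl_map_on_cmul:
  fixes f :: "'a::euclidean_space \<Rightarrow> 'b::euclidean_space"
  assumes "pl_map_on X f" shows "pl_map_on X (\<lambda>x. c *\<^sub>R f x)"
  using pl_map_on_linear_o[OF linear_scaleR[of c] assms] .

lemma pl_map_on_cmult:
  fixes f :: "'a::euclidean_space \<Rightarrow> real"
  assumes "pl_map_on X f" shows "pl_map_on X (\<lambda>x. c * f x)"
  using pl_map_on_cmul[OF assms, of c] by simp

lemma pl_map_on_diff:
  fixes f g :: "'a::euclidean_space \<Rightarrow> 'b::euclidean_space"
  assumes "pl_map_on X f" "pl_map_on X g" shows "pl_map_on X (\<lambda>x. f x - g x)"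
  using pl_map_on_add[OF assms(1) pl_map_on_cmul[OF assms(2), of "-1"]] by simp

lemma pl_map_on_abs_UNIV: "pl_map_on UNIV (abs :: real \<Rightarrow> real)"
proof -
  have "pl_at UNIV (abs :: real \<Rightarrow> real) x" for x
  proof -
    have "affine_map_on {max 0 (x - 1)..x + 1} (abs::real\<Rightarrow>real)" "affine_map_on {x - 1..min 0 (x + 1)} (abs::real\<Rightarrow>real)"
      unfolding affine_map_on_def using linear_id[where 'a=real] linear_uminus[where 'a=real]
      by (force simp: id_def)+
    moreover have "{max 0 (x - 1)..x + 1} \<union> {x - 1..min 0 (x + 1)} = cbox (x - One) (x + One)"
      by auto
    ultimately show ?thesis
      unfolding pl_at_def
      by (intro exI[of _ "{{max 0 (x - 1)..x + 1}, {x - 1..min 0 (x + 1)}}"])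
        (use nbhd_in_unit_cbox[of x] polytope_interval[where 'a=real] in auto)
  qed
  then show ?thesis by (simp add: pl_map_on_iff continuous_intros)
qed

lemma pl_map_on_abs:
  fixes f :: "'a::euclidean_space \<Rightarrow> real"
  assumes "pl_map_on X f" shows "pl_map_on X (\<lambda>x. \<bar>f x\<bar>)"
  by (rule pl_map_on_compose'[OF assms pl_map_on_abs_UNIV]) auto

lemma pl_map_on_max:
  fixes f g :: "'a::euclidean_space \<Rightarrow> real"
  assumes "pl_map_on X f" "pl_map_on X g" shows "pl_map_on X (\<lambda>x. max (f x) (g x))"
proof -
  have "max a b = (1/2) * ((a + b) + \<bar>a - b\<bar>)" for a b :: real by (auto simp: max_def abs_if)
  then have "(\<lambda>x. max (f x) (g x)) = (\<lambda>x. (1/2) * ((f x + g x) + \<bar>f x - g x\<bar>))" by blast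
  then show ?thesis
    using pl_map_on_cmult[OF pl_map_on_add[OF pl_map_on_add[OF assms] pl_map_on_abs[OF pl_map_on_diff[OF assms]]], of "1/2"]
    by metis
qed

lemma pl_map_on_vec_nth:
  assumes "pl_map_on X (f :: 'a::euclidean_space \<Rightarrow> real^'n)" shows "pl_map_on X (\<lambda>x. f x $ l)"
  by (rule pl_map_on_linear_o[OF _ assms]) (auto intro: linearI)

lemma pl_map_on_sum:
  fixes f :: "'i \<Rightarrow> 'a::euclidean_space \<Rightarrow> 'b::euclidean_space"
  assumes "pl_map_on X (g :: 'a \<Rightarrow> 'a)" "\<And>l. l \<in> I \<Longrightarrow> pl_map_on X (f l)"
  shows "pl_map_on X (\<lambda>x. \<Sum>l\<in>I. f l x)"
  using assms(2)
proof (induction I rule: infinite_finite_induct)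
  case (insert l I)
  then show ?case using pl_map_on_add[of X "f l"] by simp
qed (auto intro: pl_map_on_const[OF assms(1)])

lemma pl_map_on_vec:
  fixes f :: "'a::euclidean_space \<Rightarrow> real^'n"
  assumes "pl_map_on X (g :: 'a \<Rightarrow> 'a)" "\<And>l. pl_map_on X (\<lambda>x. f x $ l)"
  shows "pl_map_on X f"
proof -
  have "f x = (\<Sum>l\<in>UNIV. f x $ l *\<^sub>R axis l 1)" for x
    by (simp add: vec_eq_iff axis_def if_distrib cong: if_cong)
  moreover have "pl_map_on X (\<lambda>x. \<Sum>l\<in>UNIV. f x $ l *\<^sub>R axis l (1::real))"
    by (rule pl_map_on_sum[OF assms(1)])
      (rule pl_map_on_linear_o[OF _ assms(2), of "\<lambda>t. t *\<^sub>R axis l 1" for l],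
       auto intro!: linearI simp: algebra_simps)
  ultimately show ?thesis by presburger
qed

lemma pl_map_on_id:
  assumes "pl_map_on X f" shows "pl_map_on X (\<lambda>x. x)"
proof -
  have "affine_map_on C (\<lambda>x. x)" for C :: "'a set"
    using affine_map_on_affine[OF linear_id, of C 0] by simp
  then show ?thesis using assms unfolding pl_map_on_def by (metis continuous_on_id)
qed

lemma pl_map_on_restrict:
  assumes "pl_map_on X f" "pl_map_on Y (\<lambda>x. x)" "Y \<subseteq> X" shows "pl_map_on Y f"
  using pl_map_on_compose'[OF assms(2,1)] assms(3) by auto

lemma pl_map_on_preimage:
  assumes "pl_map_on X f" "pl_map_on Y g" shows "pl_map_on {x \<in> X. f x \<in> Y} f"
  using pl_map_on_compose[OF assms(1) pl_map_on_id[OF assms(2)]] .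

lemma pl_map_on_Int:
  assumes "pl_map_on X f" "pl_map_on Y g" shows "pl_map_on (X \<inter> Y) f"
proof -
  have "pl_map_on {x \<in> X. x \<in> Y} (\<lambda>x. x)"
    using pl_map_on_compose[OF pl_map_on_id[OF assms(1)] pl_map_on_id[OF assms(2)]] .
  moreover have "{x \<in> X. x \<in> Y} = X \<inter> Y" by auto
  ultimately show ?thesis using pl_map_on_restrict[OF assms(1)] by auto
qed

lemma pl_map_on_polytope:
  assumes "polytope P" shows "pl_map_on P (\<lambda>x. x)"
proof -
  have "affine_map_on P (\<lambda>x. x)"
    using affine_map_on_affine[OF linear_id, of P 0] by simp
  then show ?thesis
    unfolding pl_map_on_def nbhd_in_def
    by (auto intro!: exI[of _ "{P}"] exI[of _ P] simp: assms)
qed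

section \<open>Piecewise linearity as a local property\<close>

lemma pl_at_local:
  assumes X': "X' \<subseteq> X" "pl_at X' f x" and V: "openin (top_of_set X) V" "x \<in> V" "V \<subseteq> X'"
    and eq: "\<And>y. y \<in> V \<Longrightarrow> g y = f y"
  shows "pl_at X g x"
proof -
  obtain \<C> where C: "finite \<C>" "nbhd_in X' x (\<Union>\<C>)" "\<And>C. C \<in> \<C> \<Longrightarrow> polytope C"
      "\<And>C. C \<in> \<C> \<Longrightarrow> affine_map_on C f"
    using X'(2) unfolding pl_at_def by blast
  obtain W where W: "openin (top_of_set X') W" "x \<in> W" "W \<subseteq> \<Union>\<C>" and CX: "\<Union>\<C> \<subseteq> X'"
    using C(2) unfolding nbhd_in_def by blast
  obtain T where T: "open T" "V = X \<inter> T" using V(1) unfolding openin_open by blast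
  obtain a b where ab: "x \<in> box a b" "cbox a b \<subseteq> T"
    using T V(2) open_contains_cbox[of T x] by (metis IntD2)
  \<comment> \<open>Cutting by a box keeps the pieces polytopes and shrinks them into
    \<open>V\<close>, where \<open>g\<close> agrees with \<open>f\<close>.\<close>
  define \<E> where "\<E> = (\<lambda>C. C \<inter> cbox a b) ` \<C>"
  have UE: "\<Union>\<E> = \<Union>\<C> \<inter> cbox a b" unfolding \<E>_def by auto
  obtain S where S: "open S" "W = X' \<inter> S" using W(1) unfolding openin_open by blast
  have "V \<inter> S \<inter> box a b \<subseteq> \<Union>\<E>"
    unfolding UE using V(3) S(2) W(3) box_subset_cbox by blast
  moreover have "openin (top_of_set X) (V \<inter> (S \<inter> box a b))"
    using V(1) S(1) by (meson open_Int open_box openin_Int_open)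
  moreover have "x \<in> V \<inter> (S \<inter> box a b)" using V(2) W(2) S(2) ab(1) by blast
  moreover have "\<Union>\<E> \<subseteq> X" unfolding UE using CX X'(1) by blast
  ultimately have "nbhd_in X x (\<Union>\<E>)" unfolding nbhd_in_def by (metis inf_assoc)
  moreover have "polytope E \<and> affine_map_on E g" if "E \<in> \<E>" for E
  proof -
    obtain C' where E: "E = C' \<inter> cbox a b" "C' \<in> \<C>" using \<open>E \<in> \<E>\<close> unfolding \<E>_def by auto
    have "E \<subseteq> V" using E CX X'(1) T(2) ab(2) by blast
    then show ?thesis
      using C(3,4)[OF E(2)] E(1) affine_map_on_subset[of C' f E] affine_map_on_cong[of E f g] eq
      by (metis inf_le1 polytope_Int polytope_interval subsetD)
  qed
  moreover have "finite \<E>" using C(1) by (simp add: \<E>_def)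
  ultimately show ?thesis unfolding pl_at_def by blast
qed

text \<open>This pastes functions defined by cases: near every point the function only has to agree
  with some map known to be piecewise linear, and that map may change from point to point.\<close>

lemma pl_map_on_local:
  assumes "\<And>x. x \<in> X \<Longrightarrow> \<exists>V X' f. openin (top_of_set X) V \<and> x \<in> V \<and> V \<subseteq> X' \<and> X' \<subseteq> X \<and>
      pl_map_on X' f \<and> (\<forall>y\<in>V. g y = f y)"
  shows "pl_map_on X g"
proof -
  have "pl_at X g x" if "x \<in> X" for x
    using assms[OF that] pl_at_local[of _ X _ x _ g] unfolding pl_map_on_iff by (metis subsetD)
  moreover have "continuous_on X g"
    unfolding continuous_on_eq_continuous_within
  proof
    fix x assume "x \<in> X"
    then obtain V X' f where V: "openin (top_of_set X) V" "x \<in> V" "V \<subseteq> X'" "pl_map_on X' f" "\<forall>y\<in>V. g y = f y"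
      using assms by meson
    have "continuous_on V f" using V(3,4) continuous_on_subset pl_map_on_continuous by blast
    then have "continuous_on V g" using V(5) continuous_on_cong by metis
    show "continuous (at x within X) g"
    proof -
      obtain T where T: "open T" "V = X \<inter> T" using V(1) unfolding openin_open by blast
      have "at x within V = at x within X"
        by (rule at_within_nhd[of x T]) (use T V(2) in auto)
      then show ?thesis
        using \<open>continuous_on V g\<close> V(2) unfolding continuous_on_eq_continuous_within by auto
    qed
  qed
  ultimately show ?thesis by (simp add: pl_map_on_iff)
qed

lemma polytope_pl_ball: "polytope (pl_ball :: (real^'n) set)"
  unfolding pl_ball_def by (rule polytope_interval)


section \<open>Charts and local flatness\<close>

lemma pl_homeomorphismI:
  assumes "pl_map_on X f" "pl_map_on Y g" "\<And>x. x \<in> X \<Longrightarrow> f x \<in> Y" "\<And>y. y \<in> Y \<Longrightarrow> g y \<in> X"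
    "\<And>x. x \<in> X \<Longrightarrow> g (f x) = x" "\<And>y. y \<in> Y \<Longrightarrow> f (g y) = y"
  shows "pl_homeomorphism X Y f g"
  unfolding pl_homeomorphism_def
  using assms by (auto intro!: homeomorphismI dest: pl_map_on_continuous)

lemma pl_homeomorphismD:
  assumes "pl_homeomorphism X Y f g"
  shows "pl_map_on X f" "pl_map_on Y g" "\<And>x. x \<in> X \<Longrightarrow> f x \<in> Y" "\<And>y. y \<in> Y \<Longrightarrow> g y \<in> X"
    "\<And>x. x \<in> X \<Longrightarrow> g (f x) = x" "\<And>y. y \<in> Y \<Longrightarrow> f (g y) = y" "f ` X = Y" "g ` Y = X"
    "homeomorphism X Y f g" "continuous_on X f" "continuous_on Y g"
  using assms unfolding pl_homeomorphism_def homeomorphism_def by auto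

lemma pl_map_on_Times:
  fixes f :: "'a::euclidean_space \<Rightarrow> 'b::euclidean_space" and g :: "'c::euclidean_space \<Rightarrow> 'd::euclidean_space"
  assumes "pl_map_on X f" "pl_map_on Y g"
  shows "pl_map_on (X \<times> Y) (\<lambda>z. (f (fst z), g (snd z)))"
proof -
  have 1: "pl_map_on {z \<in> UNIV. fst z \<in> X} (\<lambda>z. f (fst z))"
    by (rule pl_map_on_compose[OF pl_map_on_linear[OF linear_fst] assms(1)])
  have 2: "pl_map_on {z \<in> UNIV. snd z \<in> Y} (\<lambda>z. g (snd z))"
    by (rule pl_map_on_compose[OF pl_map_on_linear[OF linear_snd] assms(2)])
  have "X \<times> Y = {z \<in> UNIV. fst z \<in> X} \<inter> {z \<in> UNIV. snd z \<in> Y}" by auto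
  then show ?thesis
    using pl_map_on_pair[OF pl_map_on_Int[OF 1 2]] pl_map_on_Int[OF 2 1] by (metis Int_commute)
qed

section \<open>Coordinates in dimensions three and four\<close>

definition vec3 :: "real \<Rightarrow> real \<Rightarrow> real \<Rightarrow> real^3" where
  "vec3 a b c = (\<chi> j. if j = 1 then a else if j = 2 then b else c)"

definition vec4 :: "real \<Rightarrow> real \<Rightarrow> real \<Rightarrow> real \<Rightarrow> real^4" where
  "vec4 a b c d = (\<chi> j. if j = 1 then a else if j = 2 then b else if j = 3 then c else d)"

lemma vec3_nth [simp]: "vec3 a b c $ 1 = a" "vec3 a b c $ 2 = b" "vec3 a b c $ 3 = c"
  by (simp_all add: vec3_def)

lemma vec4_nth [simp]: "vec4 a b c d $ 1 = a" "vec4 a b c d $ 2 = b" "vec4 a b c d $ 3 = c"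
    "vec4 a b c d $ 4 = d"
  by (simp_all add: vec4_def)

lemma vec3_eq_iff: "v = w \<longleftrightarrow> v$1 = w$1 \<and> v$2 = w$2 \<and> v$3 = w$3" for v w :: "real^3"
  by (simp add: vec_eq_iff forall_3)

lemma vec4_eq_iff: "v = w \<longleftrightarrow> v$1 = w$1 \<and> v$2 = w$2 \<and> v$3 = w$3 \<and> v$4 = w$4" for v w :: "real^4"
  by (simp add: vec_eq_iff forall_4)

lemma pl_map_on_vec3:
  assumes "pl_map_on X a" "pl_map_on X b" "pl_map_on X c"
  shows "pl_map_on X (\<lambda>x. vec3 (a x) (b x) (c x))"
proof (rule pl_map_on_vec[OF pl_map_on_id[OF assms(1)]])
  show "pl_map_on X (\<lambda>x. vec3 (a x) (b x) (c x) $ l)" for l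
    using exhaust_3[of l] assms by auto
qed

lemma pl_map_on_vec4:
  assumes "pl_map_on X a" "pl_map_on X b" "pl_map_on X c" "pl_map_on X d"
  shows "pl_map_on X (\<lambda>x. vec4 (a x) (b x) (c x) (d x))"
proof (rule pl_map_on_vec[OF pl_map_on_id[OF assms(1)]])
  show "pl_map_on X (\<lambda>x. vec4 (a x) (b x) (c x) (d x) $ l)" for l
    using exhaust_4[of l] assms by auto
qed

lemma mem_pl_ball: "v \<in> pl_ball \<longleftrightarrow> (\<forall>l. \<bar>v$l\<bar> \<le> 1)"
  by (auto simp: pl_ball_def mem_box_cart abs_le_iff)

lemma mem_unit_box: "v \<in> box (-1) (1::real^'n) \<longleftrightarrow> (\<forall>l. \<bar>v$l\<bar> < 1)"
  by (auto simp: mem_box_cart abs_less_iff)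

lemma mem_half_ball: "v \<in> half_ball \<longleftrightarrow> v \<in> pl_ball \<and> 0 \<le> v$3"
  unfolding half_ball_def by auto

lemma pl_map_on_pl_ball: "pl_map_on pl_ball (\<lambda>x. x)"
  by (rule pl_map_on_polytope[OF polytope_pl_ball])

lemma pl_map_on_half: "pl_map_on (pl_ball \<inter> {v :: real^'n. 0 \<le> v$l}) (\<lambda>x. x)"
proof (rule pl_map_on_polytope)
  have "{v :: real^'n. 0 \<le> v$l} = {v. axis l 1 \<bullet> v \<ge> 0}" by (simp add: inner_axis')
  then have "polyhedron {v :: real^'n. 0 \<le> v$l}" by (metis polyhedron_halfspace_ge)
  then show "polytope (pl_ball \<inter> {v :: real^'n. 0 \<le> v$l})"
    using polytope_pl_ball[where 'n='n] by (auto simp: bounded_Int polytope_eq_bounded_polyhedron)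
qed

text \<open>Invariance of domain: the transition map carries an open subset of Euclidean space
  injectively into the cube, so the image is open and lies in the interior of the cube.\<close>

lemma chart_interior_independent:
  fixes f f' :: "'a::euclidean_space \<Rightarrow> real^'n"
  assumes N: "nbhd_in X x N" "homeomorphism N pl_ball f g" "f x \<in> box (-1) 1"
    and N': "nbhd_in X x N'" "homeomorphism N' pl_ball f' g'"
  shows "f' x \<in> box (-1) 1"
proof -
  obtain V where V: "openin (top_of_set X) V" "x \<in> V" "V \<subseteq> N" and NX: "N \<subseteq> X"
    using N(1) unfolding nbhd_in_def by blast
  obtain V' where V': "openin (top_of_set X) V'" "x \<in> V'" "V' \<subseteq> N'"
    using N'(1) unfolding nbhd_in_def by blast
  let ?O = "V \<inter> V'"
  have O: "openin (top_of_set N) ?O"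
    using openin_subset_trans[OF openin_Int[OF V(1) V'(1)] _ NX] V(3) by blast
  have "openin (top_of_set pl_ball) (f ` ?O)"
    by (rule homeomorphism_imp_open_map[OF N(2) O])
  then obtain T where T: "open T" "f ` ?O = pl_ball \<inter> T" unfolding openin_open by blast
  \<comment> \<open>Relatively open subsets of the cube need not be open in Euclidean space; inside
    the open cube they are.\<close>
  let ?D = "f ` ?O \<inter> box (-1) 1"
  have "?D = T \<inter> box (-1) 1" using T(2) box_subset_cbox unfolding pl_ball_def by blast
  then have D: "open ?D" using T(1) by (simp only: open_Int open_box)
  have gD: "g y \<in> ?O" if "y \<in> ?D" for y
    using that V(3) homeomorphism_apply1[OF N(2)] by auto
  have "continuous_on ?D (f' \<circ> g)"
  proof (rule continuous_on_compose)
    have "?D \<subseteq> pl_ball" unfolding pl_ball_def using box_subset_cbox by blast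
    then show "continuous_on ?D g" by (rule continuous_on_subset[OF homeomorphism_cont2[OF N(2)]])
    have "g ` ?D \<subseteq> N'" using gD V'(3) by blast
    then show "continuous_on (g ` ?D) f'" by (rule continuous_on_subset[OF homeomorphism_cont1[OF N'(2)]])
  qed
  moreover have "inj_on (f' \<circ> g) ?D"
  proof (rule inj_onI)
    fix y z assume y: "y \<in> ?D" and z: "z \<in> ?D" and eq: "(f' \<circ> g) y = (f' \<circ> g) z"
    have "g y = g z" using eq gD[OF y] gD[OF z] V'(3) homeomorphism_apply1[OF N'(2)] by (metis IntD2 comp_apply subsetD)
    then show "y = z" using y z V(3) homeomorphism_apply1[OF N(2)] by (auto simp: subset_iff)
  qed
  ultimately have "open ((f' \<circ> g) ` ?D)" using D invariance_of_domain by blast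
  moreover have "(f' \<circ> g) ` ?D \<subseteq> pl_ball"
    using gD V'(3) homeomorphism_image1[OF N'(2)] by auto
  ultimately have "(f' \<circ> g) ` ?D \<subseteq> box (-1) 1"
    unfolding pl_ball_def by (metis interior_cbox interior_maximal)
  moreover have "f x \<in> ?D" using V(2) V'(2) N(3) by blast
  moreover have "g (f x) = x" using V(2,3) homeomorphism_apply1[OF N(2)] by blast
  ultimately show ?thesis by (metis comp_apply image_subset_iff)
qed

text \<open>The height becomes a fourth coordinate, centred at \<open>t\<close>. It vanishes at the
  base point, so whether that point is interior is decided by \<open>f p\<close> alone.\<close>

lemma product_chart:
  fixes f :: "'m::euclidean_space \<Rightarrow> real^3"
  assumes N: "nbhd_in M p N" and f: "pl_homeomorphism N pl_ball f g"
  shows "\<exists>N' f' g'. nbhd_in (M \<times> (UNIV::real set)) (p, t) N' \<and>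
    pl_homeomorphism N' (pl_ball :: (real^4) set) f' g' \<and>
    (f' (p, t) \<in> box (-1) 1 \<longleftrightarrow> f p \<in> box (-1) 1)"
proof -
  note fD = pl_homeomorphismD[OF f]
  define f' where "f' z = vec4 (f (fst z) $ 1) (f (fst z) $ 2) (f (fst z) $ 3) (snd z - t)" for z :: "'m \<times> real"
  define g' where "g' w = (g (vec3 (w$1) (w$2) (w$3)), w$4 + t)" for w :: "real^4"
  let ?N = "N \<times> {t-1..t+1}"
  have I: "pl_map_on {t-1..t+1} (\<lambda>x. x)"
    using pl_map_on_polytope[OF polytope_interval[of "t-1" "t+1"]] by simp
  have prod: "pl_map_on ?N (\<lambda>z. (f (fst z), snd z))"
    using pl_map_on_Times[OF fD(1) I] .
  have fst': "pl_map_on ?N (\<lambda>z. f (fst z))" using pl_map_on_linear_o[OF linear_fst prod] by simp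
  have snd': "pl_map_on ?N snd" using pl_map_on_linear_o[OF linear_snd prod] by simp
  have f': "pl_map_on ?N f'"
    unfolding f'_def
    by (intro pl_map_on_vec4 pl_map_on_vec_nth fst' pl_map_on_diff snd' pl_map_on_const[OF snd'])
  have id4: "pl_map_on (pl_ball::(real^4) set) (\<lambda>w. w)" by (rule pl_map_on_pl_ball)
  have g': "pl_map_on pl_ball g'"
    unfolding g'_def
  proof (intro pl_map_on_pair pl_map_on_add pl_map_on_vec_nth id4 pl_map_on_const[OF id4])
    show "pl_map_on pl_ball (\<lambda>x::real^4. g (vec3 (x $ 1) (x $ 2) (x $ 3)))"
      by (rule pl_map_on_compose'[OF _ fD(2)])
        (auto intro!: pl_map_on_vec3 pl_map_on_vec_nth id4 simp: mem_pl_ball forall_3 forall_4)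
  qed
  have hom: "pl_homeomorphism ?N pl_ball f' g'"
  proof (rule pl_homeomorphismI[OF f' g'])
    show "f' z \<in> pl_ball" if "z \<in> ?N" for z
      using that fD(3)[of "fst z"] by (auto simp: f'_def mem_pl_ball forall_3 forall_4 abs_le_iff)
    show "g' w \<in> ?N" if "w \<in> pl_ball" for w
    proof -
      have "vec3 (w$1) (w$2) (w$3) \<in> pl_ball" using that by (auto simp: mem_pl_ball forall_3 forall_4)
      then show ?thesis using that fD(4) unfolding g'_def by (auto simp: mem_pl_ball forall_4 abs_le_iff)
    qed
    show "g' (f' z) = z" if "z \<in> ?N" for z
    proof -
      have "vec3 (f (fst z) $ 1) (f (fst z) $ 2) (f (fst z) $ 3) = f (fst z)" by (simp add: vec3_eq_iff)
      then show ?thesis using that fD(5) by (auto simp: f'_def g'_def)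
    qed
    show "f' (g' w) = w" if "w \<in> pl_ball" for w
    proof -
      have "vec3 (w$1) (w$2) (w$3) \<in> pl_ball" using that by (auto simp: mem_pl_ball forall_3 forall_4)
      then show ?thesis using fD(6) by (auto simp: f'_def g'_def vec4_eq_iff)
    qed
  qed
  have "nbhd_in (M \<times> UNIV) (p, t) ?N"
  proof -
    obtain V where V: "openin (top_of_set M) V" "p \<in> V" "V \<subseteq> N" and NX: "N \<subseteq> M"
      using N unfolding nbhd_in_def by blast
    have "openin (top_of_set (M \<times> UNIV)) (V \<times> {t-1<..<t+1})"
      by (rule openin_Times[OF V(1)]) simp
    then show ?thesis unfolding nbhd_in_def using V NX
      by (intro conjI exI[of _ "V \<times> {t-1<..<t+1}"]) auto
  qed
  moreover have "f' (p, t) \<in> box (-1) 1 \<longleftrightarrow> f p \<in> box (-1) 1"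
    unfolding mem_unit_box by (simp add: f'_def forall_3 forall_4)
  ultimately show ?thesis using hom by blast
qed

text \<open>Needed for the properness of a lift. Interior points are defined by the existence of one
  suitable chart, so on the way down from the product to \<open>M\<close> the given chart is traded
  for a product chart by \<open>chart_interior_independent\<close>.\<close>

lemma mf_boundary_Times_line:
  assumes M: "pl_manifold TYPE(3) M" and p: "p \<in> M"
  shows "(p, t) \<in> mf_boundary TYPE(4) (M \<times> (UNIV::real set)) \<longleftrightarrow> p \<in> mf_boundary TYPE(3) M"
proof -
  have "(p, t) \<in> mf_interior TYPE(4) (M \<times> (UNIV::real set)) \<longleftrightarrow> p \<in> mf_interior TYPE(3) M"
  proof
    assume "p \<in> mf_interior TYPE(3) M"
    then obtain N and f :: "'a \<Rightarrow> real^3" and g where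
      "nbhd_in M p N" "pl_homeomorphism N pl_ball f g" "f p \<in> box (-1) 1"
      unfolding mf_interior_def by blast
    then show "(p, t) \<in> mf_interior TYPE(4) (M \<times> (UNIV::real set))"
      using product_chart[of M p N f g t] p unfolding mf_interior_def by blast
  next
    assume "(p, t) \<in> mf_interior TYPE(4) (M \<times> (UNIV::real set))"
    then obtain N' and f' :: "'a \<times> real \<Rightarrow> real^4" and g' where
      N': "nbhd_in (M \<times> UNIV) (p, t) N'" "pl_homeomorphism N' pl_ball f' g'" "f' (p, t) \<in> box (-1) 1"
      unfolding mf_interior_def by blast
    obtain N and f :: "'a \<Rightarrow> real^3" and g where N: "nbhd_in M p N" "pl_homeomorphism N pl_ball f g"
      using M p unfolding pl_manifold_def by blast
    obtain N2 and f2 :: "'a \<times> real \<Rightarrow> real^4" and g2 where N2: "nbhd_in (M \<times> UNIV) (p, t) N2"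
        "pl_homeomorphism N2 pl_ball f2 g2" "f2 (p, t) \<in> box (-1) 1 \<longleftrightarrow> f p \<in> box (-1) 1"
      using product_chart[OF N, of t] by blast
    have "f2 (p, t) \<in> box (-1) 1"
      using chart_interior_independent[of "M \<times> UNIV" "(p, t)" N' f' g' N2 f2 g2] N' N2(1,2)
      by (simp add: pl_homeomorphism_def)
    then show "p \<in> mf_interior TYPE(3) M" using N2(3) N p unfolding mf_interior_def by blast
  qed
  then show ?thesis unfolding mf_boundary_def using p by auto
qed

text \<open>Flatness may be tested after a piecewise linear homeomorphism \<open>\<Phi>\<close> of
  the whole column \<open>B \<times> UNIV\<close>, such as a shear. Its image \<open>Y\<close> has
  to look like the space or a half-space only in the cube of size \<open>\<epsilon>\<close> about 0,
  which is then rescaled to the unit cube.\<close>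

lemma locally_flat_chart:
  fixes f :: "'m::euclidean_space \<Rightarrow> real^3" and \<Phi> :: "(real^3) \<times> real \<Rightarrow> real^4"
  assumes N: "nbhd_in M p N" and f: "pl_homeomorphism N B f g" and fp: "f p = 0"
    and \<Phi>: "pl_homeomorphism (B \<times> UNIV) Y \<Phi> \<Psi>" and \<Phi>0: "\<Phi> (0, t0) = 0"
    and H: "H = UNIV \<or> H = {w. 0 \<le> w$1}" and \<epsilon>: "0 < \<epsilon>"
    and Y: "\<And>w. (\<forall>l. \<bar>w$l\<bar> \<le> \<epsilon>) \<Longrightarrow> w \<in> Y \<longleftrightarrow> w \<in> H"
    and T: "\<And>m s. m \<in> N \<Longrightarrow> (\<forall>l. \<bar>\<Phi> (f m, s) $ l\<bar> \<le> \<epsilon>) \<Longrightarrow>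
        (m, s) \<in> T \<longleftrightarrow> \<Phi> (f m, s) $ 3 = 0 \<and> \<Phi> (f m, s) $ 4 = 0"
  shows "locally_flat_at (M \<times> UNIV) T (p, t0)"
proof -
  note fD = pl_homeomorphismD[OF f] and \<Phi>D = pl_homeomorphismD[OF \<Phi>]
  define c where "c z = \<Phi> (f (fst z), snd z)" for z
  define N' where "N' = {z \<in> N \<times> UNIV. c z \<in> cbox (- (\<epsilon> *\<^sub>R 1)) (\<epsilon> *\<^sub>R 1)}"
  define B' where "B' = pl_ball \<inter> H"
  define f' where "f' z = (1/\<epsilon>) *\<^sub>R c z" for z
  define g' where "g' w = (g (fst (\<Psi> (\<epsilon> *\<^sub>R w))), snd (\<Psi> (\<epsilon> *\<^sub>R w)))" for w
  have "\<bar>x\<bar> \<le> \<epsilon> \<longleftrightarrow> - \<epsilon> \<le> x \<and> x \<le> \<epsilon>" "\<bar>x\<bar> < \<epsilon> \<longleftrightarrow> - \<epsilon> < x \<and> x < \<epsilon>" for x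
    by linarith+
  then have mem: "w \<in> cbox (- (\<epsilon> *\<^sub>R 1)) (\<epsilon> *\<^sub>R 1) \<longleftrightarrow> (\<forall>l. \<bar>w$l\<bar> \<le> \<epsilon>)"
    and memo: "w \<in> box (- (\<epsilon> *\<^sub>R 1)) (\<epsilon> *\<^sub>R 1) \<longleftrightarrow> (\<forall>l. \<bar>w$l\<bar> < \<epsilon>)" for w :: "real^4"
    by (simp_all add: mem_box_cart)
  have prod: "pl_map_on (N \<times> UNIV) (\<lambda>z. (f (fst z), snd z))"
    using pl_map_on_Times[OF fD(1) pl_map_on_linear[OF linear_id]] by simp
  have c: "pl_map_on (N \<times> UNIV) c"
    unfolding c_def by (rule pl_map_on_compose'[OF prod \<Phi>D(1)]) (use fD(3) in auto)
  have cN: "c z \<in> Y" if "z \<in> N \<times> UNIV" for z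
    using that fD(3) \<Phi>D(3) unfolding c_def by auto
  have \<Psi>c: "\<Psi> (c z) = (f (fst z), snd z)" if "z \<in> N \<times> UNIV" for z
    using that fD(3) \<Phi>D(5) unfolding c_def by auto
  have "pl_map_on N' c"
    unfolding N'_def by (rule pl_map_on_preimage[OF c pl_map_on_polytope[OF polytope_interval]])
  then have f': "pl_map_on N' f'" unfolding f'_def by (rule pl_map_on_cmul)
  have idB: "pl_map_on B' (\<lambda>x. x)"
    using H pl_map_on_pl_ball pl_map_on_half unfolding B'_def by auto
  have scale: "\<epsilon> *\<^sub>R w \<in> cbox (- (\<epsilon> *\<^sub>R 1)) (\<epsilon> *\<^sub>R 1) \<and> \<epsilon> *\<^sub>R w \<in> Y" if "w \<in> B'" for w
  proof -
    have 1: "\<bar>(\<epsilon> *\<^sub>R w) $ l\<bar> \<le> \<epsilon>" for l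
      using that \<epsilon> unfolding B'_def by (auto simp: mem_pl_ball abs_mult mult_le_cancel_left1)
    have "\<epsilon> *\<^sub>R w \<in> H" using that H \<epsilon> unfolding B'_def by auto
    then show ?thesis using 1 Y[of "\<epsilon> *\<^sub>R w"] mem by blast
  qed
  have \<Psi>s: "pl_map_on B' (\<lambda>w. \<Psi> (\<epsilon> *\<^sub>R w))"
    by (rule pl_map_on_compose'[OF pl_map_on_cmul[OF idB] \<Phi>D(2)]) (use scale in auto)
  have \<Psi>B: "fst (\<Psi> (\<epsilon> *\<^sub>R w)) \<in> B" if "w \<in> B'" for w
    using scale[OF that] \<Phi>D(4)[of "\<epsilon> *\<^sub>R w"] by (metis mem_Times_iff)
  have g': "pl_map_on B' g'"
    unfolding g'_def
  proof (rule pl_map_on_pair)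
    show "pl_map_on B' (\<lambda>x. g (fst (\<Psi> (\<epsilon> *\<^sub>R x))))"
      by (rule pl_map_on_compose'[OF pl_map_on_linear_o[OF linear_fst \<Psi>s] fD(2)]) (use \<Psi>B in auto)
    show "pl_map_on B' (\<lambda>x. snd (\<Psi> (\<epsilon> *\<^sub>R x)))"
      by (rule pl_map_on_linear_o[OF linear_snd \<Psi>s])
  qed
  have cg: "g' w \<in> N \<times> UNIV" "c (g' w) = \<epsilon> *\<^sub>R w" if "w \<in> B'" for w
    using fD(4)[OF \<Psi>B[OF that]] fD(6)[OF \<Psi>B[OF that]] \<Phi>D(6) scale[OF that]
    unfolding g'_def c_def by auto
  have hom: "pl_homeomorphism N' B' f' g'"
  proof (rule pl_homeomorphismI[OF f' g'])
    show "f' z \<in> B'" if "z \<in> N'" for z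
    proof -
      have z: "\<forall>l. \<bar>c z $ l\<bar> \<le> \<epsilon>" "z \<in> N \<times> UNIV" using that mem unfolding N'_def by auto
      then have "c z \<in> H" using Y cN by blast
      then show ?thesis using z \<epsilon> H unfolding B'_def f'_def
        by (auto simp: mem_pl_ball abs_mult divide_le_eq)
    qed
    show "g' w \<in> N'" if "w \<in> B'" for w
      using cg[OF that] scale[OF that] unfolding N'_def by auto
    show "g' (f' z) = z" if "z \<in> N'" for z
    proof -
      have z: "z \<in> N \<times> UNIV" using that unfolding N'_def by auto
      show ?thesis using \<Psi>c[OF z] z fD(5) \<epsilon> unfolding g'_def f'_def by (auto simp: prod_eq_iff)
    qed
    show "f' (g' w) = w" if "w \<in> B'" for w
      using cg[OF that] \<epsilon> unfolding f'_def by auto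
  qed
  have nb: "nbhd_in (M \<times> UNIV) (p, t0) N'"
  proof -
    obtain V where V: "openin (top_of_set M) V" "p \<in> V" "V \<subseteq> N" and NM: "N \<subseteq> M"
      using N unfolding nbhd_in_def by blast
    have VU: "openin (top_of_set (M \<times> UNIV)) (V \<times> (UNIV::real set))"
      by (rule openin_Times[OF V(1)]) simp
    have "continuous_on (V \<times> UNIV) c"
      using pl_map_on_continuous[OF c] V(3) by (meson continuous_on_subset Sigma_mono subset_refl)
    then have "openin (top_of_set (V \<times> UNIV)) ((V \<times> UNIV) \<inter> c -` box (- (\<epsilon> *\<^sub>R 1)) (\<epsilon> *\<^sub>R 1))"
      by (rule continuous_openin_preimage_gen) (rule open_box)
    then have "openin (top_of_set (M \<times> UNIV)) ((V \<times> UNIV) \<inter> c -` box (- (\<epsilon> *\<^sub>R 1)) (\<epsilon> *\<^sub>R 1))"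
      using VU openin_trans by blast
    moreover have "(p, t0) \<in> (V \<times> UNIV) \<inter> c -` box (- (\<epsilon> *\<^sub>R 1)) (\<epsilon> *\<^sub>R 1)"
      using V(2) fp \<Phi>0 \<epsilon> by (auto simp: c_def memo)
    moreover have "(V \<times> UNIV) \<inter> c -` box (- (\<epsilon> *\<^sub>R 1)) (\<epsilon> *\<^sub>R 1) \<subseteq> N'"
      unfolding N'_def using V(3) box_subset_cbox by blast
    moreover have "N' \<subseteq> M \<times> UNIV" unfolding N'_def using NM by auto
    ultimately show ?thesis unfolding nbhd_in_def by blast
  qed
  have Tc: "z \<in> T \<longleftrightarrow> c z $ 3 = 0 \<and> c z $ 4 = 0" if "z \<in> N'" for z
    using that T[of "fst z" "snd z"] mem unfolding N'_def c_def by auto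
  have "f' ` (N' \<inter> T) = B' \<inter> {v. v$3 = 0 \<and> v$4 = 0}"
  proof (intro equalityI subsetI)
    fix w assume "w \<in> f' ` (N' \<inter> T)"
    then obtain z where z: "z \<in> N'" "z \<in> T" "w = f' z" by blast
    then show "w \<in> B' \<inter> {v. v$3 = 0 \<and> v$4 = 0}"
      using pl_homeomorphismD(3)[OF hom z(1)] Tc[OF z(1)] unfolding f'_def by simp
  next
    fix w assume w: "w \<in> B' \<inter> {v. v$3 = 0 \<and> v$4 = 0}"
    then have "g' w \<in> N'" "f' (g' w) = w" "c (g' w) = \<epsilon> *\<^sub>R w"
      using pl_homeomorphismD(4,6)[OF hom] cg by auto
    moreover have "g' w \<in> T" using w Tc[OF \<open>g' w \<in> N'\<close>] \<open>c (g' w) = \<epsilon> *\<^sub>R w\<close> by simp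
    ultimately show "w \<in> f' ` (N' \<inter> T)" by (metis IntI image_eqI)
  qed
  moreover have "f' (p, t0) = 0" using fp \<Phi>0 by (simp add: f'_def c_def)
  moreover have "B' = pl_ball \<or> B' = pl_ball \<inter> {v. 0 \<le> v$1}" using H unfolding B'_def by auto
  ultimately show ?thesis unfolding locally_flat_at_def using nb hom by blast
qed

text \<open>Projection along the \<open>l\<close>-th axis; composing with it extends a function from
  the sheet to the whole chart.\<close>

definition flatten :: "3 \<Rightarrow> real^3 \<Rightarrow> real^3" where
  "flatten l v = (\<chi> j. if j = l then 0 else v$j)"

lemma flatten_nth [simp]: "flatten l v $ j = (if j = l then 0 else v$j)"
  by (simp add: flatten_def)

text \<open>The shear that subtracts \<open>q\<close>, extended constantly along the axis
  \<open>l\<close>, from the height takes the graph to a coordinate plane. The hypothesis on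
  \<open>T\<close> concerns only points close to the graph, so other sheets may pass at a different
  height.\<close>

lemma locally_flat_graph:
  fixes f :: "'m::euclidean_space \<Rightarrow> real^3"
  assumes N: "nbhd_in M p N" and f: "pl_homeomorphism N B f g" and fp: "f p = 0"
    and B: "B = pl_ball \<or> B = half_ball \<and> l \<noteq> 3"
    and q: "pl_map_on (B \<inter> {v. v$l = 0}) q" and \<delta>: "0 < \<delta>"
    and T: "\<And>m s. m \<in> N \<Longrightarrow> (\<forall>j. \<bar>f m $ j\<bar> \<le> \<delta>) \<Longrightarrow> \<bar>s - q (flatten l (f m))\<bar> \<le> \<delta> \<Longrightarrow>
        (m, s) \<in> T \<longleftrightarrow> f m $ l = 0 \<and> s = q (f m)"
  shows "locally_flat_at (M \<times> UNIV) T (p, q 0)"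
proof -
  \<comment> \<open>\<open>a\<close> is 3 whenever \<open>l\<close> is not: in the half ball the
    constraint on \<open>v$3\<close> then becomes the constraint on \<open>w$1\<close> that
    \<open>locally_flat_at\<close> asks for.\<close>
  define a :: 3 where "a = (if l = 3 then 1 else 3)"
  define b :: 3 where "b = (if l = 2 then 1 else 2)"
  have abl: "a \<noteq> b" "a \<noteq> l" "b \<noteq> l" "\<And>P. (\<forall>j. P j) \<longleftrightarrow> P a \<and> P b \<and> P l"
    using exhaust_3[of l] by (auto simp: a_def b_def forall_3)
  define r :: "real^4 \<Rightarrow> real^3" where "r w = (\<chi> j. if j = l then w$3 else if j = a then w$1 else w$2)" for w
  have r [simp]: "r w $ l = w$3" "r w $ a = w$1" "r w $ b = w$2" for w
    using abl by (auto simp: r_def)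
  define \<Phi> where "\<Phi> z = vec4 (fst z $ a) (fst z $ b) (fst z $ l) (snd z - q (flatten l (fst z)))" for z :: "(real^3) \<times> real"
  define \<Psi> where "\<Psi> w = (r w, w$4 + q (flatten l (r w)))" for w
  define Y where "Y = {w \<in> UNIV. r w \<in> B}"
  have idB: "pl_map_on B (\<lambda>v. v)"
    using B pl_map_on_pl_ball pl_map_on_half unfolding half_ball_def by auto
  have fl: "pl_map_on B (\<lambda>v. flatten l v)"
  proof (rule pl_map_on_vec[OF idB])
    show "pl_map_on B (\<lambda>x. flatten l x $ j)" for j
      using pl_map_on_vec_nth[OF idB] pl_map_on_const[OF idB] by (cases "j = l") auto
  qed
  have flB: "flatten l v \<in> B \<inter> {v. v$l = 0}" if "v \<in> B" for v
    using that B by (auto simp: mem_half_ball mem_pl_ball)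
  have qf: "pl_map_on B (\<lambda>v. q (flatten l v))"
    by (rule pl_map_on_compose'[OF fl q]) (use flB in auto)
  have idp: "pl_map_on (B \<times> (UNIV::real set)) (\<lambda>z. z)"
    using pl_map_on_Times[OF idB pl_map_on_linear[OF linear_id]] by simp
  have fs: "pl_map_on (B \<times> (UNIV::real set)) fst" "pl_map_on (B \<times> (UNIV::real set)) snd"
    using pl_map_on_linear_o[OF linear_fst idp] pl_map_on_linear_o[OF linear_snd idp] by simp_all
  have P: "pl_map_on (B \<times> UNIV) \<Phi>"
    unfolding \<Phi>_def
    by (intro pl_map_on_vec4 pl_map_on_vec_nth fs pl_map_on_diff pl_map_on_compose'[OF fs(1) qf]) auto
  have "linear r"
    by (rule linearI) (auto simp: r_def vec_eq_iff)
  then have r_pl: "pl_map_on Y r" unfolding Y_def by (rule pl_map_on_preimage[OF pl_map_on_linear idB])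
  have Q: "pl_map_on Y \<Psi>"
    unfolding \<Psi>_def
    by (intro pl_map_on_pair r_pl pl_map_on_add pl_map_on_vec_nth[OF pl_map_on_id[OF r_pl]] pl_map_on_compose'[OF r_pl qf])
      (auto simp: Y_def)
  have r_eq: "r (vec4 (v $ a) (v $ b) (v $ l) x) = v" for v x
    using abl(4)[of "\<lambda>j. r (vec4 (v $ a) (v $ b) (v $ l) x) $ j = v $ j"] by (simp add: vec_eq_iff)
  have hom: "pl_homeomorphism (B \<times> UNIV) Y \<Phi> \<Psi>"
    by (rule pl_homeomorphismI[OF P Q]) (auto simp: \<Phi>_def \<Psi>_def Y_def r_eq vec4_eq_iff)
  define H :: "(real^4) set" where "H = (if B = pl_ball then UNIV else {w. 0 \<le> w$1})"
  show ?thesis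
  proof (rule locally_flat_chart[OF N f fp hom, where H = H and \<epsilon> = "min 1 \<delta>"])
    have "flatten l 0 = 0" by (simp add: flatten_def vec_eq_iff)
    then show "\<Phi> (0, q 0) = 0" by (simp add: \<Phi>_def vec4_eq_iff)
    show "H = UNIV \<or> H = {w. 0 \<le> w$1}" by (simp add: H_def)
    show "0 < min 1 \<delta>" using \<delta> by simp
    show "w \<in> Y \<longleftrightarrow> w \<in> H" if "\<forall>j. \<bar>w $ j\<bar> \<le> min 1 \<delta>" for w
    proof -
      have rw: "r w \<in> pl_ball"
        using that abl(4)[of "\<lambda>j. \<bar>r w $ j\<bar> \<le> 1"] by (auto simp: mem_pl_ball)
      have r3: "r w $ 3 = w $ 1" if "B \<noteq> pl_ball" using B that r(2)[of w] by (auto simp: a_def)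
      show ?thesis
      proof (cases "B = pl_ball")
        case True
        then show ?thesis using rw by (simp add: Y_def H_def)
      next
        case False
        then have "w \<in> Y \<longleftrightarrow> r w \<in> half_ball" "w \<in> H \<longleftrightarrow> 0 \<le> w $ 1" using B by (auto simp: Y_def H_def)
        then show ?thesis using r3[OF False] rw by (simp add: mem_half_ball)
      qed
    qed
    show "(m, s) \<in> T \<longleftrightarrow> \<Phi> (f m, s) $ 3 = 0 \<and> \<Phi> (f m, s) $ 4 = 0"
      if m: "m \<in> N" and le: "\<forall>l. \<bar>\<Phi> (f m, s) $ l\<bar> \<le> min 1 \<delta>" for m s
    proof -
      have "\<forall>j. \<bar>f m $ j\<bar> \<le> \<delta>" "\<bar>s - q (flatten l (f m))\<bar> \<le> \<delta>"
        using le abl(4)[of "\<lambda>j. \<bar>f m $ j\<bar> \<le> \<delta>"] by (auto simp: \<Phi>_def forall_4)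
      then have "(m, s) \<in> T \<longleftrightarrow> f m $ l = 0 \<and> s = q (f m)" using T m by blast
      moreover have "flatten l (f m) = f m" if "f m $ l = 0" using that by (auto simp: vec_eq_iff)
      ultimately show ?thesis by (auto simp: \<Phi>_def)
    qed
  qed
qed

text \<open>The lift of the cone over a figure-8 is the graph of a function over the plane spanned by the
  first coordinate and the height; hence a shear makes it flat.\<close>

lemma locally_flat_cone:
  fixes f :: "'m::euclidean_space \<Rightarrow> real^3"
  assumes N: "nbhd_in M p N" and f: "pl_homeomorphism N pl_ball f g" and fp: "f p = 0"
    and e: "e = 1 \<or> e = -1" and \<delta>: "0 < \<delta>"
    and T: "\<And>m s. m \<in> N \<Longrightarrow> (\<forall>j. \<bar>f m $ j\<bar> \<le> \<delta>) \<Longrightarrow> \<bar>s - \<kappa>\<bar> \<le> \<delta> \<Longrightarrow>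
        (m, s) \<in> T \<longleftrightarrow>
          f m $ 2 = (\<bar>f m $ 1 + e * (s - \<kappa>)\<bar> - \<bar>f m $ 1 - e * (s - \<kappa>)\<bar>) / 2 \<and>
          f m $ 3 = \<bar>f m $ 1 + e * (s - \<kappa>)\<bar> + \<bar>f m $ 1 - e * (s - \<kappa>)\<bar>"
  shows "locally_flat_at (M \<times> UNIV) T (p, \<kappa>)"
proof -
  \<comment> \<open>\<open>\<beta> a t\<close> is the smaller of the two absolute values with the
    product of the signs, and \<open>\<mu> a t\<close> is twice the larger one. So for
    \<open>\<bar>a\<bar> \<le> \<bar>t\<bar>\<close> the point with coordinates \<open>a\<close>,
    \<open>\<beta> a t\<close>, \<open>\<mu> a t\<close> lies in a diagonal plane of the cone,
    otherwise over a side of the figure-8.\<close>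
  define \<beta> :: "real \<Rightarrow> real \<Rightarrow> real" where "\<beta> a t = (1/2) * (\<bar>a + t\<bar> - \<bar>a - t\<bar>)" for a t
  define \<mu> :: "real \<Rightarrow> real \<Rightarrow> real" where "\<mu> a t = \<bar>a + t\<bar> + \<bar>a - t\<bar>" for a t
  define \<Phi> where "\<Phi> z = vec4 (fst z $ 1) (e * (snd z - \<kappa>)) (fst z $ 2 - \<beta> (fst z $ 1) (e * (snd z - \<kappa>)))
      (fst z $ 3 - \<mu> (fst z $ 1) (e * (snd z - \<kappa>)))" for z :: "(real^3) \<times> real"
  define r where "r w = vec3 (w$1) (w$3 + \<beta> (w$1) (w$2)) (w$4 + \<mu> (w$1) (w$2))" for w :: "real^4"
  define \<Psi> where "\<Psi> w = (r w, \<kappa> + e * w$2)" for w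
  define Y where "Y = {w \<in> UNIV. r w \<in> pl_ball}"
  have ee: "e * e = 1" using e by auto
  have ee': "e * (e * x) = x" for x using e by auto
  have \<beta>_pl: "pl_map_on X (\<lambda>x. \<beta> (u x) (v x))" if "pl_map_on X u" "pl_map_on X v"
    for X :: "'c::euclidean_space set" and u v
    unfolding \<beta>_def using that
    by (intro pl_map_on_cmult pl_map_on_diff pl_map_on_abs pl_map_on_add)
  have \<mu>_pl: "pl_map_on X (\<lambda>x. \<mu> (u x) (v x))" if "pl_map_on X u" "pl_map_on X v"
    for X :: "'c::euclidean_space set" and u v
    unfolding \<mu>_def using that by (intro pl_map_on_diff pl_map_on_abs pl_map_on_add)
  have idp: "pl_map_on ((pl_ball::(real^3) set) \<times> (UNIV::real set)) (\<lambda>z. z)"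
    using pl_map_on_Times[OF pl_map_on_pl_ball pl_map_on_linear[OF linear_id]] by simp
  have fs: "pl_map_on ((pl_ball::(real^3) set) \<times> (UNIV::real set)) fst" "pl_map_on ((pl_ball::(real^3) set) \<times> (UNIV::real set)) snd"
    using pl_map_on_linear_o[OF linear_fst idp] pl_map_on_linear_o[OF linear_snd idp] by simp_all
  have P: "pl_map_on (pl_ball \<times> UNIV) \<Phi>"
    unfolding \<Phi>_def
    by (intro pl_map_on_vec4 pl_map_on_vec_nth fs pl_map_on_diff \<beta>_pl \<mu>_pl pl_map_on_cmult pl_map_on_const[OF idp])
  have id4: "pl_map_on UNIV (\<lambda>w :: real^4. w)" using pl_map_on_linear[OF linear_id] by (simp add: id_def)
  have "pl_map_on UNIV r"
    unfolding r_def by (intro pl_map_on_vec3 pl_map_on_vec_nth id4 pl_map_on_add \<beta>_pl \<mu>_pl)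
  then have r_pl: "pl_map_on Y r" unfolding Y_def by (rule pl_map_on_preimage[OF _ pl_map_on_pl_ball])
  have Q: "pl_map_on Y \<Psi>"
    unfolding \<Psi>_def
    by (intro pl_map_on_pair r_pl pl_map_on_add pl_map_on_cmult pl_map_on_const[OF r_pl]
        pl_map_on_vec_nth[OF pl_map_on_id[OF r_pl]])
  have r\<Phi>: "r (\<Phi> z) = fst z" for z by (simp add: r_def \<Phi>_def vec3_eq_iff)
  have hom: "pl_homeomorphism (pl_ball \<times> UNIV) Y \<Phi> \<Psi>"
  proof (rule pl_homeomorphismI[OF P Q])
    show "\<Phi> z \<in> Y" if "z \<in> pl_ball \<times> UNIV" for z using that r\<Phi> unfolding Y_def by auto
    show "\<Psi> w \<in> pl_ball \<times> UNIV" if "w \<in> Y" for w using that unfolding Y_def \<Psi>_def by auto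
    show "\<Psi> (\<Phi> z) = z" for z
      unfolding \<Psi>_def r\<Phi> by (simp add: \<Phi>_def prod_eq_iff ee')
    show "\<Phi> (\<Psi> w) = w" for w
      by (simp add: \<Psi>_def r_def \<Phi>_def vec4_eq_iff ee')
  qed
  have \<beta>b: "\<bar>\<beta> a t\<bar> \<le> d" if "\<bar>a\<bar> \<le> d" "\<bar>t\<bar> \<le> d" for a t d
    using that unfolding \<beta>_def by (auto simp: abs_if split: if_splits)
  have \<mu>b: "\<bar>\<mu> a t\<bar> \<le> 2 * d" if "\<bar>a\<bar> \<le> d" "\<bar>t\<bar> \<le> d" for a t d
    using that unfolding \<mu>_def by (auto simp: abs_if split: if_splits)
  show ?thesis
  \<comment> \<open>The third chart coordinate is the fourth new coordinate plus
    \<open>\<mu>\<close>, and \<open>\<mu>\<close> is at most twice the bound; hence the division by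
    3.\<close>
  proof (rule locally_flat_chart[OF N f fp hom, where H = UNIV and \<epsilon> = "min 1 \<delta> / 3"])
    show "\<Phi> (0, \<kappa>) = 0" by (simp add: \<Phi>_def vec4_eq_iff \<beta>_def \<mu>_def)
    show "(UNIV::(real^4) set) = UNIV \<or> (UNIV::(real^4) set) = {w. 0 \<le> w$1}" by simp
    show "0 < min 1 \<delta> / 3" using \<delta> by simp
    show "w \<in> Y \<longleftrightarrow> w \<in> UNIV" if "\<forall>j. \<bar>w $ j\<bar> \<le> min 1 \<delta> / 3" for w
    proof -
      have "\<bar>w$1\<bar> \<le> 1/3" "\<bar>w$2\<bar> \<le> 1/3" "\<bar>w$3\<bar> \<le> 1/3" "\<bar>w$4\<bar> \<le> 1/3"
        using that by (auto simp: forall_4)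
      then have "r w \<in> pl_ball"
        using \<beta>b[of "w$1" "1/3" "w$2"] \<mu>b[of "w$1" "1/3" "w$2"]
        by (auto simp: mem_pl_ball forall_3 r_def)
      then show ?thesis unfolding Y_def by auto
    qed
    show "(m, s) \<in> T \<longleftrightarrow> \<Phi> (f m, s) $ 3 = 0 \<and> \<Phi> (f m, s) $ 4 = 0"
      if m: "m \<in> N" and le: "\<forall>l. \<bar>\<Phi> (f m, s) $ l\<bar> \<le> min 1 \<delta> / 3" for m s
    proof -
      let ?a = "f m $ 1" and ?t = "e * (s - \<kappa>)"
      have b: "\<bar>?a\<bar> \<le> min 1 \<delta> / 3" "\<bar>?t\<bar> \<le> min 1 \<delta> / 3" "\<bar>f m $ 2 - \<beta> ?a ?t\<bar> \<le> min 1 \<delta> / 3"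
        "\<bar>f m $ 3 - \<mu> ?a ?t\<bar> \<le> min 1 \<delta> / 3"
        using le by (auto simp: \<Phi>_def forall_4)
      have "\<bar>s - \<kappa>\<bar> = \<bar>?t\<bar>" using e by (auto simp: abs_mult)
      then have "\<bar>s - \<kappa>\<bar> \<le> \<delta>" using b(2) \<delta> by linarith
      moreover have "\<forall>j. \<bar>f m $ j\<bar> \<le> \<delta>"
        using b \<beta>b[OF b(1,2)] \<mu>b[OF b(1,2)] \<delta> unfolding forall_3 by linarith
      ultimately have "(m, s) \<in> T \<longleftrightarrow> f m $ 2 = \<beta> ?a ?t \<and> f m $ 3 = \<mu> ?a ?t"
        using T[OF m] unfolding \<beta>_def \<mu>_def by simp
      then show ?thesis by (auto simp: \<Phi>_def)
    qed
  qed
qed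


section \<open>Charts of a generic surface and local heights\<close>

text \<open>Used in place of the Euclidean norm because it is piecewise linear, so that cutoffs may
  depend on it.\<close>

definition maxnorm :: "real^3 \<Rightarrow> real" where
  "maxnorm v = max \<bar>v$1\<bar> (max \<bar>v$2\<bar> \<bar>v$3\<bar>)"

lemma maxnorm_le_iff: "maxnorm v \<le> r \<longleftrightarrow> (\<forall>j. \<bar>v$j\<bar> \<le> r)"
  by (auto simp: maxnorm_def forall_3)

lemma maxnorm_less_iff: "maxnorm v < r \<longleftrightarrow> (\<forall>j. \<bar>v$j\<bar> < r)"
  by (auto simp: maxnorm_def forall_3)

lemma norm_le_maxnorm: "norm v \<le> 3 * maxnorm v"
proof -
  have "norm v \<le> (\<Sum>j\<in>UNIV. \<bar>v$j\<bar>)" by (rule norm_le_l1_cart)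
  also have "\<dots> \<le> 3 * maxnorm v" unfolding sum_3 maxnorm_def by linarith
  finally show ?thesis .
qed

lemma maxnorm_nonneg: "0 \<le> maxnorm v" by (simp add: maxnorm_def)

lemma maxnorm_0 [simp]: "maxnorm 0 = 0" by (simp add: maxnorm_def)

lemma pl_map_on_maxnorm: "pl_map_on X f \<Longrightarrow> pl_map_on X (\<lambda>x. maxnorm (f x))"
  unfolding maxnorm_def by (intro pl_map_on_max pl_map_on_abs pl_map_on_vec_nth)

lemma continuous_on_maxnorm: "continuous_on X f \<Longrightarrow> continuous_on X (\<lambda>x. maxnorm (f x))"
  unfolding maxnorm_def by (intro continuous_intros)

text \<open>Phrased as an eventual statement about the radius, so that the conditions for several
  sheets can be combined.\<close>

lemma continuous_on_small:
  fixes \<phi> :: "real^3 \<Rightarrow> 'b::metric_space"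
  assumes "continuous_on Z \<phi>" "0 \<in> Z" "0 < \<eta>"
  shows "eventually (\<lambda>d. \<forall>v\<in>Z. maxnorm v \<le> d \<longrightarrow> dist (\<phi> v) (\<phi> 0) < \<eta>) (at_right 0)"
proof -
  obtain d where d: "0 < d" "\<And>v. v \<in> Z \<Longrightarrow> dist v 0 < d \<Longrightarrow> dist (\<phi> v) (\<phi> 0) < \<eta>"
    using assms unfolding continuous_on_iff by metis
  have "dist (\<phi> v) (\<phi> 0) < \<eta>" if "v \<in> Z" "maxnorm v \<le> e" "e < d / 3" for v e
    using d(2)[OF that(1)] norm_le_maxnorm[of v] that(2,3) by (simp add: dist_norm)
  then show ?thesis unfolding eventually_at_right_field using d(1)
    by (intro exI[of _ "d/3"]) auto
qed

text \<open>A chart domain only contains an open neighbourhood of \<open>p\<close>, so sublevel sets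
  of the chart norm are open in \<open>M\<close> for small radii only. The image of the open part
  contains all points of \<open>B\<close> in some ball about 0, which yields such a radius.\<close>

lemma chart_small:
  fixes f :: "'m::euclidean_space \<Rightarrow> real^3"
  assumes N: "nbhd_in M p N" and f: "homeomorphism N B f g" and fp: "f p = 0"
    and O: "openin (top_of_set M) W" "p \<in> W"
  shows "\<exists>r>0. {m \<in> N. maxnorm (f m) < r} \<subseteq> W \<and>
     (\<forall>r'. 0 < r' \<longrightarrow> r' \<le> r \<longrightarrow> openin (top_of_set M) {m \<in> N. maxnorm (f m) < r'})"
proof -
  obtain V where V: "openin (top_of_set M) V" "p \<in> V" "V \<subseteq> N" and NM: "N \<subseteq> M"
    using N unfolding nbhd_in_def by blast
  have op: "openin (top_of_set N) (V \<inter> W)"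
    using openin_subset_trans[OF openin_Int[OF V(1) O(1)] _ NM] V(3) by blast
  have "openin (top_of_set B) (f ` (V \<inter> W))"
    by (rule homeomorphism_imp_open_map[OF f op])
  then obtain T where T: "open T" "f ` (V \<inter> W) = B \<inter> T" unfolding openin_open by blast
  have "0 \<in> T" using T(2) V(2) O(2) fp by force
  then obtain d where d: "0 < d" "ball 0 d \<subseteq> T" using T(1) open_contains_ball by blast
  have sub: "m \<in> V \<inter> W" if m: "m \<in> N" "maxnorm (f m) < d / 3" for m
  proof -
    have "f m \<in> T" using norm_le_maxnorm[of "f m"] m(2) d(2) by (auto simp: dist_norm)
    moreover have "f m \<in> B" using m(1) homeomorphism_image1[OF f] by blast
    ultimately obtain m' where "m' \<in> V \<inter> W" "f m = f m'" using T(2) by blast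
    then show ?thesis using m(1) V(3) homeomorphism_apply1[OF f] by (metis IntD1 subsetD)
  qed
  have "openin (top_of_set M) {m \<in> N. maxnorm (f m) < r'}" if "0 < r'" "r' \<le> d / 3" for r'
  proof -
    have "continuous_on V (\<lambda>m. maxnorm (f m))"
      using continuous_on_subset[OF homeomorphism_cont1[OF f] V(3)] by (rule continuous_on_maxnorm)
    then have "openin (top_of_set V) (V \<inter> (\<lambda>m. maxnorm (f m)) -` {..<r'})"
      by (rule continuous_openin_preimage_gen) simp
    then have "openin (top_of_set M) (V \<inter> (\<lambda>m. maxnorm (f m)) -` {..<r'})"
      using V(1) openin_trans by blast
    moreover have "{m \<in> N. maxnorm (f m) < r'} = V \<inter> (\<lambda>m. maxnorm (f m)) -` {..<r'}"
      using sub that V(3) by fastforce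
    ultimately show ?thesis by simp
  qed
  then show ?thesis using d(1) sub by (intro exI[of _ "d/3"]) auto
qed

section \<open>Truncated heights over a generic surface\<close>

locale generic_surface_map =
  fixes M :: "'m::euclidean_space set" and F :: "'f::euclidean_space set" and i :: "'f \<Rightarrow> 'm"
  assumes generic: "generic_surface M F i"
begin

lemma F_compact: "compact F" and i_proper: "proper_pl_map TYPE(2) TYPE(3) F M i"
  using generic unfolding generic_surface_def by auto

lemma i_pl: "pl_map_on F i" and i_M: "x \<in> F \<Longrightarrow> i x \<in> M"
  using i_proper unfolding proper_pl_map_def by auto

lemma i_cont: "continuous_on F i"
  using i_pl by (rule pl_map_on_continuous)

lemma preimage_open: "openin (top_of_set M) W \<Longrightarrow> openin (top_of_set F) {x \<in> F. i x \<in> W}"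
  using continuous_openin_preimage[OF i_cont, of M W] i_M by (simp add: vimage_def Int_def image_subset_iff)

lemma image_compact: "compact (i ` F)"
  using F_compact i_cont by (rule compact_continuous_image[rotated])

text \<open>By compactness \<open>i\<close> maps the complement of \<open>W\<close> to a closed set,
  and this set misses \<open>p\<close>.\<close>

lemma preimage_nbhd:
  assumes O: "openin (top_of_set F) W" and p: "{x \<in> F. i x = p} \<subseteq> W" and pM: "p \<in> M"
  shows "\<exists>V. openin (top_of_set M) V \<and> p \<in> V \<and> {x \<in> F. i x \<in> V} \<subseteq> W"
proof -
  have "compact (i ` (F - W))"
  proof (rule compact_continuous_image)
    show "continuous_on (F - W) i" using i_cont continuous_on_subset by blast
    show "compact (F - W)" using F_compact O
      by (metis closedin_compact closedin_diff closedin_self)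
  qed
  then have "closed (i ` (F - W))" by (rule compact_imp_closed)
  then have "openin (top_of_set M) (M - i ` (F - W))"
    by (metis Diff_Compl Int_Diff closed_Compl Diff_eq open_Compl openin_open_Int)
  then show ?thesis using p pM by (intro exI[of _ "M - i ` (F - W)"]) auto
qed

text \<open>This notion does not refer to a chart, so it can be compared between overlapping
  charts.\<close>

definition multi :: "'m \<Rightarrow> bool" where
  "multi q \<longleftrightarrow> (\<exists>x y. (x, y) \<in> double_pairs F i \<and> i x = q)"

text \<open>Multiplying by a cutoff would destroy piecewise linearity. Instead \<open>hl\<close> is
  raised by a constant, lowered by a multiple of the chart norm and truncated at 0. The correction
  depends on \<open>i x\<close> only, hence a pair in \<open>Hi\<close> keeps its order unless both
  values become 0. Near \<open>p\<close> nothing but a constant is added, which preserves the exact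
  shape needed at branch values.\<close>

lemma bump:
  fixes f :: "'m \<Rightarrow> real^3"
  assumes N: "nbhd_in M p N" and f: "pl_homeomorphism N B f g" and fp: "f p = 0" and B: "compact B"
    and \<delta>: "0 < \<delta>"
    and hl: "pl_map_on {x \<in> F. i x \<in> N \<and> maxnorm (f (i x)) \<le> \<delta>} hl"
    and Hi: "\<forall>(x, y)\<in>Hi. x \<in> F \<and> y \<in> F \<and> i x = i y"
    and strict: "\<forall>(x, y)\<in>Hi. i x \<in> N \<longrightarrow> maxnorm (f (i x)) \<le> \<delta> \<longrightarrow> hl y < hl x"
    and W: "openin (top_of_set M) W" "p \<in> W"
  shows "\<exists>g \<rho> \<kappa>. pl_map_on F g \<and> (\<forall>x\<in>F. (0::real) \<le> g x) \<and>
     (\<forall>x y. (x, y) \<in> Hi \<longrightarrow> g y < g x \<or> g x = 0 \<and> g y = 0) \<and> (0::real) < \<rho> \<and>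
     openin (top_of_set M) {m \<in> N. maxnorm (f m) < \<rho>} \<and>
     (\<forall>x\<in>F. i x \<in> N \<longrightarrow> maxnorm (f (i x)) \<le> \<rho> \<longrightarrow> g x = hl x + \<kappa> \<and> 0 < g x) \<and>
     (\<forall>x\<in>F. g x \<noteq> 0 \<longrightarrow> i x \<in> W)"
proof -
  note fD = pl_homeomorphismD[OF f]
  obtain r0 where r0: "0 < r0" "{m \<in> N. maxnorm (f m) < r0} \<subseteq> W"
    "\<And>r'. 0 < r' \<Longrightarrow> r' \<le> r0 \<Longrightarrow> openin (top_of_set M) {m \<in> N. maxnorm (f m) < r'}"
    using chart_small[OF N fD(9) fp W] by blast
  define r where "r = min r0 \<delta>"
  have r: "0 < r" "r \<le> \<delta>" "r \<le> r0" using r0(1) \<delta> by (auto simp: r_def)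
  let ?X = "{x \<in> F. i x \<in> N \<and> maxnorm (f (i x)) \<le> \<delta>}"
  have comp: "compact {x \<in> F. i x \<in> N \<and> maxnorm (f (i x)) \<le> d}" for d
  proof -
    have "continuous_on N (\<lambda>m. maxnorm (f m))" by (rule continuous_on_maxnorm[OF fD(10)])
    moreover have "closed N" using compact_continuous_image[OF fD(11) B] fD(8) compact_imp_closed by simp
    ultimately have "closed (N \<inter> (\<lambda>m. maxnorm (f m)) -` {..d})"
      by (rule continuous_closed_preimage) simp
    then have "closed (F \<inter> i -` (N \<inter> (\<lambda>m. maxnorm (f m)) -` {..d}))"
      by (rule continuous_closed_preimage[OF i_cont compact_imp_closed[OF F_compact]])
    then have "compact (F \<inter> (F \<inter> i -` (N \<inter> (\<lambda>m. maxnorm (f m)) -` {..d})))"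
      by (rule compact_Int_closed[OF F_compact])
    moreover have "F \<inter> (F \<inter> i -` (N \<inter> (\<lambda>m. maxnorm (f m)) -` {..d})) =
        {x \<in> F. i x \<in> N \<and> maxnorm (f (i x)) \<le> d}" by auto
    ultimately show ?thesis by simp
  qed
  have "bounded (hl ` ?X)"
    using compact_continuous_image[OF pl_map_on_continuous[OF hl] comp] compact_imp_bounded by blast
  then obtain C where C: "0 < C" "\<And>x. x \<in> ?X \<Longrightarrow> \<bar>hl x\<bar> \<le> C"
    unfolding bounded_pos by auto
  \<comment> \<open>After adding \<open>C + 1\<close> the height lies between 1 and
    \<open>2 * C + 1\<close>; this slope brings it down to 0 between the radii \<open>r / 4\<close>
    and \<open>r / 2\<close>.\<close>
  define K where "K = (2 * C + 1) * 4 / r"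
  have K: "K * (r/4) = 2 * C + 1" "0 \<le> K" using r C(1) by (auto simp: K_def)
  define G where "G x = max 0 (hl x + (C + 1) - K * max 0 (maxnorm (f (i x)) - r / 4))" for x
  define h where "h x = (if i x \<in> N \<and> maxnorm (f (i x)) \<le> r / 2 then G x else 0)" for x
  have G0: "G x = 0" if "x \<in> ?X" "r / 2 \<le> maxnorm (f (i x))" for x
  proof -
    have "K * (r / 4) \<le> K * max 0 (maxnorm (f (i x)) - r / 4)"
      by (rule mult_left_mono[OF _ K(2)]) (use that(2) in linarith)
    moreover have "hl x \<le> C" using C(2)[OF that(1)] by linarith
    ultimately show ?thesis using K(1) unfolding G_def by linarith
  qed
  have idX: "pl_map_on ?X (\<lambda>x. x)" by (rule pl_map_on_id[OF hl])
  have fi: "pl_map_on ?X (\<lambda>x. f (i x))"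
  proof -
    have "pl_map_on ?X i" by (rule pl_map_on_restrict[OF i_pl idX]) auto
    then show ?thesis by (rule pl_map_on_compose'[OF _ fD(1)]) auto
  qed
  have G: "pl_map_on ?X G"
    unfolding G_def
    by (intro pl_map_on_max pl_map_on_const[OF hl] pl_map_on_diff pl_map_on_add hl pl_map_on_cmult
        pl_map_on_maxnorm fi)
  have h: "pl_map_on F h"
  proof (rule pl_map_on_local)
    fix x assume x: "x \<in> F"
    let ?V1 = "{x \<in> F. i x \<in> {m \<in> N. maxnorm (f m) < r}}"
    let ?V2 = "F - {x \<in> F. i x \<in> N \<and> maxnorm (f (i x)) \<le> r / 2}"
    show "\<exists>V X' f. openin (top_of_set F) V \<and> x \<in> V \<and> V \<subseteq> X' \<and> X' \<subseteq> F \<and>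
      pl_map_on X' f \<and> (\<forall>y\<in>V. h y = f y)"
    proof (cases "x \<in> ?V1")
      case True
      have "openin (top_of_set F) ?V1" by (rule preimage_open[OF r0(3)[OF r(1,3)]])
      moreover have "?V1 \<subseteq> ?X" using r by auto
      moreover have "h y = G y" if "y \<in> ?V1" for y
        using G0[of y] that \<open>?V1 \<subseteq> ?X\<close> unfolding h_def by (cases "maxnorm (f (i y)) \<le> r / 2") auto
      ultimately show ?thesis using True G by (intro exI[of _ ?V1] exI[of _ ?X] exI[of _ G]) auto
    next
      case False
      have "openin (top_of_set F) ?V2"
        using comp[of "r/2"] by (intro openin_diff closed_subset compact_imp_closed) auto
      moreover have "x \<in> ?V2" using False x r by auto
      moreover have "h y = 0" if "y \<in> ?V2" for y using that unfolding h_def by auto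
      ultimately show ?thesis using pl_map_on_const[OF i_pl, of "0::real"]
        by (intro exI[of _ ?V2] exI[of _ F] exI[of _ "\<lambda>_. 0"]) auto
    qed
  qed
  have "0 \<le> h x" for x unfolding h_def G_def by auto
  moreover have "h y < h x \<or> h x = 0 \<and> h y = 0" if xy: "(x, y) \<in> Hi" for x y
  proof (cases "i x \<in> N \<and> maxnorm (f (i x)) \<le> r / 2")
    case True
    then have "hl y < hl x" using strict xy r by fastforce
    moreover have "i x = i y" using Hi xy by blast
    ultimately show ?thesis using True unfolding h_def G_def by auto
  next
    case False
    moreover have "i x = i y" using Hi xy by blast
    ultimately show ?thesis unfolding h_def by auto
  qed
  moreover have "h x = hl x + (C + 1) \<and> 0 < h x" if "x \<in> F" "i x \<in> N" "maxnorm (f (i x)) \<le> r / 4" for x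
  proof -
    have "\<bar>hl x\<bar> \<le> C" using C(2)[of x] that r by auto
    then show ?thesis using that r unfolding h_def G_def by auto
  qed
  moreover have "i x \<in> W" if "h x \<noteq> 0" for x
    using that r0(2) r(1,3) unfolding h_def by (auto split: if_splits)
  moreover have "openin (top_of_set M) {m \<in> N. maxnorm (f m) < r / 4}" using r0(3)[of "r/4"] r by auto
  ultimately show ?thesis using h r(1)
    by (rule_tac exI[of _ h], rule_tac exI[of _ "r/4"], rule_tac exI[of _ "C + 1"]) auto
qed

end

text \<open>A choice of all data in \<open>planes_at\<close>, where \<open>u l\<close> parametrizes
  the sheet \<open>U l\<close> by its plane. In the half ball the plane \<open>v$3 = 0\<close> is
  the boundary face, so it is excluded as a sheet.\<close>

locale plane_chart = generic_surface_map M F i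
  for M :: "'m::euclidean_space set" and F :: "'f::euclidean_space set" and i :: "'f \<Rightarrow> 'm" +
  fixes p :: 'm and B :: "(real^3) set" and L :: "3 set" and N :: "'m set" and f :: "'m \<Rightarrow> real^3"
    and g :: "real^3 \<Rightarrow> 'm" and U :: "3 \<Rightarrow> 'f set" and u :: "3 \<Rightarrow> real^3 \<Rightarrow> 'f"
  assumes N: "nbhd_in M p N" and f: "pl_homeomorphism N B f g" and fp: "f p = 0"
    and image: "f ` (N \<inter> i ` F) = (\<Union>l\<in>L. B \<inter> {v. v$l = 0})"
    and disj: "disjoint_family_on U L" and UN: "(\<Union>l\<in>L. U l) = {x \<in> F. i x \<in> N}"
    and u: "l \<in> L \<Longrightarrow> pl_homeomorphism (U l) (B \<inter> {v. v$l = 0}) (f \<circ> i) (u l)"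
    and B: "B = pl_ball \<or> B = half_ball \<and> 3 \<notin> L"
begin

lemmas fD = pl_homeomorphismD[OF f]
lemmas uD = pl_homeomorphismD[OF u]

lemma B_compact: "compact B" and B_convex: "convex B" and B0: "0 \<in> B" and B_ball: "B \<subseteq> pl_ball"
proof -
  have 1: "compact (pl_ball :: (real^3) set)" "convex (pl_ball :: (real^3) set)"
    by (simp_all add: polytope_pl_ball polytope_imp_compact polytope_imp_convex)
  have "{v :: real^3. 0 \<le> v$3} = {v. axis 3 1 \<bullet> v \<ge> 0}" by (simp add: inner_axis')
  then have 2: "closed {v :: real^3. 0 \<le> v$3}" "convex {v :: real^3. 0 \<le> v$3}"
    by (simp_all add: closed_halfspace_ge convex_halfspace_ge)
  show "compact B" "convex B"
    using B 1 2 unfolding half_ball_def by (auto intro: compact_Int_closed convex_Int)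
  show "0 \<in> B" "B \<subseteq> pl_ball" using B by (auto simp: mem_half_ball mem_pl_ball)
qed

lemma p_N: "p \<in> N" and N_M: "N \<subseteq> M"
  using N unfolding nbhd_in_def by auto

lemma U_sub: "l \<in> L \<Longrightarrow> x \<in> U l \<Longrightarrow> x \<in> F \<and> i x \<in> N"
  using UN by blast

lemma U_mem:
  assumes "l \<in> L" "x \<in> U l"
  shows "f (i x) $ l = 0" "f (i x) \<in> B" "u l (f (i x)) = x"
  using uD(3)[OF assms] uD(5)[OF assms] by auto

lemma u_mem:
  assumes "l \<in> L" "v \<in> B" "v $ l = 0"
  shows "u l v \<in> U l" "u l v \<in> F" "f (i (u l v)) = v" "i (u l v) = g v"
proof -
  have v: "v \<in> B \<inter> {v. v$l = 0}" using assms by auto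
  show 1: "u l v \<in> U l" by (rule uD(4)[OF assms(1) v])
  then show "u l v \<in> F" using U_sub assms(1) by blast
  show 2: "f (i (u l v)) = v" using uD(6)[OF assms(1) v] by simp
  have "i (u l v) \<in> N" using 1 U_sub assms(1) by blast
  then show "i (u l v) = g v" using 2 fD(5) by metis
qed

lemma preimage_iff:
  assumes "q \<in> N"
  shows "x \<in> F \<and> i x = q \<longleftrightarrow> (\<exists>l\<in>L. f q $ l = 0 \<and> x = u l (f q))"
proof
  assume x: "x \<in> F \<and> i x = q"
  then obtain l where "l \<in> L" "x \<in> U l" using assms UN by blast
  then show "\<exists>l\<in>L. f q $ l = 0 \<and> x = u l (f q)" using U_mem x by metis
next
  assume "\<exists>l\<in>L. f q $ l = 0 \<and> x = u l (f q)"
  then show "x \<in> F \<and> i x = q" using u_mem assms fD(3,5) by metis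
qed

lemma u_neq:
  assumes "l \<in> L" "l' \<in> L" "l \<noteq> l'" "v \<in> B" "v $ l = 0" "w \<in> B" "w $ l' = 0"
  shows "u l v \<noteq> u l' w"
  using assms disj u_mem(1) unfolding disjoint_family_on_def by (metis disjoint_iff)

lemma multi_iff:
  assumes "q \<in> N"
  shows "multi q \<longleftrightarrow> (\<exists>l\<in>L. \<exists>l'\<in>L. l \<noteq> l' \<and> f q $ l = 0 \<and> f q $ l' = 0)"
proof
  assume "multi q"
  then obtain x y where "x \<in> F" "y \<in> F" "x \<noteq> y" "i x = q" "i y = q"
    unfolding multi_def double_pairs_def by auto
  then show "\<exists>l\<in>L. \<exists>l'\<in>L. l \<noteq> l' \<and> f q $ l = 0 \<and> f q $ l' = 0" using preimage_iff[OF assms] by metis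
next
  assume "\<exists>l\<in>L. \<exists>l'\<in>L. l \<noteq> l' \<and> f q $ l = 0 \<and> f q $ l' = 0"
  then obtain l l' where l: "l \<in> L" "l' \<in> L" "l \<noteq> l'" "f q $ l = 0" "f q $ l' = 0" by blast
  have "u l (f q) \<noteq> u l' (f q)" using u_neq[OF l(1-3)] l fD(3)[OF assms] by blast
  moreover have "u l (f q) \<in> F" "i (u l (f q)) = q" "u l' (f q) \<in> F" "i (u l' (f q)) = q"
    using preimage_iff[OF assms] l by blast+
  ultimately show "multi q" unfolding multi_def double_pairs_def
    by (rule_tac exI[of _ "u l (f q)"], rule_tac exI[of _ "u l' (f q)"]) auto
qed

lemma surface_iff:
  assumes "q \<in> N" shows "q \<in> i ` F \<longleftrightarrow> (\<exists>l\<in>L. f q $ l = 0)"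
proof -
  have "q \<in> i ` F \<longleftrightarrow> (\<exists>x. x \<in> F \<and> i x = q)" by auto
  then show ?thesis unfolding preimage_iff[OF assms] by blast
qed

lemma U_compact: "l \<in> L \<Longrightarrow> compact (U l)"
proof -
  assume l: "l \<in> L"
  have "closed {v :: real^3. v$l = 0}" by (intro closed_Collect_eq continuous_intros)
  then have "compact (B \<inter> {v. v$l = 0})" using B_compact by (rule compact_Int_closed[rotated])
  then show "compact (U l)"
    using compact_continuous_image[OF uD(11)[OF l]] uD(8)[OF l] by simp
qed

text \<open>The sheets are finitely many, compact and disjoint, so the union of the others is
  closed.\<close>

lemma U_open: assumes "l \<in> L" shows "openin (top_of_set {x \<in> F. i x \<in> N}) (U l)"
proof -
  have "U l = {x \<in> F. i x \<in> N} - (\<Union>l'\<in>L - {l}. U l')"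
    using UN disj assms unfolding disjoint_family_on_def by blast
  moreover have "closedin (top_of_set {x \<in> F. i x \<in> N}) (\<Union>l'\<in>L - {l}. U l')"
    using U_compact UN by (intro closed_subset compact_imp_closed compact_UN) auto
  ultimately show ?thesis by (metis openin_diff openin_subtopology_self)
qed

text \<open>The intersection of two of the planes with \<open>B\<close> is convex. Moving along it
  keeps to the same ordered pair of sheets, so a choice made once per strip is the same on all of
  it.\<close>

lemma double_pair_path:
  assumes l: "l \<in> L" "l' \<in> L" "l \<noteq> l'" and v: "v \<in> B" "v $ l = 0" "v $ l' = 0"
    and w: "w \<in> B" "w $ l = 0" "w $ l' = 0"
  shows "path_component (double_pairs F i) (u l v, u l' v) (u l w, u l' w)"
proof -
  let ?Z = "B \<inter> {v. v$l = 0} \<inter> {v. v$l' = 0}"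
  have "convex {v :: real^3. v$j = 0}" for j by (auto simp: convex_def)
  then have "path_connected ?Z" using B_convex by (intro convex_imp_path_connected convex_Int)
  moreover have "continuous_on ?Z (\<lambda>v. (u l v, u l' v))"
    using continuous_on_subset[OF uD(11)[OF l(1)], of ?Z] continuous_on_subset[OF uD(11)[OF l(2)], of ?Z]
    by (intro continuous_on_Pair) auto
  ultimately have "path_connected ((\<lambda>v. (u l v, u l' v)) ` ?Z)"
    by (rule path_connected_continuous_image[rotated])
  then have "path_component ((\<lambda>v. (u l v, u l' v)) ` ?Z) (u l v, u l' v) (u l w, u l' w)"
    unfolding path_connected_component using v w by blast
  moreover have "(\<lambda>v. (u l v, u l' v)) ` ?Z \<subseteq> double_pairs F i"
    using u_mem l u_neq unfolding double_pairs_def by auto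
  ultimately show ?thesis by (rule path_component_of_subset[rotated])
qed

text \<open>No special form of \<open>h\<close> is needed: the other sheets through \<open>p\<close>
  have different heights there by injectivity, hence stay away by continuity, and what remains near
  the point is the graph over a single sheet.\<close>

lemma locally_flat_at_plane_value:
  assumes h: "pl_map_on F h" and inj: "inj_on (\<lambda>x. (i x, h x)) F" and x: "x \<in> F" "i x = p"
  shows "locally_flat_at (M \<times> (UNIV::real set)) ((\<lambda>x. (i x, h x)) ` F) (i x, h x)"
proof -
  obtain l where l: "l \<in> L" "x = u l 0" using preimage_iff[OF p_N] x fp by auto
  define q where "q v = h (u l v)" for v
  have q: "pl_map_on (B \<inter> {v. v$l = 0}) q"
    unfolding q_def by (rule pl_map_on_compose'[OF uD(2)[OF l(1)] h]) (use u_mem l in auto)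
  \<comment> \<open>The sheet \<open>l'\<close> stays farther than \<open>d\<close> from the graph
    of \<open>q\<close>, extended by \<open>flatten\<close>. Two oscillations below
    \<open>\<eta>/3\<close> leave more than a third of the initial gap \<open>\<eta>\<close>, and
    \<open>d < \<eta>/3\<close>.\<close>
  let ?sep = "\<lambda>l' d. \<forall>v\<in>B. maxnorm v \<le> d \<longrightarrow> v$l' = 0 \<longrightarrow> d < \<bar>h (u l' v) - q (flatten l v)\<bar>"
  have "eventually (?sep l') (at_right 0)" if l': "l' \<in> L" "l' \<noteq> l" for l'
  proof -
    define \<eta> where "\<eta> = \<bar>h (u l' 0) - q 0\<bar>"
    have "u l' 0 \<noteq> u l 0" using u_neq[OF l'(1) l(1) l'(2) B0 _ B0] by simp
    moreover have "i (u l' 0) = i (u l 0)" "u l' 0 \<in> F" "u l 0 \<in> F"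
      using u_mem[OF l'(1) B0] u_mem[OF l(1) B0] by auto
    ultimately have "h (u l' 0) \<noteq> q 0" using inj unfolding q_def inj_on_def by blast
    then have \<eta>: "0 < \<eta>" by (simp add: \<eta>_def)
    have c': "continuous_on (B \<inter> {v. v$l' = 0}) (\<lambda>v. h (u l' v))"
      by (rule continuous_on_compose2[OF pl_map_on_continuous[OF h] uD(11)[OF l'(1)]]) (use u_mem l' in auto)
    have "eventually (\<lambda>d. \<forall>v\<in>B \<inter> {v. v$l' = 0}. maxnorm v \<le> d \<longrightarrow> dist (h (u l' v)) (h (u l' 0)) < \<eta>/3) (at_right 0)"
      using B0 \<eta> by (intro continuous_on_small[OF c']) auto
    moreover have "eventually (\<lambda>d. \<forall>v\<in>B \<inter> {v. v$l = 0}. maxnorm v \<le> d \<longrightarrow> dist (q v) (q 0) < \<eta>/3) (at_right 0)"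
      using B0 \<eta> by (intro continuous_on_small[OF pl_map_on_continuous[OF q]]) auto
    moreover have "eventually (\<lambda>d. d < \<eta>/3) (at_right 0)"
      using \<eta> unfolding eventually_at_right_field by (intro exI[of _ "\<eta>/3"]) auto
    ultimately show ?thesis
    proof eventually_elim
      case (elim d)
      show ?case
      proof (intro ballI impI)
        fix v assume v: "v \<in> B" "maxnorm v \<le> d" "v $ l' = 0"
        have "flatten l v \<in> B" using v(1) B l(1) by (auto simp: mem_half_ball mem_pl_ball)
        moreover have "maxnorm (flatten l v) \<le> d" using v(2) maxnorm_nonneg[of v] by (auto simp: maxnorm_le_iff)
        ultimately have "dist (q (flatten l v)) (q 0) < \<eta>/3" using elim(2) by auto
        moreover have "dist (h (u l' v)) (h (u l' 0)) < \<eta>/3" using elim(1) v by auto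
        moreover have "\<eta> \<le> \<bar>h (u l' v) - h (u l' 0)\<bar> + \<bar>q (flatten l v) - q 0\<bar> + \<bar>h (u l' v) - q (flatten l v)\<bar>"
          unfolding \<eta>_def by linarith
        ultimately show "d < \<bar>h (u l' v) - q (flatten l v)\<bar>"
          using elim(3) unfolding dist_real_def by linarith
      qed
    qed
  qed
  then have "eventually (\<lambda>d. \<forall>l'\<in>L - {l}. ?sep l' d) (at_right 0)"
    by (intro eventually_ball_finite) auto
  then obtain b where b: "0 < b" "\<And>d. 0 < d \<Longrightarrow> d < b \<Longrightarrow> \<forall>l'\<in>L - {l}. ?sep l' d"
    unfolding eventually_at_right_field by auto
  define d where "d = b / 2"
  have d: "0 < d" "\<And>l'. l' \<in> L \<Longrightarrow> l' \<noteq> l \<Longrightarrow> ?sep l' d" using b(1) b(2)[of d] by (auto simp: d_def)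
  have "locally_flat_at (M \<times> (UNIV::real set)) ((\<lambda>x. (i x, h x)) ` F) (p, q 0)"
  proof (rule locally_flat_graph[OF N f fp _ q d(1)])
    show "B = pl_ball \<or> B = half_ball \<and> l \<noteq> 3" using B l(1) by auto
    fix m s assume m: "m \<in> N" and le: "\<forall>j. \<bar>f m $ j\<bar> \<le> d" "\<bar>s - q (flatten l (f m))\<bar> \<le> d"
    show "(m, s) \<in> (\<lambda>x. (i x, h x)) ` F \<longleftrightarrow> f m $ l = 0 \<and> s = q (f m)"
    proof
      assume "(m, s) \<in> (\<lambda>x. (i x, h x)) ` F"
      then obtain y where y: "y \<in> F" "i y = m" "h y = s" by auto
      then obtain l' where l': "l' \<in> L" "f m $ l' = 0" "y = u l' (f m)" using preimage_iff[OF m] by blast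
      have "l' = l"
      proof (rule ccontr)
        assume "l' \<noteq> l"
        from d(2)[OF l'(1) this] have "d < \<bar>h (u l' (f m)) - q (flatten l (f m))\<bar>"
          using fD(3)[OF m] le(1) l'(2) maxnorm_le_iff by blast
        then show False using le(2) l'(3) y(3) by simp
      qed
      then show "f m $ l = 0 \<and> s = q (f m)" using l' y by (auto simp: q_def)
    next
      assume *: "f m $ l = 0 \<and> s = q (f m)"
      then have "u l (f m) \<in> F \<and> i (u l (f m)) = m" using preimage_iff[OF m] l(1) by blast
      then show "(m, s) \<in> (\<lambda>x. (i x, h x)) ` F" using * unfolding q_def by force
    qed
  qed
  then show ?thesis using x l(2) by (simp add: q_def)
qed

end

section \<open>Kinds of values, and heights over values with plane sheets\<close>

context generic_surface_map
begin

lemma planes_at_chart: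
  assumes "planes_at M F i B L p" "B = pl_ball \<or> B = half_ball \<and> 3 \<notin> L"
  shows "\<exists>N f g U u. plane_chart M F i p B L N f g U u"
proof -
  obtain N f g U where 1: "nbhd_in M p N" "pl_homeomorphism N B f g" "f p = 0"
      "f ` (N \<inter> i ` F) = (\<Union>l\<in>L. B \<inter> {v. v$l = 0})"
      "disjoint_family_on U L" "(\<Union>l\<in>L. U l) = {x \<in> F. i x \<in> N}"
      "\<forall>l\<in>L. \<exists>u. pl_homeomorphism (U l) (B \<inter> {v. v$l = 0}) (f \<circ> i) u"
    using assms(1) unfolding planes_at_def by (elim exE conjE) (rule that; assumption)
  obtain u where "\<forall>l\<in>L. pl_homeomorphism (U l) (B \<inter> {v. v$l = 0}) (f \<circ> i) (u l)"
    using bchoice[OF 1(7)] by blast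
  then have "plane_chart M F i p B L N f g U u"
    using 1 assms(2) by unfold_locales auto
  then show ?thesis by blast
qed

text \<open>Five of the six kinds of values differ only in \<open>B\<close> and \<open>L\<close>, so
  all but the branch values are treated uniformly.\<close>

lemma value_cases:
  assumes p: "p \<in> i ` F"
  obtains (branch) "branch_value M F i p"
  | (planes) B L N f g U u where "plane_chart M F i p B L N f g U u"
      "L \<in> {{1}, {2}, {1, 2}, {1, 2, 3}}" "L = {1,2,3} \<Longrightarrow> triple_value M F i p"
proof -
  have 3: "(3::3) \<noteq> 1" "(3::3) \<noteq> 2" by auto
  have "regular_value M F i p \<or> double_value M F i p \<or> triple_value M F i p \<or>
        branch_value M F i p \<or> RB_value M F i p \<or> DB_value M F i p"
    using p generic unfolding generic_surface_def by blast
  then consider "branch_value M F i p" | B L where "planes_at M F i B L p" "B = pl_ball \<or> B = half_ball \<and> 3 \<notin> L"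
      "L \<in> {{1}, {2}, {1, 2}, {1, 2, 3}}" "L = {1,2,3} \<Longrightarrow> triple_value M F i p"
    unfolding regular_value_def double_value_def RB_value_def DB_value_def
  proof (elim disjE)
    assume "triple_value M F i p"
    then show thesis using that(2)[of pl_ball "{1,2,3}"] unfolding triple_value_def by auto
  next
    assume "planes_at M F i pl_ball {1} p"
    then show thesis using that(2)[of pl_ball "{1}"] by auto
  next
    assume "planes_at M F i pl_ball {1,2} p"
    moreover have "{1,2::3} \<noteq> {1,2,3}" using 3 by blast
    ultimately show thesis using that(2)[of pl_ball "{1,2}"] by auto
  next
    assume "planes_at M F i half_ball {2} p"
    then show thesis using that(2)[of half_ball "{2}"] 3 by auto
  next
    assume "planes_at M F i half_ball {1,2} p"
    moreover have "{1,2::3} \<noteq> {1,2,3}" using 3 by blast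
    ultimately show thesis using that(2)[of half_ball "{1,2}"] 3 by auto
  qed
  then show thesis
  proof cases
    case 1 then show ?thesis by (rule that(1))
  next
    case (2 B L)
    then obtain N f g U u where "plane_chart M F i p B L N f g U u" using planes_at_chart by blast
    then show ?thesis using that(2) 2 by blast
  qed
qed

end

text \<open>A lifting attempt without arcs and labels: a pair in \<open>Hi\<close> has its first
  point higher. Invariance under paths of double pairs expresses one choice per strip;
  \<open>Hi_acyclic\<close> is what the formula will supply.\<close>

locale height_order = generic_surface_map M F i
  for M :: "'m::euclidean_space set" and F :: "'f::euclidean_space set" and i :: "'f \<Rightarrow> 'm" +
  fixes Hi :: "('f \<times> 'f) set"
  assumes Hi_sub: "Hi \<subseteq> double_pairs F i"
    and Hi_total: "(x, y) \<in> double_pairs F i \<Longrightarrow> (x, y) \<in> Hi \<longleftrightarrow> (y, x) \<notin> Hi"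
    and Hi_path: "path_component (double_pairs F i) e e' \<Longrightarrow> e \<in> Hi \<Longrightarrow> e' \<in> Hi"
    and Hi_acyclic: "(x, y) \<in> Hi \<Longrightarrow> (y, z) \<in> Hi \<Longrightarrow> (z, x) \<notin> Hi"
begin

lemma Hi_D: "(x, y) \<in> Hi \<Longrightarrow> x \<in> F \<and> y \<in> F \<and> x \<noteq> y \<and> i x = i y"
  using Hi_sub unfolding double_pairs_def by auto

lemma Hi_trans:
  assumes "(x, y) \<in> Hi" "(y, z) \<in> Hi" shows "(x, z) \<in> Hi"
proof -
  have "x \<noteq> z" using assms Hi_total Hi_sub by blast
  then have "(x, z) \<in> double_pairs F i" using Hi_D[OF assms(1)] Hi_D[OF assms(2)] unfolding double_pairs_def by auto
  then show ?thesis using Hi_total Hi_acyclic assms by blast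
qed

text \<open>In a sum of such functions every term respects the order weakly, and a term that is
  positive over \<open>V\<close> respects it strictly there, as the alternative of both values being
  0 is excluded.\<close>

definition local_height :: "'m \<Rightarrow> 'm set \<Rightarrow> ('f \<Rightarrow> real) \<Rightarrow> 'm set \<Rightarrow> bool" where
  "local_height p W g V \<longleftrightarrow> pl_map_on F g \<and> (\<forall>x\<in>F. 0 \<le> g x) \<and>
     (\<forall>x y. (x, y) \<in> Hi \<longrightarrow> g y < g x \<or> g x = 0 \<and> g y = 0) \<and>
     openin (top_of_set M) V \<and> p \<in> V \<and> (\<forall>x\<in>F. i x \<in> V \<longrightarrow> 0 < g x) \<and>
     (\<forall>x\<in>F. g x \<noteq> 0 \<longrightarrow> i x \<in> W)"

text \<open>The constant on a sheet is the number of sheets that have to lie below it at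
  \<open>p\<close>. Transitivity makes these counts strictly monotone, and
  \<open>double_pair_path\<close> relates every double value in the chart to the centre.\<close>

lemma plane_height:
  assumes "plane_chart M F i p B L N f g U u" and W: "openin (top_of_set M) W" "p \<in> W"
  shows "\<exists>g V. local_height p W g V"
proof -
  interpret plane_chart M F i p B L N f g U u by (rule assms(1))
  define c where "c l = real (card {l' \<in> L. (u l 0, u l' 0) \<in> Hi})" for l
  define hl where "hl x = c (THE l. l \<in> L \<and> x \<in> U l)" for x
  have hl: "hl x = c l" if "l \<in> L" "x \<in> U l" for l x
  proof -
    have "(THE l. l \<in> L \<and> x \<in> U l) = l"
      by (rule the_equality) (use that disj in \<open>auto simp: disjoint_family_on_def\<close>)
    then show ?thesis by (simp add: hl_def)
  qed
  have idN: "pl_map_on {x \<in> F. i x \<in> N} i"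
    by (rule pl_map_on_preimage[OF i_pl fD(1)])
  have "pl_map_on {x \<in> F. i x \<in> N} hl"
  proof (rule pl_map_on_local)
    fix x assume "x \<in> {x \<in> F. i x \<in> N}"
    then obtain l where l: "l \<in> L" "x \<in> U l" using UN by blast
    then show "\<exists>V X' f. openin (top_of_set {x \<in> F. i x \<in> N}) V \<and> x \<in> V \<and> V \<subseteq> X' \<and>
        X' \<subseteq> {x \<in> F. i x \<in> N} \<and> pl_map_on X' f \<and> (\<forall>y\<in>V. hl y = f y)"
      using U_open[OF l(1)] U_sub hl pl_map_on_const[OF idN, of "c l"]
      by (intro exI[of _ "U l"] exI[of _ "{x \<in> F. i x \<in> N}"] exI[of _ "\<lambda>_. c l"]) auto
  qed
  moreover have "{x \<in> F. i x \<in> N} = {x \<in> F. i x \<in> N \<and> maxnorm (f (i x)) \<le> 1}"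
    using fD(3) B_ball unfolding maxnorm_le_iff mem_pl_ball[symmetric] by blast
  ultimately have hpl: "pl_map_on {x \<in> F. i x \<in> N \<and> maxnorm (f (i x)) \<le> 1} hl" by simp
  have strict: "hl y < hl x" if xy: "(x, y) \<in> Hi" "i x \<in> N" "maxnorm (f (i x)) \<le> 1" for x y
  proof -
    note D = Hi_D[OF xy(1)]
    let ?v = "f (i x)"
    obtain l where l: "l \<in> L" "x \<in> U l" using D UN xy by blast
    obtain l' where l': "l' \<in> L" "y \<in> U l'" using D UN xy by (metis (no_types, lifting) UN_E mem_Collect_eq)
    have x: "x = u l ?v" "?v $ l = 0" "?v \<in> B" and y: "y = u l' ?v" "?v $ l' = 0"
      using U_mem[OF l] U_mem[OF l'] D by auto
    have ne: "l \<noteq> l'" using x(1) y(1) D by metis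
    have "path_component (double_pairs F i) (u l ?v, u l' ?v) (u l 0, u l' 0)"
      by (rule double_pair_path[OF l(1) l'(1) ne]) (use x(2,3) y(2) B0 in auto)
    then have ul: "(u l 0, u l' 0) \<in> Hi" using Hi_path xy(1) x(1) y(1) by metis
    have "{k \<in> L. (u l' 0, u k 0) \<in> Hi} \<subset> {k \<in> L. (u l 0, u k 0) \<in> Hi}"
    proof
      show "{k \<in> L. (u l' 0, u k 0) \<in> Hi} \<subseteq> {k \<in> L. (u l 0, u k 0) \<in> Hi}" using Hi_trans[OF ul] by blast
      have "(u l' 0, u l' 0) \<notin> Hi" using Hi_D by blast
      then show "{k \<in> L. (u l' 0, u k 0) \<in> Hi} \<noteq> {k \<in> L. (u l 0, u k 0) \<in> Hi}" using ul l' by blast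
    qed
    then have "c l' < c l" unfolding c_def by (simp add: psubset_card_mono)
    then show ?thesis using hl l l' by simp
  qed
  have 1: "\<forall>(x, y)\<in>Hi. x \<in> F \<and> y \<in> F \<and> i x = i y" using Hi_D by blast
  have 2: "\<forall>(x, y)\<in>Hi. i x \<in> N \<longrightarrow> maxnorm (f (i x)) \<le> 1 \<longrightarrow> hl y < hl x" using strict by blast
  from bump[OF N f fp B_compact zero_less_one hpl 1 2 W]
  obtain g' \<rho> \<kappa> where g': "pl_map_on F g'" "\<forall>x\<in>F. (0::real) \<le> g' x"
     "\<forall>x y. (x, y) \<in> Hi \<longrightarrow> g' y < g' x \<or> g' x = 0 \<and> g' y = 0" "(0::real) < \<rho>"
     "openin (top_of_set M) {m \<in> N. maxnorm (f m) < \<rho>}"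
     "\<forall>x\<in>F. i x \<in> N \<longrightarrow> maxnorm (f (i x)) \<le> \<rho> \<longrightarrow> g' x = hl x + \<kappa> \<and> 0 < g' x"
     "\<forall>x\<in>F. g' x \<noteq> 0 \<longrightarrow> i x \<in> W"
    by (elim exE conjE) (rule that; assumption)
  then show ?thesis using p_N fp unfolding local_height_def
    by (intro exI[of _ g'] exI[of _ "{m \<in> N. maxnorm (f m) < \<rho>}"]) auto
qed

end


section \<open>Topology near a branch value\<close>

lemma pl_map_on_open_subset:
  assumes f: "pl_map_on X f" and V: "openin (top_of_set X) V"
  shows "pl_map_on V f"
proof -
  have VX: "V \<subseteq> X" using V openin_imp_subset by blast
  obtain T where T: "open T" "V = X \<inter> T" using V unfolding openin_open by blast
  have "pl_at V f x" if x: "x \<in> V" for x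
  proof -
    have "pl_at X f x" using f x VX unfolding pl_map_on_iff by blast
    then obtain \<C> where C: "finite \<C>" "nbhd_in X x (\<Union>\<C>)" "\<And>C. C \<in> \<C> \<Longrightarrow> polytope C"
      "\<And>C. C \<in> \<C> \<Longrightarrow> affine_map_on C f" unfolding pl_at_def by auto
    obtain a b where ab: "x \<in> box a b" "cbox a b \<subseteq> T"
      using T x open_contains_cbox[of T x] by (metis IntD2)
    obtain W where W: "openin (top_of_set X) W" "x \<in> W" "W \<subseteq> \<Union>\<C>" and CX: "\<Union>\<C> \<subseteq> X"
      using C(2) unfolding nbhd_in_def by blast
    define \<E> where "\<E> = (\<lambda>C. C \<inter> cbox a b) ` \<C>"
    have UE: "\<Union>\<E> = \<Union>\<C> \<inter> cbox a b" unfolding \<E>_def by auto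
    have "openin (top_of_set X) (W \<inter> box a b)" using W(1) by (meson open_box openin_Int_open)
    moreover have "W \<inter> box a b \<subseteq> V"
    proof
      fix y assume y: "y \<in> W \<inter> box a b"
      then have "y \<in> X" using W(3) CX by blast
      moreover have "y \<in> T" using y ab(2) box_subset_cbox[of a b] by blast
      ultimately show "y \<in> V" using T(2) by blast
    qed
    ultimately have op: "openin (top_of_set V) (W \<inter> box a b)" using VX openin_subset_trans by blast
    have "W \<inter> box a b \<subseteq> \<Union>\<E>" unfolding UE using W(3) box_subset_cbox[of a b] by blast
    moreover have "\<Union>\<E> \<subseteq> V" unfolding UE using CX T(2) ab(2) by blast
    ultimately have "nbhd_in V x (\<Union>\<E>)" unfolding nbhd_in_def using op W(2) ab(1) by blast
    moreover have "polytope E \<and> affine_map_on E f" if E: "E \<in> \<E>" for E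
    proof -
      obtain C' where C': "E = C' \<inter> cbox a b" "C' \<in> \<C>" using E unfolding \<E>_def by auto
      then show ?thesis using C(3,4)[OF C'(2)] affine_map_on_subset[of C' f E]
        by (simp add: polytope_Int polytope_interval)
    qed
    moreover have "finite \<E>" using C(1) by (simp add: \<E>_def)
    ultimately show ?thesis unfolding pl_at_def by blast
  qed
  moreover have "continuous_on V f" using pl_map_on_continuous[OF f] VX by (rule continuous_on_subset)
  ultimately show ?thesis by (simp add: pl_map_on_iff)
qed

text \<open>Serves to find points with prescribed coordinates in one chart that lie in a
  neighbourhood described by another chart.\<close>

lemma path_enters:
  fixes \<gamma> :: "real \<Rightarrow> 'a::topological_space"
  assumes \<gamma>: "continuous_on {0..\<eta>} \<gamma>" "\<gamma> ` {0..\<eta>} \<subseteq> S" and V: "openin (top_of_set S) V" "\<gamma> 0 \<in> V"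
    and \<eta>: "0 < \<eta>"
  shows "\<exists>s. 0 < s \<and> s \<le> \<eta> \<and> (\<forall>t. 0 \<le> t \<longrightarrow> t \<le> s \<longrightarrow> \<gamma> t \<in> V)"
proof -
  have "openin (top_of_set {0..\<eta>}) ({0..\<eta>} \<inter> \<gamma> -` V)"
    using continuous_openin_preimage[OF \<gamma>(1) _ V(1)] \<gamma>(2) by auto
  moreover have "0 \<in> {0..\<eta>} \<inter> \<gamma> -` V" using V(2) \<eta> by auto
  ultimately obtain e where e: "0 < e" "ball 0 e \<inter> {0..\<eta>} \<subseteq> {0..\<eta>} \<inter> \<gamma> -` V"
    unfolding openin_contains_ball by blast
  have "\<gamma> t \<in> V" if "0 \<le> t" "t \<le> min (e/2) \<eta>" for t
  proof -
    have "t \<in> ball 0 e \<inter> {0..\<eta>}" using that e(1) by (auto simp: dist_real_def)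
    then show ?thesis using e(2) by blast
  qed
  then show ?thesis using e(1) \<eta> by (intro exI[of _ "min (e/2) \<eta>"]) auto
qed

text \<open>Read through \<open>e\<close>, the disc becomes an open set by invariance of domain;
  pulled back by the injective \<open>e\<close>, it fills a neighbourhood of
  \<open>q\<close>.\<close>

lemma embedded_disc_nbhd:
  fixes e :: "'m::topological_space \<Rightarrow> 'e::euclidean_space" and \<Delta> :: "'e \<Rightarrow> 'm"
  assumes O: "openin (top_of_set S) W" "q \<in> W" "continuous_on W e" "inj_on e W"
    and D: "open D" "z \<in> D" "continuous_on D \<Delta>" "inj_on \<Delta> D" "\<Delta> z = q" "\<Delta> ` D \<subseteq> S"
  shows "\<exists>V. openin (top_of_set S) V \<and> q \<in> V \<and> V \<subseteq> \<Delta> ` D"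
proof -
  define D' where "D' = D \<inter> \<Delta> -` W"
  have "openin (top_of_set D) D'"
    unfolding D'_def using continuous_openin_preimage[OF D(3) _ O(1)] D(6) by blast
  then have D': "open D'" using D(1) openin_open_trans by blast
  have sub: "D' \<subseteq> D" "\<Delta> ` D' \<subseteq> W" unfolding D'_def by auto
  have "continuous_on D' (e \<circ> \<Delta>)"
    using continuous_on_subset[OF D(3) sub(1)] continuous_on_subset[OF O(3) sub(2)] by (rule continuous_on_compose)
  moreover have "inj_on (e \<circ> \<Delta>) D'"
    using inj_on_subset[OF D(4) sub(1)] inj_on_subset[OF O(4) sub(2)] by (rule comp_inj_on)
  ultimately have T: "open ((e \<circ> \<Delta>) ` D')" using D' invariance_of_domain by blast
  have "openin (top_of_set W) (W \<inter> e -` ((e \<circ> \<Delta>) ` D'))"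
    by (rule continuous_openin_preimage_gen[OF O(3) T])
  then have "openin (top_of_set S) (W \<inter> e -` ((e \<circ> \<Delta>) ` D'))" using O(1) openin_trans by blast
  moreover have "q \<in> W \<inter> e -` ((e \<circ> \<Delta>) ` D')"
  proof -
    have "z \<in> D'" using D(2,5) O(2) unfolding D'_def by simp
    then have "(e \<circ> \<Delta>) z \<in> (e \<circ> \<Delta>) ` D'" by (rule imageI)
    then show ?thesis using D(5) O(2) by simp
  qed
  moreover have "W \<inter> e -` ((e \<circ> \<Delta>) ` D') \<subseteq> \<Delta> ` D"
  proof
    fix y assume y: "y \<in> W \<inter> e -` ((e \<circ> \<Delta>) ` D')"
    then obtain d where d: "d \<in> D'" "e y = e (\<Delta> d)" by auto
    then have "y = \<Delta> d" using O(4) y sub(2) unfolding inj_on_def by blast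
    then show "y \<in> \<Delta> ` D" using d(1) sub(1) by blast
  qed
  ultimately show ?thesis by blast
qed

text \<open>A property of the image alone, which is all that a chart at a branch value describes.
  Only an embedding into the plane is asked for, not an open one, so boundary points of a sheet
  qualify as well.\<close>

definition planar :: "'m::topological_space set \<Rightarrow> 'm \<Rightarrow> bool" where
  "planar S q \<longleftrightarrow> (\<exists>W (e :: 'm \<Rightarrow> real \<times> real).
     openin (top_of_set S) W \<and> q \<in> W \<and> continuous_on W e \<and> inj_on e W)"

text \<open>By \<open>embedded_disc_nbhd\<close> the disc would fill a neighbourhood of
  \<open>q\<close> in \<open>S\<close>, but the path leaves the disc at once.\<close>

lemma not_planar:
  fixes \<Delta> :: "real \<times> real \<Rightarrow> 'm::topological_space"
  assumes D: "open D" "z \<in> D" "continuous_on D \<Delta>" "inj_on \<Delta> D" "\<Delta> z = q" "\<Delta> ` D \<subseteq> S"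
    and \<gamma>: "continuous_on {0..\<eta>} \<gamma>" "\<gamma> ` {0..\<eta>} \<subseteq> S" "\<gamma> 0 = q" "0 < (\<eta>::real)"
    and off: "\<And>s. 0 < s \<Longrightarrow> s \<le> \<eta> \<Longrightarrow> \<gamma> s \<notin> \<Delta> ` D"
  shows "\<not> planar S q"
proof
  assume "planar S q"
  then obtain W and e :: "'m \<Rightarrow> real \<times> real" where
    "openin (top_of_set S) W" "q \<in> W" "continuous_on W e" "inj_on e W"
    unfolding planar_def by blast
  then obtain V where V: "openin (top_of_set S) V" "q \<in> V" "V \<subseteq> \<Delta> ` D"
    using embedded_disc_nbhd[OF _ _ _ _ D] by blast
  obtain s where "0 < s" "s \<le> \<eta>" "\<forall>t. 0 \<le> t \<longrightarrow> t \<le> s \<longrightarrow> \<gamma> t \<in> V"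
    using path_enters[OF \<gamma>(1,2) V(1) _ \<gamma>(4)] \<gamma>(3) V(2) by blast
  then show False using off[of s] V(3) by (meson less_imp_le order_refl subsetD)
qed

lemma continuous_on_vec3 [continuous_intros]:
  assumes "continuous_on X a" "continuous_on X b" "continuous_on X c"
  shows "continuous_on X (\<lambda>x. vec3 (a x) (b x) (c x))"
proof -
  have "vec3 r s t = r *\<^sub>R axis 1 1 + s *\<^sub>R axis 2 1 + t *\<^sub>R axis 3 1" for r s t
    by (simp add: vec3_eq_iff axis_def)
  then show ?thesis using assms by (simp add: continuous_intros)
qed

lemma vec3_inject [simp]: "vec3 a b c = vec3 a' b' c' \<longleftrightarrow> a = a' \<and> b = b' \<and> c = c'"
  by (simp add: vec3_eq_iff)

lemma figure_eight_cone_iff: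
  "v \<in> figure_eight_cone \<longleftrightarrow> 0 \<le> v$3 \<and> v$3 \<le> 1 \<and>
     (\<bar>v$1\<bar> = \<bar>v$2\<bar> \<and> 2 * \<bar>v$1\<bar> \<le> v$3 \<or> 2 * \<bar>v$1\<bar> = v$3 \<and> 2 * \<bar>v$2\<bar> \<le> v$3)"
    (is "_ \<longleftrightarrow> ?R v")
proof
  assume "v \<in> figure_eight_cone"
  then obtain t w where tw: "v = t *\<^sub>R w" "0 \<le> t" "t \<le> 1" "w \<in> figure_eight"
    unfolding figure_eight_cone_def by blast
  have w: "w$3 = 1" "\<bar>w$1\<bar> = \<bar>w$2\<bar> \<and> \<bar>w$1\<bar> \<le> 1/2 \<or> \<bar>w$1\<bar> = 1/2 \<and> \<bar>w$2\<bar> \<le> 1/2"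
    using tw(4) unfolding figure_eight_def by auto
  have v: "v$3 = t" "\<bar>v$1\<bar> = t * \<bar>w$1\<bar>" "\<bar>v$2\<bar> = t * \<bar>w$2\<bar>"
    using tw(1,2) w(1) by (auto simp: abs_mult)
  have "2 * (t * a) \<le> t" if "a \<le> 1/2" for a
    using mult_left_mono[OF that tw(2)] by simp
  moreover have "2 * (t * (1/2)) = t" by simp
  ultimately show "?R v" using w(2) tw(2,3) unfolding v by metis
next
  assume R: "?R v"
  show "v \<in> figure_eight_cone"
  proof (cases "v$3 = 0")
    case True
    then have "v = 0" using R by (auto simp: vec3_eq_iff)
    then have "v = 0 *\<^sub>R vec3 0 0 1" by simp
    moreover have "vec3 0 0 1 \<in> figure_eight" unfolding figure_eight_def by simp
    ultimately show ?thesis unfolding figure_eight_cone_def using order_refl[of "0::real"] zero_le_one by blast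
  next
    case False
    let ?w = "(1 / v$3) *\<^sub>R v"
    have "?w \<in> figure_eight"
      using R False unfolding figure_eight_def by (auto simp: divide_le_eq)
    moreover have "v = v$3 *\<^sub>R ?w" using False by simp
    ultimately show ?thesis using R unfolding figure_eight_cone_def by blast
  qed
qed

section \<open>Planarity at values with plane sheets\<close>

context plane_chart
begin

lemma center_planar:
  assumes "L = {l}" shows "planar (i ` F) p"
proof -
  obtain V where V: "openin (top_of_set M) V" "p \<in> V" "V \<subseteq> N"
    using N unfolding nbhd_in_def by blast
  define e where "e m = (if l = 1 then f m $ 2 else f m $ 1, if l = 3 then f m $ 2 else f m $ 3)" for m
  have op: "openin (top_of_set (i ` F)) (i ` F \<inter> V)"
  proof -
    obtain T where "open T" "V = M \<inter> T" using V(1) unfolding openin_open by blast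
    moreover have "i ` F \<inter> (M \<inter> T) = i ` F \<inter> T" using i_M by blast
    ultimately show ?thesis unfolding openin_open by blast
  qed
  have "continuous_on (i ` F \<inter> V) f" using continuous_on_subset[OF fD(10)] V(3) by blast
  then have "continuous_on (i ` F \<inter> V) e"
    unfolding e_def by (cases "l = 1"; cases "l = 3") (auto intro!: continuous_intros)
  moreover have "inj_on e (i ` F \<inter> V)"
  proof (rule inj_onI)
    fix m m' assume m: "m \<in> i ` F \<inter> V" and m': "m' \<in> i ` F \<inter> V" and eq: "e m = e m'"
    have "f m $ l = 0" "f m' $ l = 0" using m m' surface_iff V(3) assms by auto
    then have "f m = f m'" using eq exhaust_3[of l] by (auto simp: e_def vec3_eq_iff)
    then show "m = m'" using m m' V(3) fD(5) by (metis IntD2 subsetD)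
  qed
  moreover have "p \<in> i ` F" using surface_iff[OF p_N] assms fp by auto
  ultimately show ?thesis using op V(2) unfolding planar_def by blast
qed

lemma g_surface:
  assumes "v \<in> B" "l \<in> L" "v $ l = 0" shows "g v \<in> i ` F"
  using surface_iff[of "g v"] assms fD(4,6) by metis

text \<open>In the half ball \<open>p\<close> lies on the face, where the planes contain no open
  disc around it. Planarity at \<open>p\<close> is inherited by nearby points, so the contradiction
  is found slightly further up the common axis of the two planes, in the interior of the
  chart.\<close>

lemma center_not_planar:
  assumes L: "{1, 2} \<subseteq> L" shows "\<not> planar (i ` F) p"
proof
  assume "planar (i ` F) p"
  then obtain W and e :: "'m \<Rightarrow> real \<times> real" where
    W: "openin (top_of_set (i ` F)) W" "p \<in> W" "continuous_on W e" "inj_on e W"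
    unfolding planar_def by blast
  have inB: "vec3 a b c \<in> B" if "\<bar>a\<bar> \<le> 1" "\<bar>b\<bar> \<le> 1" "0 \<le> c" "c \<le> 1" for a b c
    using B that by (auto simp: mem_half_ball mem_pl_ball forall_3)
  have g0: "g 0 = p" using fp fD(5)[OF p_N] by simp
  have v0: "vec3 0 0 0 = 0" by (simp add: vec3_eq_iff)
  have "continuous_on {0..1} (\<lambda>s. g (vec3 0 0 s))"
    by (rule continuous_on_compose2[OF fD(11)]) (auto intro!: continuous_intros inB)
  moreover have "(\<lambda>s. g (vec3 0 0 s)) ` {0..1} \<subseteq> i ` F"
    using L g_surface[of _ 1] inB by auto
  ultimately obtain s where s: "0 < s" "s \<le> 1" "\<And>t. 0 \<le> t \<Longrightarrow> t \<le> s \<Longrightarrow> g (vec3 0 0 t) \<in> W"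
    using path_enters[of 1 "\<lambda>s. g (vec3 0 0 s)", OF _ _ W(1)] W(2) g0 v0 by auto
  define t0 where "t0 = s / 2"
  have t0: "0 < t0" "t0 < 1" "g (vec3 0 0 t0) \<in> W" using s(1,2) s(3)[of t0] by (auto simp: t0_def)
  then have "planar (i ` F) (g (vec3 0 0 t0))" using W unfolding planar_def by blast
  moreover have "\<not> planar (i ` F) (g (vec3 0 0 t0))"
  proof (rule not_planar)
    let ?D = "{-1<..<1} \<times> {0<..<1} :: (real \<times> real) set"
    let ?\<Delta> = "\<lambda>z. g (vec3 0 (fst z) (snd z))" and ?\<gamma> = "\<lambda>s. g (vec3 s 0 t0)"
    have DB: "vec3 0 (fst z) (snd z) \<in> B" if "z \<in> ?D" for z using that by (intro inB) auto
    have \<gamma>B: "vec3 s 0 t0 \<in> B" if "s \<in> {0..1}" for s using that t0 by (intro inB) auto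
    show "open ?D" by (intro open_Times) auto
    show "(0, t0) \<in> ?D" using t0 by auto
    show "continuous_on ?D ?\<Delta>"
      by (rule continuous_on_compose2[OF fD(11)]) (use DB in \<open>auto intro!: continuous_intros\<close>)
    show "inj_on ?\<Delta> ?D"
    proof (rule inj_onI)
      fix z z' assume z: "z \<in> ?D" "z' \<in> ?D" and eq: "?\<Delta> z = ?\<Delta> z'"
      have "vec3 0 (fst z) (snd z) = vec3 0 (fst z') (snd z')"
        using fD(6)[OF DB[OF z(1)]] fD(6)[OF DB[OF z(2)]] eq by metis
      then show "z = z'" by (simp add: prod_eq_iff)
    qed
    show "?\<Delta> (0, t0) = g (vec3 0 0 t0)" by simp
    show "?\<Delta> ` ?D \<subseteq> i ` F" using DB L g_surface[of _ 1] by auto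
    show "continuous_on {0..1} ?\<gamma>"
      by (rule continuous_on_compose2[OF fD(11)]) (use \<gamma>B in \<open>auto intro!: continuous_intros\<close>)
    show "?\<gamma> ` {0..1} \<subseteq> i ` F" using \<gamma>B L g_surface[of _ 2] by auto
    show "?\<gamma> 0 = g (vec3 0 0 t0)" by simp
    show "(0::real) < 1" by simp
    show "?\<gamma> s \<notin> ?\<Delta> ` ?D" if s: "0 < s" "s \<le> 1" for s
    proof
      assume "?\<gamma> s \<in> ?\<Delta> ` ?D"
      then obtain z where z: "z \<in> ?D" "?\<gamma> s = ?\<Delta> z" by blast
      have "s \<in> {0..1}" using s by auto
      then have "vec3 s 0 t0 = vec3 0 (fst z) (snd z)" using fD(6)[OF DB[OF z(1)]] fD(6)[OF \<gamma>B] z(2) by metis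
      then show False using s by simp
    qed
  qed
  ultimately show False by blast
qed

end

lemma figure_eight_cone_ball: "figure_eight_cone \<subseteq> pl_ball"
proof
  fix v assume "v \<in> figure_eight_cone"
  then show "v \<in> pl_ball" unfolding figure_eight_cone_iff by (auto simp: mem_pl_ball forall_3)
qed

lemma figure_eight_cone_axis:
  "v \<in> figure_eight_cone \<Longrightarrow> v$1 = 0 \<Longrightarrow> v = vec3 0 0 (v$3) \<and> 0 \<le> v$3"
  unfolding figure_eight_cone_iff by (auto simp: vec3_eq_iff)

text \<open>Hence the cone over each of the two loops of the figure-8 projects injectively to the plane.\<close>

lemma figure_eight_cone_loop:
  "v \<in> figure_eight_cone \<Longrightarrow> \<bar>v$1\<bar> = max \<bar>v$2\<bar> (- (v$3 - 4 * \<bar>v$1\<bar>) / 2)"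
  unfolding figure_eight_cone_iff by (elim conjE disjE; simp add: max_def; linarith)

context generic_surface_map
begin

lemma multi_surface: "multi q \<Longrightarrow> q \<in> i ` F"
  unfolding multi_def double_pairs_def by auto

lemma surface_open: assumes "openin (top_of_set M) V" shows "openin (top_of_set (i ` F)) (i ` F \<inter> V)"
proof -
  obtain T where "open T" "V = M \<inter> T" using assms unfolding openin_open by blast
  moreover have "i ` F \<inter> (M \<inter> T) = i ` F \<inter> T" using i_M by blast
  ultimately show ?thesis unfolding openin_open by blast
qed

end

section \<open>Planarity and multiple values near a branch value\<close>

locale branch_chart = generic_surface_map M F i
  for M :: "'m::euclidean_space set" and F :: "'f::euclidean_space set" and i :: "'f \<Rightarrow> 'm" +
  fixes p :: 'm and N :: "'m set" and f :: "'m \<Rightarrow> real^3" and g :: "real^3 \<Rightarrow> 'm"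
    and b :: 'f and \<rho> :: real
  assumes N: "nbhd_in M p N" and f: "pl_homeomorphism N pl_ball f g" and fp: "f p = 0"
    and image: "f ` (N \<inter> i ` F) = figure_eight_cone"
    and b: "b \<in> F" "i b = p" and single: "x \<in> F \<Longrightarrow> i x = p \<Longrightarrow> x = b"
    and \<rho>: "0 < \<rho>" "\<rho> \<le> 1"
    and nb_open: "0 < r \<Longrightarrow> r \<le> \<rho> \<Longrightarrow> openin (top_of_set M) {m \<in> N. maxnorm (f m) < r}"
begin

lemmas fD = pl_homeomorphismD[OF f]

text \<open>Open in \<open>M\<close>, and small enough that the bound \<open>v$3 \<le> 1\<close> in
  the cone is not felt.\<close>

definition nb :: "'m set" where "nb = {m \<in> N. maxnorm (f m) < \<rho>}"

lemma nb_N: "q \<in> nb \<Longrightarrow> q \<in> N" and nb_less: "q \<in> nb \<Longrightarrow> \<bar>f q $ j\<bar> < \<rho>"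
  by (auto simp: nb_def maxnorm_less_iff)

lemma nb_openin: "openin (top_of_set M) nb"
  unfolding nb_def using nb_open[of \<rho>] \<rho> by simp

lemma N_M: "N \<subseteq> M" and p_N: "p \<in> N" and p_nb: "p \<in> nb"
  using N fp \<rho> unfolding nbhd_in_def nb_def by auto

lemma surface_iff: assumes "q \<in> N" shows "q \<in> i ` F \<longleftrightarrow> f q \<in> figure_eight_cone"
proof
  assume "q \<in> i ` F" then show "f q \<in> figure_eight_cone" using image assms by blast
next
  assume "f q \<in> figure_eight_cone"
  then have "f q \<in> f ` (N \<inter> i ` F)" by (simp only: image)
  then obtain q' where "q' \<in> N" "q' \<in> i ` F" "f q = f q'" by blast
  then show "q \<in> i ` F" using assms fD(5) by metis
qed

lemma g_cone:
  assumes "v \<in> figure_eight_cone" shows "g v \<in> i ` F" "f (g v) = v" "g v \<in> N"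
proof -
  have "v \<in> pl_ball" using assms figure_eight_cone_ball by blast
  then show "f (g v) = v" "g v \<in> N" using fD(4,6) by auto
  then show "g v \<in> i ` F" using surface_iff assms by simp
qed

lemma f_cont_nb: "continuous_on (i ` F \<inter> nb) f"
  by (rule continuous_on_subset[OF fD(10)]) (auto simp: nb_def)

text \<open>On one side of the axis the cone consists of a single loop, opened at the axis, and
  projects injectively to a plane.\<close>

lemma off_axis_planar:
  assumes q: "q \<in> nb" "q \<in> i ` F" "f q $ 1 \<noteq> 0" shows "planar (i ` F) q"
proof -
  define \<sigma> where "\<sigma> = sgn (f q $ 1)"
  define W where "W = (i ` F \<inter> nb) \<inter> (\<lambda>m. \<sigma> * f m $ 1) -` {0<..}"
  \<comment> \<open>With the factor 4 the second entry is \<open>- 2 * \<bar>v$1\<bar>\<close> over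
    the sides and at least that in the diagonal planes, where
    \<open>\<bar>v$1\<bar> = \<bar>v$2\<bar>\<close>; so \<open>\<bar>v$1\<bar>\<close> can be read
    off as a maximum.\<close>
  define e where "e m = (f m $ 2, f m $ 3 - 4 * \<bar>f m $ 1\<bar>)" for m
  have "openin (top_of_set (i ` F \<inter> nb)) W"
    unfolding W_def by (rule continuous_openin_preimage_gen) (auto intro!: continuous_intros f_cont_nb)
  then have "openin (top_of_set (i ` F)) W"
    using surface_open[OF nb_openin] openin_trans by blast
  moreover have "q \<in> W" using q unfolding W_def \<sigma>_def by (auto simp: sgn_if)
  moreover have "continuous_on W e"
    unfolding e_def by (intro continuous_intros continuous_on_subset[OF f_cont_nb]) (auto simp: W_def)
  moreover have "inj_on e W"
  proof (rule inj_onI)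
    fix m m' assume m: "m \<in> W" "m' \<in> W" and eq: "e m = e m'"
    have c: "f m \<in> figure_eight_cone" "f m' \<in> figure_eight_cone" and N: "m \<in> N" "m' \<in> N"
      using m surface_iff nb_N unfolding W_def by auto
    have abs: "\<bar>f m $ 1\<bar> = \<bar>f m' $ 1\<bar>"
      using figure_eight_cone_loop[OF c(1)] figure_eight_cone_loop[OF c(2)] eq unfolding e_def
      by (metis (no_types, lifting) prod.inject)
    moreover have "0 < \<sigma> * f m $ 1" "0 < \<sigma> * f m' $ 1" using m unfolding W_def by auto
    ultimately have "f m $ 1 = f m' $ 1" by (auto simp: abs_if zero_less_mult_iff split: if_splits)
    then have "f m = f m'" using eq abs by (auto simp: e_def vec3_eq_iff)
    then show "m = m'" using N fD(5) by metis
  qed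
  ultimately show ?thesis unfolding planar_def by blast
qed

text \<open>The cone over the loop with \<open>v$1 \<ge> 0\<close> contains an open disc around
  every point of the axis, the cone point included. A path in a diagonal half-plane of the other
  loop leaves this disc at once.\<close>

lemma axis_not_planar:
  assumes q: "q \<in> nb" "q \<in> i ` F" "f q $ 1 = 0" shows "\<not> planar (i ` F) q"
proof (rule not_planar)
  define c where "c = f q $ 3"
  have fq: "f q = vec3 0 0 c" "0 \<le> c" "c < \<rho>"
    using figure_eight_cone_axis[of "f q"] q surface_iff[OF nb_N] nb_less[of q 3] by (auto simp: c_def)
  \<comment> \<open>\<open>a\<close> recovers the first coordinate as in
    \<open>figure_eight_cone_loop\<close>, and \<open>\<delta>\<close> inverts the projection of
    that loop's cone to the plane.\<close>
  define a :: "real \<times> real \<Rightarrow> real" where "a z = max \<bar>fst z\<bar> (- snd z / 2)" for z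
  define \<delta> where "\<delta> z = vec3 (a z) (fst z) (snd z + 4 * a z)" for z
  let ?D = "{z. maxnorm (\<delta> z) < \<rho>}" and ?\<Delta> = "\<lambda>z. g (\<delta> z)"
  define \<eta> where "\<eta> = (\<rho> - c) / 4"
  let ?\<gamma> = "\<lambda>s. g (vec3 (- s) s (c + 2 * s))"
  have \<delta>: "\<delta> z \<in> figure_eight_cone" if "z \<in> ?D" for z
  proof -
    have "\<bar>\<delta> z $ 3\<bar> < \<rho>" using that maxnorm_less_iff by blast
    moreover have "0 \<le> a z" "a z = \<bar>fst z\<bar> \<and> - snd z \<le> 2 * a z \<or> 2 * a z = - snd z \<and> \<bar>fst z\<bar> \<le> a z"
      unfolding a_def by (auto simp: max_def)
    ultimately show ?thesis using \<rho> unfolding figure_eight_cone_iff \<delta>_def vec3_nth by linarith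
  qed
  have \<gamma>: "vec3 (- s) s (c + 2 * s) \<in> figure_eight_cone" if "s \<in> {0..\<eta>}" for s
  proof -
    have "s \<le> (\<rho> - c) / 4" "0 \<le> s" using that by (auto simp: \<eta>_def)
    then show ?thesis using fq \<rho> unfolding figure_eight_cone_iff by auto
  qed
  have cont: "continuous_on UNIV \<delta>" unfolding \<delta>_def a_def by (intro continuous_intros) auto
  show "open ?D" using continuous_on_maxnorm[OF cont] by (intro open_Collect_less) auto
  show "(0, c) \<in> ?D" using fq by (auto simp: \<delta>_def a_def maxnorm_def)
  show "continuous_on ?D ?\<Delta>"
    by (rule continuous_on_compose2[OF fD(11) continuous_on_subset[OF cont]])
      (use \<delta> figure_eight_cone_ball in auto)
  show "inj_on ?\<Delta> ?D"
  proof (rule inj_onI)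
    fix z z' assume z: "z \<in> ?D" "z' \<in> ?D" and eq: "?\<Delta> z = ?\<Delta> z'"
    have "\<delta> z = \<delta> z'" using g_cone(2)[OF \<delta>[OF z(1)]] g_cone(2)[OF \<delta>[OF z(2)]] eq by metis
    then show "z = z'" by (auto simp: \<delta>_def prod_eq_iff)
  qed
  have "g (vec3 0 0 c) = q" using fq(1) fD(5) nb_N[OF q(1)] by metis
  then show "?\<Delta> (0, c) = q" "?\<gamma> 0 = q" using fq by (auto simp: \<delta>_def a_def)
  show "?\<Delta> ` ?D \<subseteq> i ` F" using g_cone(1) \<delta> by blast
  show "continuous_on {0..\<eta>} ?\<gamma>"
    by (rule continuous_on_compose2[OF fD(11)])
      (use \<gamma> figure_eight_cone_ball in \<open>auto intro!: continuous_intros\<close>)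
  show "?\<gamma> ` {0..\<eta>} \<subseteq> i ` F" using g_cone(1) \<gamma> by blast
  show "0 < \<eta>" using fq by (simp add: \<eta>_def)
  show "?\<gamma> s \<notin> ?\<Delta> ` ?D" if s: "0 < s" "s \<le> \<eta>" for s
  proof
    assume "?\<gamma> s \<in> ?\<Delta> ` ?D"
    then obtain z where z: "z \<in> ?D" "?\<gamma> s = ?\<Delta> z" by blast
    have "s \<in> {0..\<eta>}" using s by auto
    then have "vec3 (- s) s (c + 2 * s) = \<delta> z" using g_cone(2)[OF \<delta>[OF z(1)]] g_cone(2)[OF \<gamma>] z(2) by metis
    then have "- s = a z" unfolding \<delta>_def by simp
    moreover have "0 \<le> a z" unfolding a_def by auto
    ultimately show False using s by simp
  qed
qed

end

context generic_surface_map
begin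

lemma branch_value_chart:
  assumes "branch_value M F i p"
  shows "\<exists>N f g b \<rho>. branch_chart M F i p N f g b \<rho>"
proof -
  obtain N f g where 1: "nbhd_in M p N" "pl_homeomorphism N pl_ball f g" "f p = 0"
      "f ` (N \<inter> i ` F) = figure_eight_cone"
    using assms unfolding branch_value_def by blast
  obtain b where b: "b \<in> F" "i b = p" "\<And>x. x \<in> F \<Longrightarrow> i x = p \<Longrightarrow> x = b"
    using assms unfolding branch_value_def by blast
  have "p \<in> M" using 1(1) unfolding nbhd_in_def by blast
  obtain r where r: "0 < r" "\<forall>r'. 0 < r' \<longrightarrow> r' \<le> r \<longrightarrow> openin (top_of_set M) {m \<in> N. maxnorm (f m) < r'}"
    using chart_small[OF 1(1) pl_homeomorphismD(9)[OF 1(2)] 1(3) openin_subtopology_self \<open>p \<in> M\<close>] by blast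
  have "branch_chart M F i p N f g b (min r 1)"
    by unfold_locales ((rule 1 b; assumption) | (insert r, auto))+
  then show ?thesis by blast
qed

end

context branch_chart
begin

lemma axis_eq:
  assumes "q \<in> nb" "q \<in> i ` F" "f q $ 1 = 0"
  shows "f q = vec3 0 0 (f q $ 3)" "0 \<le> f q $ 3" "g (vec3 0 0 (f q $ 3)) = q"
proof -
  show 1: "f q = vec3 0 0 (f q $ 3)" "0 \<le> f q $ 3"
    using figure_eight_cone_axis[of "f q"] assms surface_iff[OF nb_N] by auto
  show "g (vec3 0 0 (f q $ 3)) = q" using 1(1) fD(5)[OF nb_N[OF assms(1)]] by metis
qed

lemma axis_pos:
  assumes "q \<in> nb" "q \<in> i ` F" "f q $ 1 = 0" "q \<noteq> p" shows "0 < f q $ 3"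
proof (rule ccontr)
  assume "\<not> 0 < f q $ 3"
  then have "f q $ 3 = 0" using axis_eq(2)[OF assms(1-3)] by simp
  then have "f q = 0" using axis_eq(1)[OF assms(1-3)] by (simp add: vec3_eq_iff)
  then show False using fp fD(5) p_N nb_N[OF assms(1)] assms(4) by metis
qed

lemma g_axis:
  assumes "0 \<le> t" "t < \<rho>"
  shows "g (vec3 0 0 t) \<in> nb" "g (vec3 0 0 t) \<in> i ` F" "f (g (vec3 0 0 t)) = vec3 0 0 t"
proof -
  have c: "vec3 0 0 t \<in> figure_eight_cone" using assms \<rho> by (auto simp: figure_eight_cone_iff)
  show "g (vec3 0 0 t) \<in> i ` F" "f (g (vec3 0 0 t)) = vec3 0 0 t" using g_cone[OF c] by auto
  then show "g (vec3 0 0 t) \<in> nb" using g_cone(3)[OF c] assms by (auto simp: nb_def maxnorm_def)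
qed

text \<open>The points where the surface is not planar form the axis. Around \<open>q\<close> this
  is an open interval in the chart at \<open>p\<close>, whereas a branch value is an end point of
  the axis in its own chart; invariance of domain in dimension one excludes this.\<close>

lemma isolated_branch:
  assumes q: "q \<in> nb" "q \<in> i ` F" "q \<noteq> p" shows "\<not> branch_value M F i q"
proof
  assume "branch_value M F i q"
  then obtain N' f' g' b' \<rho>' where "branch_chart M F i q N' f' g' b' \<rho>'" using branch_value_chart by blast
  then interpret q: branch_chart M F i q N' f' g' b' \<rho>' .
  have "\<not> planar (i ` F) q" using q.axis_not_planar[OF q.p_nb q(2)] q.fp by simp
  then have q1: "f q $ 1 = 0" using off_axis_planar q by blast
  define c where "c = f q $ 3"
  have c: "0 < c" "c < \<rho>" using axis_pos[OF q(1,2) q1 q(3)] nb_less[OF q(1), of 3] by (auto simp: c_def)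
  let ?\<gamma> = "\<lambda>t. g (vec3 0 0 t)"
  define J where "J = {0<..<\<rho>} \<inter> ?\<gamma> -` q.nb"
  have J: "?\<gamma> t \<in> nb" "?\<gamma> t \<in> i ` F" "f (?\<gamma> t) = vec3 0 0 t" "?\<gamma> t \<in> q.nb" if "t \<in> J" for t
    using that g_axis[of t] unfolding J_def by auto
  have cont: "continuous_on {0<..<\<rho>} ?\<gamma>"
    by (rule continuous_on_compose2[OF fD(11)]) (use \<rho> in \<open>auto intro!: continuous_intros simp: mem_pl_ball forall_3\<close>)
  have "openin (top_of_set {0<..<\<rho>}) J"
    unfolding J_def by (rule continuous_openin_preimage[OF cont _ q.nb_openin])
      (use g_axis(1) nb_N N_M in force)
  then have oJ: "open J" by (rule openin_open_trans) simp
  have axis: "f' (?\<gamma> t) $ 1 = 0" if "t \<in> J" for t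
    using q.off_axis_planar[OF J(4,2)[OF that]] axis_not_planar[OF J(1,2)[OF that]] J(3)[OF that] by auto
  note ax = q.axis_eq[OF J(4,2) axis]
  let ?h = "\<lambda>t. f' (?\<gamma> t) $ 3"
  have "continuous_on J ?h"
  proof (intro continuous_intros continuous_on_compose2[OF q.fD(10)])
    show "continuous_on J ?\<gamma>" using cont by (rule continuous_on_subset) (auto simp: J_def)
    show "?\<gamma> ` J \<subseteq> N'" using J(4) q.nb_N by blast
  qed
  moreover have "inj_on ?h J"
  proof (rule inj_onI)
    fix t t' assume t: "t \<in> J" "t' \<in> J" and eq: "?h t = ?h t'"
    then have "?\<gamma> t = ?\<gamma> t'" using ax(3) by metis
    then have "vec3 0 0 t = vec3 0 0 t'" using J(3) t by metis
    then show "t = t'" by simp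
  qed
  ultimately have oh: "open (?h ` J)" using oJ invariance_of_domain by blast
  have "?\<gamma> c = q" using axis_eq(3)[OF q(1,2) q1] by (simp add: c_def)
  then have "c \<in> J" "?h c = 0" using c q.p_nb q.fp by (auto simp: J_def)
  then have "0 \<in> ?h ` J" by force
  then obtain e where e: "0 < e" "ball 0 e \<subseteq> ?h ` J" using oh open_contains_ball by blast
  \<comment> \<open>Since 0 is interior to the image, negative values are taken too, but the axis in
    the chart at \<open>q\<close> has height at least 0.\<close>
  have "- e / 2 \<in> ball 0 e" using e(1) by (simp add: dist_real_def)
  then have "- e / 2 \<in> ?h ` J" using e(2) by blast
  then obtain t where "t \<in> J" "- e / 2 = ?h t" by blast
  then show False using ax(2)[of t] e(1) by linarith
qed

text \<open>Planarity rules out crossing sheets and \<open>isolated_branch\<close> rules out branch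
  values, so only the kinds with one sheet remain.\<close>

lemma off_axis_not_multi:
  assumes q: "q \<in> nb" "q \<in> i ` F" "f q $ 1 \<noteq> 0" shows "\<not> multi q"
proof -
  have "q \<noteq> p" using q(3) fp by auto
  have pl: "planar (i ` F) q" by (rule off_axis_planar[OF q])
  from q(2) show ?thesis
  proof (cases rule: value_cases)
    case branch
    then show ?thesis using isolated_branch q \<open>q \<noteq> p\<close> by blast
  next
    case (planes B L N' f' g' U u)
    interpret q: plane_chart M F i q B L N' f' g' U u by (rule planes(1))
    have "\<not> {1, 2} \<subseteq> L" using q.center_not_planar pl by blast
    then have "L = {1} \<or> L = {2}" using planes(2) by auto
    then show ?thesis using q.multi_iff[OF q.p_N] by auto
  qed
qed

text \<open>Planarity excludes single sheets and isolation excludes branch values. At a triple value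
  the multiple values would form three lines, all inside the axis; one line already fills an
  interval of the axis around \<open>q\<close>, so a second line would have to meet it outside
  \<open>q\<close>.\<close>

lemma axis_chart:
  assumes q: "q \<in> nb" "q \<in> i ` F" "f q $ 1 = 0" "q \<noteq> p"
  obtains B N' f' g' U u where "plane_chart M F i q B {1, 2} N' f' g' U u"
proof -
  have npl: "\<not> planar (i ` F) q" by (rule axis_not_planar[OF q(1-3)])
  from q(2) show thesis
  proof (cases rule: value_cases)
    case branch
    then show thesis using isolated_branch q by blast
  next
    case (planes B L N' f' g' U u)
    interpret q: plane_chart M F i q B L N' f' g' U u by (rule planes(1))
    have "L \<noteq> {1}" "L \<noteq> {2}" using q.center_planar npl by auto
    then consider "L = {1, 2}" | "L = {1, 2, 3}" using planes(2) by blast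
    then show thesis
    proof cases
      case 1
      then show thesis using planes(1) by (auto intro: that)
    next
      case 2
      then have B: "B = pl_ball" using q.B by auto
      have g'0: "g' 0 = q" using q.fp q.fD(5)[OF q.p_N] by simp
      have v0: "vec3 0 0 0 = 0" by (simp add: vec3_eq_iff)
      have onax: "f m = vec3 0 0 (f m $ 3)" if "m \<in> nb" "multi m" for m
      proof -
        have "m \<in> i ` F" using that(2) by (rule multi_surface)
        then show ?thesis using off_axis_not_multi axis_eq(1) that by blast
      qed
      have g'B: "g' v \<in> N'" "f' (g' v) = v" if "\<forall>j. \<bar>v$j\<bar> \<le> 1" for v
        using that q.fD(4,6) B by (auto simp: mem_pl_ball)
      let ?\<gamma> = "\<lambda>s. g' (vec3 0 0 s)" and ?\<gamma>' = "\<lambda>s. g' (vec3 s 0 0)"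
      have \<gamma>: "?\<gamma> s \<in> N'" "f' (?\<gamma> s) = vec3 0 0 s" "?\<gamma>' s \<in> N'" "f' (?\<gamma>' s) = vec3 s 0 0" if "\<bar>s\<bar> \<le> 1" for s
        using that g'B[of "vec3 0 0 s"] g'B[of "vec3 s 0 0"] by (auto simp: forall_3)
      have multi: "multi (?\<gamma> s)" "multi (?\<gamma>' s)" if "\<bar>s\<bar> \<le> 1" for s
        using q.multi_iff[OF \<gamma>(1)[OF that]] q.multi_iff[OF \<gamma>(3)[OF that]] \<gamma>(2,4)[OF that] 2 by auto
      define J where "J = {-1<..<1} \<inter> ?\<gamma> -` nb"
      have cont: "continuous_on {-1<..<1} ?\<gamma>"
        by (rule continuous_on_compose2[OF q.fD(11)]) (auto intro!: continuous_intros simp: B mem_pl_ball forall_3)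
      have "openin (top_of_set {-1<..<1}) J"
        unfolding J_def by (rule continuous_openin_preimage[OF cont _ nb_openin]) (use \<gamma>(1) q.N_M in force)
      then have oJ: "open J" by (rule openin_open_trans) simp
      have J: "\<bar>s\<bar> \<le> 1" "?\<gamma> s \<in> nb" if "s \<in> J" for s using that unfolding J_def by auto
      let ?h = "\<lambda>s. f (?\<gamma> s) $ 3"
      have "continuous_on J ?h"
      proof (intro continuous_intros continuous_on_compose2[OF fD(10)])
        show "continuous_on J ?\<gamma>" using cont by (rule continuous_on_subset) (auto simp: J_def)
        show "?\<gamma> ` J \<subseteq> N" using J(2) nb_N by blast
      qed
      moreover have "inj_on ?h J"
      proof (rule inj_onI)
        fix t t' assume t: "t \<in> J" "t' \<in> J" and eq: "?h t = ?h t'"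
        then have "f (?\<gamma> t) = f (?\<gamma> t')" using onax J multi(1) by metis
        then have "?\<gamma> t = ?\<gamma> t'" using fD(5) J(2) t nb_N by metis
        then have "vec3 0 0 t = vec3 0 0 t'" using \<gamma>(2) J(1) t by metis
        then show "t = t'" by simp
      qed
      ultimately have oh: "open (?h ` J)" using oJ invariance_of_domain by blast
      have "0 \<in> J" using q(1) g'0 v0 by (auto simp: J_def)
      define V where "V = (i ` F \<inter> nb) \<inter> (\<lambda>m. f m $ 3) -` (?h ` J)"
      have "openin (top_of_set (i ` F \<inter> nb)) V"
        unfolding V_def by (rule continuous_openin_preimage_gen[OF _ oh]) (intro continuous_intros f_cont_nb)
      then have V: "openin (top_of_set (i ` F)) V"
        using surface_open[OF nb_openin] openin_trans by blast
      have "continuous_on {0..1} ?\<gamma>'"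
        by (rule continuous_on_compose2[OF q.fD(11)]) (auto intro!: continuous_intros simp: B mem_pl_ball forall_3)
      moreover have "?\<gamma>' ` {0..1} \<subseteq> i ` F"
        using multi(2) multi_surface by auto
      moreover have "?\<gamma>' 0 \<in> V"
        using g'0 v0 q(1,2) \<open>0 \<in> J\<close> unfolding V_def by (auto intro!: image_eqI[of _ _ 0])
      ultimately obtain s where s: "0 < s" "s \<le> 1" "\<forall>t. 0 \<le> t \<longrightarrow> t \<le> s \<longrightarrow> ?\<gamma>' t \<in> V"
        using path_enters[of 1 ?\<gamma>' "i ` F" V] V by auto
      have sV: "?\<gamma>' s \<in> V" using s by auto
      then obtain t where t: "t \<in> J" "f (?\<gamma>' s) $ 3 = f (?\<gamma> t) $ 3" unfolding V_def by auto
      have "f (?\<gamma>' s) = f (?\<gamma> t)"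
        using onax[of "?\<gamma>' s"] onax[OF J(2)[OF t(1)]] multi s(1,2) sV t J(1)[OF t(1)] unfolding V_def by auto
      moreover have "?\<gamma>' s \<in> N" "?\<gamma> t \<in> N" using sV J(2)[OF t(1)] nb_N unfolding V_def by auto
      ultimately have "?\<gamma>' s = ?\<gamma> t" using fD(5) by metis
      then have "vec3 s 0 0 = vec3 0 0 t" using \<gamma>(2)[OF J(1)[OF t(1)]] \<gamma>(4)[of s] s by auto
      then show thesis using s(1) by simp
    qed
  qed
qed

lemma multi_iff:
  assumes q: "q \<in> nb" "q \<in> i ` F" shows "multi q \<longleftrightarrow> f q $ 1 = 0 \<and> q \<noteq> p"
proof
  assume m: "multi q"
  have "\<not> multi p" using single unfolding multi_def double_pairs_def by auto
  then show "f q $ 1 = 0 \<and> q \<noteq> p" using m off_axis_not_multi q by auto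
next
  assume "f q $ 1 = 0 \<and> q \<noteq> p"
  then obtain B N' f' g' U u where "plane_chart M F i q B {1, 2} N' f' g' U u" using axis_chart q by blast
  then interpret q: plane_chart M F i q B "{1, 2}" N' f' g' U u .
  show "multi q" using q.multi_iff[OF q.p_N] q.fp by auto
qed

end


section \<open>Crossing sheets near a branch value\<close>

lemma no_zero_same_sign:
  fixes y :: "'a::real_normed_vector \<Rightarrow> real"
  assumes "convex \<beta>" "continuous_on \<beta> y" "w \<in> \<beta>" "w' \<in> \<beta>"
    and nz: "\<And>t. 0 \<le> t \<Longrightarrow> t \<le> 1 \<Longrightarrow> y ((1 - t) *\<^sub>R w + t *\<^sub>R w') \<noteq> 0"
  shows "0 < y w \<longleftrightarrow> 0 < y w'"
proof -
  let ?\<phi> = "\<lambda>t. y ((1 - t) *\<^sub>R w + t *\<^sub>R w')"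
  have "continuous_on {0..1} ?\<phi>"
  proof (rule continuous_on_compose2[OF assms(2)])
    show "continuous_on {0..1} (\<lambda>t. (1 - t) *\<^sub>R w + t *\<^sub>R w')" by (intro continuous_intros)
    show "(\<lambda>t. (1 - t) *\<^sub>R w + t *\<^sub>R w') ` {0..1} \<subseteq> \<beta>"
      using convexD_alt[OF assms(1,3,4)] by auto
  qed
  then have c: "connected (?\<phi> ` {0..1})" by (intro connected_continuous_image) auto
  have m: "y w \<in> ?\<phi> ` {0..1}" "y w' \<in> ?\<phi> ` {0..1}"
    by (rule image_eqI[of _ _ 0], simp_all) (rule image_eqI[of _ _ 1], simp_all)
  have "0 \<notin> ?\<phi> ` {0..1}" using nz by force
  then show ?thesis
    using connectedD_interval[OF c m, of 0] connectedD_interval[OF c m(2,1), of 0]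
    by (metis linorder_le_cases order.order_iff_strict)
qed

text \<open>The letters stand for four half-planes in cyclic order: unprimed for the sheet to which
  each belongs, primed for the half of that sheet. If all four combinations occur and neighbours are
  never the two halves of one sheet, the sheets alternate.\<close>

lemma cyclic_rays:
  assumes "a \<and> a' \<or> b \<and> b' \<or> c \<and> c' \<or> d \<and> d'" "a \<and> \<not> a' \<or> b \<and> \<not> b' \<or> c \<and> \<not> c' \<or> d \<and> \<not> d'"
    "\<not> a \<and> a' \<or> \<not> b \<and> b' \<or> \<not> c \<and> c' \<or> \<not> d \<and> d'"
    "\<not> a \<and> \<not> a' \<or> \<not> b \<and> \<not> b' \<or> \<not> c \<and> \<not> c' \<or> \<not> d \<and> \<not> d'"
    and "\<not> (a = b \<and> a' \<noteq> b')" "\<not> (b = c \<and> b' \<noteq> c')" "\<not> (c = d \<and> c' \<noteq> d')" "\<not> (d = a \<and> d' \<noteq> a')"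
  shows "\<not> a \<and> \<not> c \<and> b \<and> d \<or> a \<and> c \<and> \<not> b \<and> \<not> d"
  using assms by (cases a; cases b; cases c; cases d) simp_all

text \<open>The coordinate functions of one chart of a pair of crossing sheets, read in another chart, where
  the sheets are the diagonal planes.  The four half-planes have to be permuted, and adjacent ones
  cannot become opposite ones as the sector between them is disjoint from the sheets.\<close>

lemma crossing_sheets:
  fixes y1 y2 :: "real^3 \<Rightarrow> real"
  assumes \<beta>: "\<beta> = {w. \<bar>w$1\<bar> < \<eta> \<and> \<bar>w$2\<bar> < \<eta> \<and> \<bar>w$3 - c\<bar> < \<eta>}" and \<eta>: "0 < \<eta>"
    and cont: "continuous_on \<beta> y1" "continuous_on \<beta> y2"
    and sheets: "\<And>w. w \<in> \<beta> \<Longrightarrow> \<bar>w$1\<bar> = \<bar>w$2\<bar> \<longleftrightarrow> y1 w = 0 \<or> y2 w = 0"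
    and axis: "\<And>w. w \<in> \<beta> \<Longrightarrow> w$1 = 0 \<and> w$2 = 0 \<longleftrightarrow> y1 w = 0 \<and> y2 w = 0"
    and rays: "\<exists>w\<in>\<beta>. y2 w = 0 \<and> 0 < y1 w" "\<exists>w\<in>\<beta>. y2 w = 0 \<and> y1 w < 0"
      "\<exists>w\<in>\<beta>. y1 w = 0 \<and> 0 < y2 w" "\<exists>w\<in>\<beta>. y1 w = 0 \<and> y2 w < 0"
  shows "(\<forall>w\<in>\<beta>. (y1 w = 0 \<longrightarrow> w$2 = w$1) \<and> (y2 w = 0 \<longrightarrow> w$2 = - w$1)) \<or>
         (\<forall>w\<in>\<beta>. (y2 w = 0 \<longrightarrow> w$2 = w$1) \<and> (y1 w = 0 \<longrightarrow> w$2 = - w$1))"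
proof -
  have conv: "convex \<beta>"
  proof -
    have "\<beta> = {w. axis 1 1 \<bullet> w < \<eta>} \<inter> {w. axis 1 1 \<bullet> w > - \<eta>} \<inter> {w. axis 2 1 \<bullet> w < \<eta>} \<inter>
        {w. axis 2 1 \<bullet> w > - \<eta>} \<inter> {w. axis 3 1 \<bullet> w < \<eta> + c} \<inter> {w. axis 3 1 \<bullet> w > c - \<eta>}"
      unfolding \<beta> by (auto simp: inner_axis' abs_less_iff)
    then show ?thesis by (simp add: convex_Int convex_halfspace_lt convex_halfspace_gt)
  qed
  have seg: "(1 - t) *\<^sub>R w + t *\<^sub>R w' \<in> \<beta>" if "w \<in> \<beta>" "w' \<in> \<beta>" "0 \<le> t" "t \<le> 1" for w w' t
    using convexD_alt[OF conv] that by auto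
  \<comment> \<open>Numbers the four half-planes cyclically: parity tells the sheet, the two halves
    of a sheet differ by 2, and the numbers below 2 are the positive halves. On the axis and off the
    sheets the value has no meaning.\<close>
  define ray where "ray w = (if y2 w = 0 then (if 0 < y1 w then 0 else 2) else (if 0 < y2 w then 1 else (3::nat)))" for w
  have ray_const: "ray w = ray w'"
    if w: "w \<in> \<beta>" "w' \<in> \<beta>" "0 < \<sigma> * w$1" "0 < \<sigma> * w'$1" "w$2 = \<tau> * w$1" "w'$2 = \<tau> * w'$1" "\<bar>\<tau>\<bar> = 1" for w w' \<sigma> \<tau>
  proof -
    \<comment> \<open>On the sheets and off the axis exactly one of \<open>y1\<close> and
      \<open>y2\<close> vanishes. So neither the sum nor the difference does, and their two signs
      determine \<open>ray\<close>.\<close>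
    have z: "y1 z + y2 z \<noteq> 0" "y1 z - y2 z \<noteq> 0" if z: "z = (1 - t) *\<^sub>R w + t *\<^sub>R w'" and t: "0 \<le> t" "t \<le> 1" for z t
    proof -
      have zb: "z \<in> \<beta>" using seg[OF w(1,2) t] z by simp
      have "z$2 = \<tau> * z$1" using w(5,6) by (simp add: z algebra_simps)
      then have "\<bar>z$1\<bar> = \<bar>z$2\<bar>" using w(7) by (simp add: abs_mult)
      then have 1: "y1 z = 0 \<or> y2 z = 0" using sheets[OF zb] by blast
      have "\<sigma> * z$1 = (1 - t) * (\<sigma> * w$1) + t * (\<sigma> * w'$1)" by (simp add: z algebra_simps)
      moreover have "0 < (1 - t) * (\<sigma> * w$1) + t * (\<sigma> * w'$1)"
        using w(3,4) t by (cases "t = 0") (auto intro!: add_nonneg_pos)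
      ultimately have "z$1 \<noteq> 0" by auto
      then have "\<not> (y1 z = 0 \<and> y2 z = 0)" using axis[OF zb] by blast
      then show "y1 z + y2 z \<noteq> 0" "y1 z - y2 z \<noteq> 0" using 1 by auto
    qed
    have "0 < y1 w + y2 w \<longleftrightarrow> 0 < y1 w' + y2 w'"
      by (rule no_zero_same_sign[OF conv _ w(1,2)]) (use cont z(1) in \<open>auto intro!: continuous_intros\<close>)
    moreover have "0 < y1 w - y2 w \<longleftrightarrow> 0 < y1 w' - y2 w'"
      by (rule no_zero_same_sign[OF conv _ w(1,2)]) (use cont z(2) in \<open>auto intro!: continuous_intros\<close>)
    moreover have "y1 w + y2 w \<noteq> 0" "y1 w - y2 w \<noteq> 0" "y1 w' + y2 w' \<noteq> 0" "y1 w' - y2 w' \<noteq> 0"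
      using z[of w 0] z[of w' 1] by auto
    moreover have "y1 w = 0 \<or> y2 w = 0" "y1 w' = 0 \<or> y2 w' = 0"
      using sheets[OF w(1)] sheets[OF w(2)] w(5-7) by (auto simp: abs_mult)
    moreover have "ray v = (if 0 < y1 v + y2 v then (if 0 < y1 v - y2 v then 0 else 1)
        else (if 0 < y1 v - y2 v then 3 else 2))" if "y1 v = 0 \<or> y2 v = 0" "y1 v + y2 v \<noteq> 0" for v
      using that unfolding ray_def by (elim disjE) auto
    ultimately show ?thesis by simp
  qed
  \<comment> \<open>For \<open>\<sigma>\<close> and \<open>\<tau>\<close> equal to 1 or -1 these are
    sample points, one in each half-plane; intermediate values parametrize the segments between
    them.\<close>
  define h where "h \<sigma> \<tau> = vec3 (\<sigma> * \<eta> / 2) (\<tau> * \<eta> / 2) c" for \<sigma> \<tau> :: real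
  have h: "h \<sigma> \<tau> \<in> \<beta>" if "\<bar>\<sigma>\<bar> \<le> 1" "\<bar>\<tau>\<bar> \<le> 1" for \<sigma> \<tau>
  proof -
    have "\<bar>\<sigma>\<bar> * \<eta> \<le> 1 * \<eta>" "\<bar>\<tau>\<bar> * \<eta> \<le> 1 * \<eta>" using that \<eta> by (auto intro!: mult_right_mono)
    then show ?thesis using \<eta> unfolding \<beta> h_def by (auto simp: abs_mult)
  qed
  have hseg: "(1 - t) *\<^sub>R h \<sigma> \<tau> + t *\<^sub>R h \<sigma>' \<tau>' = h ((1 - t) * \<sigma> + t * \<sigma>') ((1 - t) * \<tau> + t * \<tau>')" for t \<sigma> \<tau> \<sigma>' \<tau>'
    unfolding h_def vec3_eq_iff by (simp add: field_simps)
  have h_sheet: "\<bar>h \<sigma> \<tau> $ 1\<bar> = \<bar>h \<sigma> \<tau> $ 2\<bar> \<longleftrightarrow> \<bar>\<sigma>\<bar> = \<bar>\<tau>\<bar>" for \<sigma> \<tau>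
    unfolding h_def using \<eta> by (simp add: abs_mult)
  \<comment> \<open>The open segment between samples in neighbouring half-planes misses the sheets.
    Were these the two halves of one sheet, the coordinate function that changes sign would vanish
    inside the segment.\<close>
  have adjacent: "ray w \<noteq> ray w' + 2"
    if s: "w = h \<sigma> \<tau>" "w' = h \<sigma>' \<tau>'" "\<bar>\<sigma>\<bar> = 1" "\<bar>\<tau>\<bar> = 1" "\<bar>\<sigma>'\<bar> = 1" "\<bar>\<tau>'\<bar> = 1" "\<sigma> = \<sigma>' \<longleftrightarrow> \<tau> \<noteq> \<tau>'" for w w' \<sigma> \<tau> \<sigma>' \<tau>'
  proof
    assume r: "ray w = ray w' + 2"
    have wb: "w \<in> \<beta>" "w' \<in> \<beta>" using h s by auto
    have nz: "y1 z \<noteq> 0 \<and> y2 z \<noteq> 0" if z: "z = (1 - t) *\<^sub>R w + t *\<^sub>R w'" and t: "0 < t" "t < 1" for z t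
    proof -
      have zb: "z \<in> \<beta>" using seg[OF wb] z t by simp
      have "\<bar>(1 - t) * \<sigma> + t * \<sigma>'\<bar> \<noteq> \<bar>(1 - t) * \<tau> + t * \<tau>'\<bar>"
        using s(3-7) t by (auto simp: abs_if split: if_splits)
      then have "\<bar>z$1\<bar> \<noteq> \<bar>z$2\<bar>" unfolding z s(1,2) hseg h_sheet .
      then show ?thesis using sheets[OF zb] by blast
    qed
    have on: "y1 w = 0 \<or> y2 w = 0" "y1 w' = 0 \<or> y2 w' = 0"
      using sheets[OF wb(1)] sheets[OF wb(2)] h_sheet s by auto
    have off: "\<not> (y1 w = 0 \<and> y2 w = 0)" "\<not> (y1 w' = 0 \<and> y2 w' = 0)"
      using axis[OF wb(1)] axis[OF wb(2)] s \<eta> by (auto simp: h_def)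
    have "y2 w = 0 \<and> y2 w' = 0 \<and> y1 w \<noteq> 0 \<and> y1 w' \<noteq> 0 \<and> (0 < y1 w) \<noteq> (0 < y1 w') \<or>
        y1 w = 0 \<and> y1 w' = 0 \<and> y2 w \<noteq> 0 \<and> y2 w' \<noteq> 0 \<and> (0 < y2 w) \<noteq> (0 < y2 w')"
      using r on off unfolding ray_def by (auto split: if_splits)
    then show False
    proof
      assume *: "y2 w = 0 \<and> y2 w' = 0 \<and> y1 w \<noteq> 0 \<and> y1 w' \<noteq> 0 \<and> (0 < y1 w) \<noteq> (0 < y1 w')"
      have "y1 ((1 - t) *\<^sub>R w + t *\<^sub>R w') \<noteq> 0" if "0 \<le> t" "t \<le> 1" for t
        using nz[OF refl, of t] * that by (cases "t = 0"; cases "t = 1") auto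
      then show False using no_zero_same_sign[OF conv cont(1) wb] * by blast
    next
      assume *: "y1 w = 0 \<and> y1 w' = 0 \<and> y2 w \<noteq> 0 \<and> y2 w' \<noteq> 0 \<and> (0 < y2 w) \<noteq> (0 < y2 w')"
      have "y2 ((1 - t) *\<^sub>R w + t *\<^sub>R w') \<noteq> 0" if "0 \<le> t" "t \<le> 1" for t
        using nz[OF refl, of t] * that by (cases "t = 0"; cases "t = 1") auto
      then show False using no_zero_same_sign[OF conv cont(2) wb] * by blast
    qed
  qed
  have ray_h: "ray w = ray (h (sgn (w$1)) (sgn (w$2)))" if w: "w \<in> \<beta>" "w$1 \<noteq> 0" "\<bar>w$1\<bar> = \<bar>w$2\<bar>" for w
  proof (rule ray_const[where \<sigma> = "sgn (w$1)" and \<tau> = "sgn (w$1) * sgn (w$2)"])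
    show "w \<in> \<beta>" by (rule w(1))
    show "h (sgn (w$1)) (sgn (w$2)) \<in> \<beta>" by (intro h) (auto simp: sgn_if)
    show "0 < sgn (w$1) * w$1" using w(2) by (auto simp: sgn_if)
    show "0 < sgn (w$1) * h (sgn (w$1)) (sgn (w$2)) $ 1" using w(2) \<eta> by (auto simp: sgn_if h_def)
    show "w$2 = sgn (w$1) * sgn (w$2) * w$1" using w(2,3) by (auto simp: sgn_if abs_if split: if_splits)
    show "h (sgn (w$1)) (sgn (w$2)) $ 2 = sgn (w$1) * sgn (w$2) * h (sgn (w$1)) (sgn (w$2)) $ 1"
      using w(2) by (auto simp: h_def sgn_if)
    show "\<bar>sgn (w$1) * sgn (w$2)\<bar> = 1" using w(2,3) by (auto simp: sgn_if abs_mult)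
  qed
  \<comment> \<open>The samples are listed in cyclic order around the axis, as
    \<open>cyclic_rays\<close> requires.\<close>
  define A B C D where ABCD: "A = ray (h 1 1)" "B = ray (h 1 (-1))" "C = ray (h (-1) (-1))" "D = ray (h (-1) 1)"
  have cases: "ray w \<in> {A, B, C, D}" if w: "w \<in> \<beta>" "w$1 \<noteq> 0" "\<bar>w$1\<bar> = \<bar>w$2\<bar>" for w
    using ray_h[OF w] w(2,3) unfolding ABCD by (auto simp: sgn_if split: if_splits)
  have attained: "ray w \<in> {A, B, C, D}" if w: "w \<in> \<beta>" "y1 w = 0 \<or> y2 w = 0" "\<not> (y1 w = 0 \<and> y2 w = 0)" for w
  proof -
    have "\<bar>w$1\<bar> = \<bar>w$2\<bar>" using sheets[OF w(1)] w(2) by blast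
    moreover have "w$1 \<noteq> 0" using axis[OF w(1)] w(3) calculation by auto
    ultimately show ?thesis using cases[OF w(1)] by blast
  qed
  have all: "0 \<in> {A, B, C, D}" "2 \<in> {A, B, C, D}" "1 \<in> {A, B, C, D}" "3 \<in> {A, B, C, D}"
  proof -
    obtain w where w: "w \<in> \<beta>" "y2 w = 0" "0 < y1 w" using rays(1) by blast
    then have "ray w = 0" by (simp add: ray_def)
    then show "0 \<in> {A, B, C, D}" using attained[OF w(1)] w(2,3) by auto
    obtain w where w: "w \<in> \<beta>" "y2 w = 0" "y1 w < 0" using rays(2) by blast
    then have "ray w = 2" by (simp add: ray_def)
    then show "2 \<in> {A, B, C, D}" using attained[OF w(1)] w(2,3) by auto
    obtain w where w: "w \<in> \<beta>" "y1 w = 0" "0 < y2 w" using rays(3) by blast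
    then have "ray w = 1" by (simp add: ray_def)
    then show "1 \<in> {A, B, C, D}" using attained[OF w(1)] w(2,3) by auto
    obtain w where w: "w \<in> \<beta>" "y1 w = 0" "y2 w < 0" using rays(4) by blast
    then have "ray w = 3" by (simp add: ray_def)
    then show "3 \<in> {A, B, C, D}" using attained[OF w(1)] w(2,3) by auto
  qed
  have adj: "A \<noteq> B + 2" "B \<noteq> A + 2" "B \<noteq> C + 2" "C \<noteq> B + 2" "C \<noteq> D + 2" "D \<noteq> C + 2" "D \<noteq> A + 2" "A \<noteq> D + 2"
    unfolding ABCD by (rule adjacent[OF refl refl]; simp)+
  have ABCD_parity: "odd A \<and> odd C \<and> even B \<and> even D \<or> even A \<and> even C \<and> odd B \<and> odd D"
  proof (rule cyclic_rays[where a' = "A < 2" and b' = "B < 2" and c' = "C < 2" and d' = "D < 2"])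
    have bound: "A < 4" "B < 4" "C < 4" "D < 4" unfolding ABCD ray_def by simp_all
    have "\<not> (even r = even r' \<and> (r < 2) \<noteq> (r' < 2))" if "r < 4" "r' < 4" "r \<noteq> r' + 2" "r' \<noteq> r + 2" for r r' :: nat
      using that by presburger
    then show "\<not> (even A = even B \<and> (A < 2) \<noteq> (B < 2))" "\<not> (even B = even C \<and> (B < 2) \<noteq> (C < 2))"
      "\<not> (even C = even D \<and> (C < 2) \<noteq> (D < 2))" "\<not> (even D = even A \<and> (D < 2) \<noteq> (A < 2))"
      using bound adj by blast+
    have "\<exists>r\<in>{A, B, C, D}. even r \<and> r < 2" by (rule bexI[OF _ all(1)]) simp
    moreover have "\<exists>r\<in>{A, B, C, D}. even r \<and> \<not> r < 2" by (rule bexI[OF _ all(2)]) simp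
    moreover have "\<exists>r\<in>{A, B, C, D}. odd r \<and> r < 2" by (rule bexI[OF _ all(3)]) simp
    moreover have "\<exists>r\<in>{A, B, C, D}. odd r \<and> \<not> r < 2" by (rule bexI[OF _ all(4)]) simp
    ultimately show "even A \<and> A < 2 \<or> even B \<and> B < 2 \<or> even C \<and> C < 2 \<or> even D \<and> D < 2"
      "even A \<and> \<not> A < 2 \<or> even B \<and> \<not> B < 2 \<or> even C \<and> \<not> C < 2 \<or> even D \<and> \<not> D < 2"
      "odd A \<and> A < 2 \<or> odd B \<and> B < 2 \<or> odd C \<and> C < 2 \<or> odd D \<and> D < 2"
      "odd A \<and> \<not> A < 2 \<or> odd B \<and> \<not> B < 2 \<or> odd C \<and> \<not> C < 2 \<or> odd D \<and> \<not> D < 2"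
      by blast+
  qed
  have parity: "even (ray w) \<longleftrightarrow> y2 w = 0" for w by (simp add: ray_def)
  have diag: "ray w \<in> {A, C} \<and> w$2 = w$1 \<or> ray w \<in> {B, D} \<and> w$2 = - w$1"
    if w: "w \<in> \<beta>" "w$1 \<noteq> 0" "\<bar>w$1\<bar> = \<bar>w$2\<bar>" for w
    using ray_h[OF w] w(2,3) unfolding ABCD by (auto simp: sgn_if split: if_splits)
  have concl: "w$2 = w$1 \<and> ray w \<in> {A, C} \<or> w$2 = - w$1 \<and> ray w \<in> {B, D} \<or> w$1 = 0 \<and> w$2 = 0"
    if w: "w \<in> \<beta>" "y1 w = 0 \<or> y2 w = 0" for w
  proof (cases "w$1 = 0")
    case True
    then show ?thesis using sheets[OF w(1)] w(2) by auto
  next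
    case False
    then show ?thesis using diag[OF w(1)] sheets[OF w(1)] w(2) by blast
  qed
  from ABCD_parity show ?thesis
  proof
    assume *: "odd A \<and> odd C \<and> even B \<and> even D"
    have "(y1 w = 0 \<longrightarrow> w$2 = w$1) \<and> (y2 w = 0 \<longrightarrow> w$2 = - w$1)" if w: "w \<in> \<beta>" for w
      using concl[OF w] axis[OF w] * parity[of w] by auto
    then show ?thesis by blast
  next
    assume *: "even A \<and> even C \<and> odd B \<and> odd D"
    have "(y2 w = 0 \<longrightarrow> w$2 = w$1) \<and> (y1 w = 0 \<longrightarrow> w$2 = - w$1)" if w: "w \<in> \<beta>" for w
      using concl[OF w] axis[OF w] * parity[of w] by auto
    then show ?thesis by blast
  qed
qed

section \<open>The two sheets over the axis\<close>

context branch_chart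
begin

text \<open>The last condition excludes \<open>b\<close>, whose image is the cone point.\<close>

definition above :: "'f \<Rightarrow> bool" where
  "above z \<longleftrightarrow> z \<in> F \<and> i z \<in> nb \<and> 0 < f (i z) $ 3"

text \<open>The chart at \<open>q\<close> knows the sheets of \<open>i\<close> but not the cone, the
  chart at \<open>p\<close> knows the cone but not the sheets. Both see the same surface and the
  same multiple values, which is what \<open>crossing_sheets\<close> needs to match the coordinate
  planes with the diagonal planes. The last clause makes off-axis points accumulate at both points
  over \<open>q\<close>.\<close>

lemma axis_local:
  assumes q: "q \<in> nb" "q \<in> i ` F" "f q $ 1 = 0" "q \<noteq> p"
  obtains x y Wx Wy where "x \<in> Wx" "y \<in> Wy" "openin (top_of_set F) Wx" "openin (top_of_set F) Wy"
    "{z \<in> F. i z = q} = {x, y}" "x \<noteq> y"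
    "\<And>z. z \<in> Wx \<Longrightarrow> above z \<and> f (i z) $ 2 = f (i z) $ 1"
    "\<And>z. z \<in> Wy \<Longrightarrow> above z \<and> f (i z) $ 2 = - f (i z) $ 1"
    "\<And>x' y'. x' \<in> Wx \<Longrightarrow> y' \<in> Wy \<Longrightarrow> i x' = i y' \<Longrightarrow> path_component (double_pairs F i) (x', y') (x, y)"
    "\<And>W z. z \<in> {x, y} \<Longrightarrow> openin (top_of_set F) W \<Longrightarrow> z \<in> W \<Longrightarrow> \<exists>z'\<in>W. above z' \<and> f (i z') $ 1 \<noteq> 0"
proof -
  obtain B N' f' g' U u where "plane_chart M F i q B {1, 2} N' f' g' U u" using axis_chart[OF q] .
  then interpret q: plane_chart M F i q B "{1, 2}" N' f' g' U u .
  define c where "c = f q $ 3"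
  have c: "0 < c" "c < \<rho>" using axis_pos[OF q] nb_less[OF q(1), of 3] by (auto simp: c_def)
  have fq: "f q = vec3 0 0 c" using axis_eq(1)[OF q(1-3)] by (simp add: c_def)
  have q_ball: "f q \<in> pl_ball" using fD(3) nb_N q(1) by blast
  have gq: "g (f q) = q" using fD(5) nb_N q(1) by blast
  obtain V' where V': "openin (top_of_set M) V'" "q \<in> V'" "V' \<subseteq> N'"
    using q.N unfolding nbhd_in_def by blast
  have "openin (top_of_set pl_ball) (pl_ball \<inter> g -` (V' \<inter> nb))"
    by (rule continuous_openin_preimage[OF fD(11) _ openin_Int[OF V'(1) nb_openin]])
      (use fD(4) N_M in blast)
  moreover have "f q \<in> pl_ball \<inter> g -` (V' \<inter> nb)" using q_ball gq V'(2) q(1) by simp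
  ultimately obtain e where e: "0 < e" "ball (f q) e \<inter> pl_ball \<subseteq> pl_ball \<inter> g -` (V' \<inter> nb)"
    unfolding openin_contains_ball by blast
  \<comment> \<open>The bound by \<open>e / 4\<close> absorbs the factor 3 between the norms,
    \<open>c / 4\<close> keeps the box away from the sides of the cone, where
    \<open>2 * \<bar>v$1\<bar> = v$3\<close>, and \<open>1 - c\<close> keeps it in the cube.\<close>
  define \<eta> where "\<eta> = min (e / 4) (min (c / 4) (1 - c))"
  have \<eta>: "0 < \<eta>" "\<eta> \<le> e / 4" "\<eta> \<le> c / 4" "\<eta> \<le> 1 - c" using e(1) c \<rho> by (auto simp: \<eta>_def min_def)
  define \<beta> where "\<beta> = {w::real^3. \<bar>w$1\<bar> < \<eta> \<and> \<bar>w$2\<bar> < \<eta> \<and> \<bar>w$3 - c\<bar> < \<eta>}"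
  have \<beta>_ball: "w \<in> pl_ball" and \<beta>_g: "g w \<in> V'" "g w \<in> nb" "f (g w) = w" and \<beta>3: "0 < w$3"
    and \<beta>_cone: "w \<in> figure_eight_cone \<longleftrightarrow> \<bar>w$1\<bar> = \<bar>w$2\<bar>" if w: "w \<in> \<beta>" for w
  proof -
    have w': "\<bar>w$1\<bar> < \<eta>" "\<bar>w$2\<bar> < \<eta>" "c - \<eta> < w$3" "w$3 < c + \<eta>"
      using w unfolding \<beta>_def by (auto simp: abs_less_iff)
    show 3: "0 < w$3" using w' \<eta> c by linarith
    show 1: "w \<in> pl_ball" unfolding mem_pl_ball forall_3 using w' \<eta> c 3 \<rho> by (intro conjI; linarith)
    have "maxnorm (w - f q) \<le> \<eta>"
    proof -
      have "\<bar>w$3 - c\<bar> \<le> \<eta>" using w' by linarith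
      then show ?thesis using w'(1,2) unfolding maxnorm_def fq by simp
    qed
    then have "w \<in> ball (f q) e"
      using norm_le_maxnorm[of "w - f q"] \<eta>(1,2) by (simp add: dist_norm norm_minus_commute)
    then show "g w \<in> V'" "g w \<in> nb" using e(2) 1 by auto
    show "f (g w) = w" using fD(6) 1 by blast
    show "w \<in> figure_eight_cone \<longleftrightarrow> \<bar>w$1\<bar> = \<bar>w$2\<bar>"
      unfolding figure_eight_cone_iff using w' \<eta> c 3 by auto
  qed
  define y1 y2 where y: "y1 w = f' (g w) $ 1" "y2 w = f' (g w) $ 2" for w
  have cont: "continuous_on \<beta> (\<lambda>w. f' (g w))"
  proof (rule continuous_on_compose2[OF q.fD(10) continuous_on_subset[OF fD(11)]])
    show "\<beta> \<subseteq> pl_ball" using \<beta>_ball by blast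
    show "g ` \<beta> \<subseteq> N'" using \<beta>_g(1) V'(3) by blast
  qed
  have surf: "g w \<in> i ` F \<longleftrightarrow> \<bar>w$1\<bar> = \<bar>w$2\<bar>" if w: "w \<in> \<beta>" for w
    using surface_iff[OF nb_N[OF \<beta>_g(2)[OF w]]] \<beta>_g(3)[OF w] \<beta>_cone[OF w] by simp
  have surf': "g w \<in> i ` F \<longleftrightarrow> y1 w = 0 \<or> y2 w = 0" if w: "w \<in> \<beta>" for w
    using q.surface_iff[of "g w"] \<beta>_g(1)[OF w] V'(3) unfolding y by auto
  have mul': "multi (g w) \<longleftrightarrow> y1 w = 0 \<and> y2 w = 0" if w: "w \<in> \<beta>" for w
    using q.multi_iff[of "g w"] \<beta>_g(1)[OF w] V'(3) unfolding y by auto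
  have mul: "multi (g w) \<longleftrightarrow> w$1 = 0 \<and> w$2 = 0" if w: "w \<in> \<beta>" for w
  proof -
    have "g w \<noteq> p" using \<beta>_g(3)[OF w] \<beta>3[OF w] fp by (metis less_irrefl zero_index)
    then show ?thesis
      using multi_iff[OF \<beta>_g(2)[OF w]] surf[OF w] multi_surface[of "g w"] \<beta>_g(3)[OF w] by auto
  qed
  define V where "V = nb \<inter> f -` \<beta>"
  have "open \<beta>"
    unfolding \<beta>_def by (intro open_Collect_conj open_Collect_less continuous_intros)
  then have "openin (top_of_set nb) V"
    unfolding V_def by (intro continuous_openin_preimage_gen continuous_on_subset[OF fD(10)])
      (auto simp: nb_def)
  then have V: "openin (top_of_set M) V" using nb_openin openin_trans by blast
  have gf: "g (f m) = m" "f m \<in> \<beta>" "m \<in> nb" if "m \<in> V" for m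
    using that fD(5) nb_N unfolding V_def by auto
  have V_V': "m \<in> V'" "m \<in> N'" if "m \<in> V" for m
    using gf[OF that] \<beta>_g(1) V'(3) by (metis, metis subsetD)
  have "f q \<in> \<beta>" unfolding \<beta>_def fq using \<eta>(1) by simp
  then have qV: "q \<in> V" using q(1) by (simp add: V_def)
  have g'0: "g' 0 = q" using q.fp q.fD(5)[OF q.p_N] by simp
  have v0: "vec3 0 0 0 = 0" by (simp add: vec3_eq_iff)
  have inB: "vec3 a b 0 \<in> B" if "\<bar>a\<bar> \<le> 1" "\<bar>b\<bar> \<le> 1" for a b
    using q.B that by (auto simp: mem_half_ball mem_pl_ball forall_3)
  \<comment> \<open>Follows a ray of the chart at \<open>q\<close> into \<open>V\<close>; the four
    coordinate directions exhibit a point on each half-plane.\<close>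
  have ray: "\<exists>w\<in>\<beta>. \<exists>t>0. f' (g w) = vec3 (\<sigma> * t) (\<tau> * t) 0" if "\<bar>\<sigma>\<bar> \<le> 1" "\<bar>\<tau>\<bar> \<le> 1" for \<sigma> \<tau>
  proof -
    let ?\<gamma> = "\<lambda>t. g' (vec3 (\<sigma> * t) (\<tau> * t) 0)"
    have inB': "vec3 (\<sigma> * t) (\<tau> * t) 0 \<in> B" if "t \<in> {0..1}" for t
      using that \<open>\<bar>\<sigma>\<bar> \<le> 1\<close> \<open>\<bar>\<tau>\<bar> \<le> 1\<close> by (intro inB) (auto simp: abs_mult intro: mult_le_one)
    have "continuous_on {0..1} ?\<gamma>"
      by (rule continuous_on_compose2[OF q.fD(11)]) (use inB' in \<open>auto intro!: continuous_intros\<close>)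
    moreover have "?\<gamma> ` {0..1} \<subseteq> M" using q.fD(4) inB' q.N_M by blast
    moreover have "?\<gamma> 0 \<in> V" using qV g'0 v0 by simp
    ultimately obtain s where s: "0 < s" "s \<le> 1" "\<forall>t. 0 \<le> t \<longrightarrow> t \<le> s \<longrightarrow> ?\<gamma> t \<in> V"
      using path_enters[of 1 ?\<gamma> M V] V by auto
    have sV: "?\<gamma> s \<in> V" using s by auto
    have "f' (?\<gamma> s) = vec3 (\<sigma> * s) (\<tau> * s) 0" using q.fD(6) inB'[of s] s by auto
    then show ?thesis using gf[OF sV] s(1) by metis
  qed
  have r1: "\<exists>w\<in>\<beta>. y2 w = 0 \<and> 0 < y1 w"
  proof -
    have "\<exists>w\<in>\<beta>. \<exists>t>0. f' (g w) = vec3 ((1) * t) ((0) * t) 0" by (rule ray) simp_all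
    then obtain w t where "w \<in> \<beta>" "0 < t" "f' (g w) = vec3 ((1) * t) ((0) * t) 0" by blast
    then show ?thesis unfolding y by (intro bexI[of _ w]) auto
  qed
  have r2: "\<exists>w\<in>\<beta>. y2 w = 0 \<and> y1 w < 0"
  proof -
    have "\<exists>w\<in>\<beta>. \<exists>t>0. f' (g w) = vec3 ((-1) * t) ((0) * t) 0" by (rule ray) simp_all
    then obtain w t where "w \<in> \<beta>" "0 < t" "f' (g w) = vec3 ((-1) * t) ((0) * t) 0" by blast
    then show ?thesis unfolding y by (intro bexI[of _ w]) auto
  qed
  have r3: "\<exists>w\<in>\<beta>. y1 w = 0 \<and> 0 < y2 w"
  proof -
    have "\<exists>w\<in>\<beta>. \<exists>t>0. f' (g w) = vec3 ((0) * t) ((1) * t) 0" by (rule ray) simp_all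
    then obtain w t where "w \<in> \<beta>" "0 < t" "f' (g w) = vec3 ((0) * t) ((1) * t) 0" by blast
    then show ?thesis unfolding y by (intro bexI[of _ w]) auto
  qed
  have r4: "\<exists>w\<in>\<beta>. y1 w = 0 \<and> y2 w < 0"
  proof -
    have "\<exists>w\<in>\<beta>. \<exists>t>0. f' (g w) = vec3 ((0) * t) ((-1) * t) 0" by (rule ray) simp_all
    then obtain w t where "w \<in> \<beta>" "0 < t" "f' (g w) = vec3 ((0) * t) ((-1) * t) 0" by blast
    then show ?thesis unfolding y by (intro bexI[of _ w]) auto
  qed
  have "(\<forall>w\<in>\<beta>. (y1 w = 0 \<longrightarrow> w$2 = w$1) \<and> (y2 w = 0 \<longrightarrow> w$2 = - w$1)) \<or>
         (\<forall>w\<in>\<beta>. (y2 w = 0 \<longrightarrow> w$2 = w$1) \<and> (y1 w = 0 \<longrightarrow> w$2 = - w$1))"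
  proof (rule crossing_sheets[OF \<beta>_def \<eta>(1) _ _ _ _ r1 r2 r3 r4])
    show "continuous_on \<beta> y1" "continuous_on \<beta> y2"
      unfolding y using cont by (auto intro!: continuous_intros)
    show "\<bar>w$1\<bar> = \<bar>w$2\<bar> \<longleftrightarrow> y1 w = 0 \<or> y2 w = 0" if "w \<in> \<beta>" for w
      using surf[OF that] surf'[OF that] by blast
    show "w$1 = 0 \<and> w$2 = 0 \<longleftrightarrow> y1 w = 0 \<and> y2 w = 0" if "w \<in> \<beta>" for w
      using mul[OF that] mul'[OF that] by blast
  qed
  \<comment> \<open>\<open>k\<close> is the index of the sheet in the plane
    \<open>v$2 = v$1\<close>, and \<open>k'\<close> that of the sheet in
    \<open>v$2 = - v$1\<close>.\<close>
  then obtain k k' :: 3 where kk: "k = 1 \<and> k' = 2 \<or> k = 2 \<and> k' = 1"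
    and yk: "\<And>w. w \<in> \<beta> \<Longrightarrow> f' (g w) $ k = 0 \<Longrightarrow> w$2 = w$1"
    and yk': "\<And>w. w \<in> \<beta> \<Longrightarrow> f' (g w) $ k' = 0 \<Longrightarrow> w$2 = - w$1"
  proof (elim disjE)
    assume "\<forall>w\<in>\<beta>. (y1 w = 0 \<longrightarrow> w$2 = w$1) \<and> (y2 w = 0 \<longrightarrow> w$2 = - w$1)"
    then show thesis using that[of 1 2] unfolding y by blast
  next
    assume "\<forall>w\<in>\<beta>. (y2 w = 0 \<longrightarrow> w$2 = w$1) \<and> (y1 w = 0 \<longrightarrow> w$2 = - w$1)"
    then show thesis using that[of 2 1] unfolding y by blast
  qed
  have kL: "k \<in> {1, 2}" "k' \<in> {1, 2}" "k \<noteq> k'" using kk by auto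
  define Z where "Z = {z \<in> F. i z \<in> V}"
  have Z: "openin (top_of_set F) Z" unfolding Z_def by (rule preimage_open[OF V])
  have Uo: "openin (top_of_set F) (U l \<inter> Z)" if l: "l \<in> {1, 2}" for l
  proof -
    obtain T where T: "open T" "U l = {x \<in> F. i x \<in> N'} \<inter> T"
      using q.U_open[OF l] unfolding openin_open by blast
    have "U l \<inter> Z = Z \<inter> T" using T(2) V_V'(2) unfolding Z_def by blast
    then show ?thesis using Z T(1) by (simp add: openin_Int_open)
  qed
  have Zf: "f (i z) \<in> \<beta>" "g (f (i z)) = i z" "above z" if "z \<in> Z" for z
    using that gf[of "i z"] \<beta>3[of "f (i z)"] unfolding Z_def above_def by auto
  have uZ: "u l 0 \<in> U l \<inter> Z" if "l \<in> {1, 2}" for l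
    using q.u_mem[OF that q.B0] g'0 qV unfolding Z_def by auto
  show thesis
  proof (rule that[of "u k 0" "U k \<inter> Z" "u k' 0" "U k' \<inter> Z"])
    show "u k 0 \<in> U k \<inter> Z" "u k' 0 \<in> U k' \<inter> Z" using uZ kL by auto
    show "openin (top_of_set F) (U k \<inter> Z)" "openin (top_of_set F) (U k' \<inter> Z)" using Uo kL by auto
    have "z \<in> F \<and> i z = q \<longleftrightarrow> z = u k 0 \<or> z = u k' 0" for z
      using q.preimage_iff[OF q.p_N] q.fp kk by auto
    then show "{z \<in> F. i z = q} = {u k 0, u k' 0}" by blast
    show "u k 0 \<noteq> u k' 0" using q.u_neq[OF kL q.B0 _ q.B0] by simp
    show "above z \<and> f (i z) $ 2 = f (i z) $ 1" if "z \<in> U k \<inter> Z" for z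
      using that q.U_mem(1)[OF kL(1)] yk[OF Zf(1)] Zf(2,3) by auto
    show "above z \<and> f (i z) $ 2 = - f (i z) $ 1" if "z \<in> U k' \<inter> Z" for z
      using that q.U_mem(1)[OF kL(2)] yk'[OF Zf(1)] Zf(2,3) by auto
    show "path_component (double_pairs F i) (x', y') (u k 0, u k' 0)"
      if x': "x' \<in> U k \<inter> Z" and y': "y' \<in> U k' \<inter> Z" and eq: "i x' = i y'" for x' y'
    proof -
      let ?v = "f' (i x')"
      have 1: "u k ?v = x'" "?v $ k = 0" "?v \<in> B" using q.U_mem[OF kL(1)] x' by auto
      have 2: "u k' ?v = y'" "?v $ k' = 0" using q.U_mem[OF kL(2)] y' eq by auto
      show ?thesis using q.double_pair_path[OF kL 1(3,2) 2(2) q.B0] 1(1) 2(1) by simp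
    qed
    show "\<exists>z'\<in>W. above z' \<and> f (i z') $ 1 \<noteq> 0"
      if z: "z \<in> {u k 0, u k' 0}" and W: "openin (top_of_set F) W" "z \<in> W" for W z
    proof -
      obtain l where l: "l \<in> {1, 2}" "z = u l 0" using z kL by auto
      let ?v = "\<lambda>t. vec3 (if l = 2 then t else 0) (if l = 1 then t else 0) 0"
      have vB: "?v t \<in> B" "?v t $ l = 0" if "t \<in> {0..1}" for t using inB that l(1) by auto
      have "continuous_on {0..1} ?v"
        by (cases "l = 1"; cases "l = 2") (auto intro!: continuous_intros)
      then have "continuous_on {0..1} (\<lambda>t. u l (?v t))"
        by (rule continuous_on_compose2[OF q.uD(11)[OF l(1)]]) (use vB in blast)
      moreover have "(\<lambda>t. u l (?v t)) ` {0..1} \<subseteq> F" using q.u_mem(2)[OF l(1) vB] by blast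
      moreover have WZ: "openin (top_of_set F) (W \<inter> Z)" using W(1) Z by (rule openin_Int)
      moreover have "u l (?v 0) \<in> W \<inter> Z" using W(2) l uZ[OF l(1)] v0 by auto
      ultimately obtain s where s: "0 < s" "s \<le> 1" "\<forall>t. 0 \<le> t \<longrightarrow> t \<le> s \<longrightarrow> u l (?v t) \<in> W \<inter> Z"
        using path_enters[of 1 "\<lambda>t. u l (?v t)" F "W \<inter> Z"] by auto
      let ?z = "u l (?v s)"
      have sZ: "?z \<in> W \<inter> Z" using s by auto
      have s01: "s \<in> {0..1}" using s by auto
      have f's: "f' (i ?z) = ?v s" by (rule q.u_mem(3)[OF l(1) vB[OF s01]])
      have "\<not> (f' (i ?z) $ 1 = 0 \<and> f' (i ?z) $ 2 = 0)" unfolding f's using l(1) s(1) by auto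
      moreover have "i ?z \<in> N'" using sZ V_V'(2) unfolding Z_def by blast
      ultimately have "\<not> multi (i ?z)" using q.multi_iff by auto
      moreover have "i ?z \<noteq> p" using Zf(3)[of ?z] sZ fp unfolding above_def by auto
      moreover have "i ?z \<in> nb" "i ?z \<in> i ` F" using Zf(3)[of ?z] sZ unfolding above_def by auto
      ultimately have "f (i ?z) $ 1 \<noteq> 0" using multi_iff by blast
      then show ?thesis using Zf(3)[of ?z] sZ by blast
    qed
  qed
qed

end


section \<open>The height near a branch value\<close>

context branch_chart
begin

text \<open>Off the axis the height will be a formula in the chart. Density is what transfers
  statements from there to the axis, where the chart does not tell the sheets apart.\<close>

lemma dense_off_axis:
  assumes z: "z \<in> F" "i z \<in> nb" and W: "openin (top_of_set F) W" "z \<in> W"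
  shows "\<exists>z'\<in>W. i z' \<in> nb \<and> f (i z') $ 1 \<noteq> 0"
proof -
  consider "f (i z) $ 1 \<noteq> 0" | "f (i z) $ 1 = 0" "i z \<noteq> p" | "i z = p" by blast
  then show ?thesis
  proof cases
    case 1 then show ?thesis using W(2) z(2) by blast
  next
    case 2
    have iz: "i z \<in> i ` F" using z(1) by blast
    obtain x y where xy: "{z' \<in> F. i z' = i z} = {x, y}"
      "\<And>W z. z \<in> {x, y} \<Longrightarrow> openin (top_of_set F) W \<Longrightarrow> z \<in> W \<Longrightarrow> \<exists>z'\<in>W. above z' \<and> f (i z') $ 1 \<noteq> 0"
      by (rule axis_local[OF z(2) iz 2]) (rule that; assumption)
    have "z \<in> {x, y}" using xy(1) z(1) by blast
    from xy(2)[OF this W] show ?thesis unfolding above_def by blast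
  next
    case 3
    have "z = b" by (rule single[OF z(1) 3])
    have "{x \<in> F. i x = p} \<subseteq> W"
    proof
      fix x assume "x \<in> {x \<in> F. i x = p}"
      then have "x = b" by (intro single) auto
      then show "x \<in> W" using \<open>z = b\<close> W(2) by blast
    qed
    moreover have "p \<in> M" using p_N N_M by blast
    ultimately obtain V where V: "openin (top_of_set M) V" "p \<in> V" "{x \<in> F. i x \<in> V} \<subseteq> W"
      using preimage_nbhd[OF W(1)] by blast
    \<comment> \<open>A ray of the cone where a diagonal plane meets a side, starting at
      \<open>p\<close> and otherwise off the axis. Since \<open>b\<close> is the only point over
      \<open>p\<close>, points over the ray end up in \<open>W\<close>.\<close>
    let ?\<gamma> = "\<lambda>s. g (vec3 s s (2 * s))"
    have c: "vec3 s s (2 * s) \<in> figure_eight_cone" if "s \<in> {0..1/2}" for s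
      using that by (auto simp: figure_eight_cone_iff)
    have "continuous_on {0..1/2} ?\<gamma>"
      by (rule continuous_on_compose2[OF fD(11)])
        (use c figure_eight_cone_ball in \<open>auto intro!: continuous_intros\<close>)
    moreover have "?\<gamma> ` {0..1/2} \<subseteq> M" using g_cone(3) c N_M by blast
    moreover have "openin (top_of_set M) (V \<inter> nb)" using V(1) nb_openin by (rule openin_Int)
    moreover have "?\<gamma> 0 \<in> V \<inter> nb"
    proof -
      have "vec3 0 0 (2 * 0) = 0" by (simp add: vec3_eq_iff)
      then have "?\<gamma> 0 = p" using fp fD(5)[OF p_N] by simp
      then show ?thesis using V(2) p_nb by simp
    qed
    ultimately obtain s where s: "0 < s" "s \<le> 1/2" "\<forall>t. 0 \<le> t \<longrightarrow> t \<le> s \<longrightarrow> ?\<gamma> t \<in> V \<inter> nb"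
      using path_enters[of "1/2" ?\<gamma> M "V \<inter> nb"] by auto
    have s': "s \<in> {0..1/2}" using s by auto
    have "?\<gamma> s \<in> V \<inter> nb" using s by auto
    moreover obtain z' where "z' \<in> F" "i z' = ?\<gamma> s" using g_cone(1)[OF c[OF s']] by auto
    moreover have "f (?\<gamma> s) $ 1 \<noteq> 0" using g_cone(2)[OF c[OF s']] s by simp
    ultimately show ?thesis using V(3) by (intro bexI[of _ z']) auto
  qed
qed

text \<open>The points on the sheet in the plane \<open>{v. v$1 = v$2}\<close>; over the axis the position in the chart
  does not determine the sheet.\<close>

definition on_diagonal :: "'f \<Rightarrow> bool" where
  "on_diagonal z \<longleftrightarrow> (\<exists>W. openin (top_of_set F) W \<and> z \<in> W \<and>
     (\<forall>z'\<in>W. above z' \<and> f (i z') $ 2 = f (i z') $ 1))"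

text \<open>The quotient equals \<open>v$3 / 2\<close> and \<open>- (v$3 / 2)\<close> on the two
  diagonal planes, \<open>v$2\<close> and \<open>- v$2\<close> over the two sides: a single formula
  that is linear on each sector. On the axis it is undefined, and the sheet decides between the two
  diagonal values, which separates the two points.\<close>

definition cone_height :: "'f \<Rightarrow> real" where
  "cone_height z = (if f (i z) $ 1 \<noteq> 0 then f (i z) $ 2 * f (i z) $ 3 / (2 * f (i z) $ 1)
     else if on_diagonal z then f (i z) $ 3 / 2 else - (f (i z) $ 3 / 2))"

text \<open>\<open>on_diagonal\<close> tells the two sheets apart: every neighbourhood of a point of
  \<open>Wy\<close> contains points off the axis, and there \<open>v$2 = v$1\<close> is incompatible
  with \<open>v$2 = - v$1\<close>.\<close>

lemma axis_sheets:
  assumes q: "q \<in> nb" "q \<in> i ` F" "f q $ 1 = 0" "q \<noteq> p"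
  obtains x y Wx Wy where "x \<in> Wx" "y \<in> Wy" "openin (top_of_set F) Wx" "openin (top_of_set F) Wy"
    "{z \<in> F. i z = q} = {x, y}" "x \<noteq> y"
    "\<And>z. z \<in> Wx \<Longrightarrow> above z \<and> on_diagonal z \<and> cone_height z = f (i z) $ 3 / 2"
    "\<And>z. z \<in> Wy \<Longrightarrow> above z \<and> \<not> on_diagonal z \<and> cone_height z = - (f (i z) $ 3 / 2)"
    "\<And>x' y'. x' \<in> Wx \<Longrightarrow> y' \<in> Wy \<Longrightarrow> i x' = i y' \<Longrightarrow> path_component (double_pairs F i) (x', y') (x, y)"
proof -
  obtain x y Wx Wy where A: "x \<in> Wx" "y \<in> Wy" "openin (top_of_set F) Wx" "openin (top_of_set F) Wy"
    "{z \<in> F. i z = q} = {x, y}" "x \<noteq> y"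
    "\<And>z. z \<in> Wx \<Longrightarrow> above z \<and> f (i z) $ 2 = f (i z) $ 1"
    "\<And>z. z \<in> Wy \<Longrightarrow> above z \<and> f (i z) $ 2 = - f (i z) $ 1"
    "\<And>x' y'. x' \<in> Wx \<Longrightarrow> y' \<in> Wy \<Longrightarrow> i x' = i y' \<Longrightarrow> path_component (double_pairs F i) (x', y') (x, y)"
    by (rule axis_local[OF q]) (rule that; assumption)
  have X: "on_diagonal z" if z: "z \<in> Wx" for z
    unfolding on_diagonal_def using A(3,7) z by blast
  have Y: "\<not> on_diagonal z" if z: "z \<in> Wy" for z
  proof
    assume "on_diagonal z"
    then obtain W where W: "openin (top_of_set F) W" "z \<in> W"
      "\<And>z'. z' \<in> W \<Longrightarrow> f (i z') $ 2 = f (i z') $ 1" unfolding on_diagonal_def by blast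
    have "z \<in> F" "i z \<in> nb" using A(8)[OF z] unfolding above_def by auto
    then obtain z' where z': "z' \<in> W \<inter> Wy" "f (i z') $ 1 \<noteq> 0"
      using dense_off_axis[OF _ _ openin_Int[OF W(1) A(4)]] W(2) z by blast
    then show False using W(3)[of z'] A(8)[of z'] by auto
  qed
  have cX: "cone_height z = f (i z) $ 3 / 2" if "z \<in> Wx" for z
    using A(7)[OF that] X[OF that] unfolding cone_height_def by auto
  have cY: "cone_height z = - (f (i z) $ 3 / 2)" if "z \<in> Wy" for z
    using A(8)[OF that] Y[OF that] unfolding cone_height_def by auto
  show thesis
    by (rule that[OF A(1-6) _ _ A(9)]) (use A(7,8) X Y cX cY in auto)
qed

lemma cone_height_cases:
  assumes z: "z \<in> F" "i z \<in> nb"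
  defines "v \<equiv> f (i z)"
  shows "v$2 = v$1 \<and> 2 * \<bar>v$1\<bar> \<le> v$3 \<and> cone_height z = v$3 / 2 \<or>
    v$2 = - v$1 \<and> 2 * \<bar>v$1\<bar> \<le> v$3 \<and> cone_height z = - (v$3 / 2) \<or>
    2 * v$1 = v$3 \<and> 2 * \<bar>v$2\<bar> \<le> v$3 \<and> cone_height z = v$2 \<or>
    2 * v$1 = - v$3 \<and> 2 * \<bar>v$2\<bar> \<le> v$3 \<and> cone_height z = - v$2"
proof -
  have c: "v \<in> figure_eight_cone" using surface_iff[OF nb_N[OF z(2)]] z(1) v_def by auto
  show ?thesis
  proof (cases "v$1 = 0")
    case True
    then have "v$2 = 0" "0 \<le> v$3" using figure_eight_cone_axis[OF c] by (metis vec3_nth(2), simp)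
    moreover have "cone_height z = v$3 / 2 \<or> cone_height z = - (v$3 / 2)"
      using True unfolding cone_height_def v_def by simp
    ultimately show ?thesis using True by auto
  next
    case False
    then have h: "cone_height z = v$2 * v$3 / (2 * v$1)" unfolding cone_height_def v_def by simp
    have "\<bar>v$1\<bar> = \<bar>v$2\<bar> \<and> 2 * \<bar>v$1\<bar> \<le> v$3 \<or> 2 * \<bar>v$1\<bar> = v$3 \<and> 2 * \<bar>v$2\<bar> \<le> v$3"
      using c figure_eight_cone_iff by blast
    then have "v$2 = v$1 \<and> 2 * \<bar>v$1\<bar> \<le> v$3 \<or> v$2 = - v$1 \<and> 2 * \<bar>v$1\<bar> \<le> v$3 \<or>
        v$3 = 2 * v$1 \<and> 2 * \<bar>v$2\<bar> \<le> v$3 \<or> v$3 = - 2 * v$1 \<and> 2 * \<bar>v$2\<bar> \<le> v$3" by (auto simp: abs_if split: if_splits)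
    then show ?thesis unfolding h using False by (elim disjE conjE) (simp_all add: field_simps)
  qed
qed

definition region :: "'f set" where "region = {z \<in> F. i z \<in> nb}"

lemma region_open: "openin (top_of_set F) region"
  unfolding region_def by (rule preimage_open[OF nb_openin])

lemma fi_pl: "pl_map_on region (\<lambda>z. f (i z))"
proof (rule pl_map_on_open_subset)
  show "pl_map_on {x \<in> F. i x \<in> N} (\<lambda>z. f (i z))" by (rule pl_map_on_compose[OF i_pl fD(1)])
  show "openin (top_of_set {x \<in> F. i x \<in> N}) region"
    by (rule openin_subset_trans[OF region_open]) (auto simp: region_def nb_def)
qed

lemmas fi_cont = pl_map_on_continuous[OF fi_pl]

lemma cone_height_b: "cone_height b = 0"
  unfolding cone_height_def using b(2) fp by simp

lemma continuous_within_local: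
  fixes h \<phi> :: "'f \<Rightarrow> real"
  assumes W: "openin (top_of_set F) W" "z \<in> W" "W \<subseteq> region" and \<phi>: "continuous_on W \<phi>"
    and eq: "\<And>w. w \<in> W \<Longrightarrow> h w = \<phi> w"
  shows "continuous (at z within region) h"
proof -
  obtain T where T: "open T" "W = F \<inter> T" using W(1) unfolding openin_open by blast
  have "at z within W = at z within region"
    by (rule at_within_nhd[of z T]) (use T W(2,3) region_def in auto)
  moreover have "continuous_on W h" using \<phi> eq continuous_on_cong by metis
  ultimately show ?thesis using W(2) unfolding continuous_on_eq_continuous_within by auto
qed

text \<open>On the axis each sheet has its own linear expression. At \<open>b\<close> no sheet is
  singled out, and the bound of the height by \<open>v$3 / 2\<close> takes over.\<close>

lemma cone_height_cont: "continuous_on region cone_height"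
  unfolding continuous_on_eq_continuous_within
proof
  fix z assume z: "z \<in> region"
  then have z': "z \<in> F" "i z \<in> nb" "i z \<in> i ` F" by (auto simp: region_def)
  consider "f (i z) $ 1 \<noteq> 0" | "f (i z) $ 1 = 0" "i z \<noteq> p" | "i z = p" by blast
  then show "continuous (at z within region) cone_height"
  proof cases
    case 1
    let ?W = "region \<inter> (\<lambda>z. f (i z) $ 1) -` (- {0})"
    have "openin (top_of_set region) ?W"
      by (rule continuous_openin_preimage_gen) (auto intro!: continuous_intros fi_cont)
    then have W: "openin (top_of_set F) ?W" using region_open openin_trans by blast
    show ?thesis
    proof (rule continuous_within_local[OF W])
      show "continuous_on ?W (\<lambda>z. f (i z) $ 2 * f (i z) $ 3 / (2 * f (i z) $ 1))"
        by (auto intro!: continuous_intros continuous_on_subset[OF fi_cont])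
      show "z \<in> ?W" using z 1 by simp
      show "?W \<subseteq> region" by blast
      show "cone_height w = f (i w) $ 2 * f (i w) $ 3 / (2 * f (i w) $ 1)" if "w \<in> ?W" for w
        using that unfolding cone_height_def by simp
    qed
  next
    case 2
    obtain x y Wx Wy where A: "x \<in> Wx" "y \<in> Wy" "openin (top_of_set F) Wx" "openin (top_of_set F) Wy"
      "{z' \<in> F. i z' = i z} = {x, y}"
      "\<And>z. z \<in> Wx \<Longrightarrow> above z \<and> on_diagonal z \<and> cone_height z = f (i z) $ 3 / 2"
      "\<And>z. z \<in> Wy \<Longrightarrow> above z \<and> \<not> on_diagonal z \<and> cone_height z = - (f (i z) $ 3 / 2)"
      by (rule axis_sheets[OF z'(2,3) 2]) (rule that; assumption)
    have sub: "Wx \<subseteq> region" "Wy \<subseteq> region" using A(6,7) unfolding above_def region_def by blast+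
    have "z = x \<or> z = y" using A(5) z'(1) by blast
    then show ?thesis
    proof
      assume "z = x"
      show ?thesis
        by (rule continuous_within_local[OF A(3) _ sub(1), of _ "\<lambda>z. f (i z) $ 3 / 2"])
          (use A(1,6) \<open>z = x\<close> in \<open>auto intro!: continuous_intros continuous_on_subset[OF fi_cont sub(1)]\<close>)
    next
      assume "z = y"
      show ?thesis
        by (rule continuous_within_local[OF A(4) _ sub(2), of _ "\<lambda>z. - (f (i z) $ 3 / 2)"])
          (use A(2,7) \<open>z = y\<close> in \<open>auto intro!: continuous_intros continuous_on_subset[OF fi_cont sub(2)]\<close>)
    qed
  next
    case 3
    then have zb: "z = b" by (rule single[OF z'(1)])
    have bound: "norm (cone_height w) \<le> f (i w) $ 3 / 2" if "w \<in> region" for w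
      using cone_height_cases[of w] that unfolding region_def by auto
    have "continuous_on region (\<lambda>w. f (i w) $ 3 / 2)" by (intro continuous_intros fi_cont) auto
    then have "((\<lambda>w. f (i w) $ 3 / 2) \<longlongrightarrow> f (i z) $ 3 / 2) (at z within region)"
      using z unfolding continuous_on_def by blast
    then have "((\<lambda>w. f (i w) $ 3 / 2) \<longlongrightarrow> 0) (at z within region)" using 3 fp by simp
    then have "(cone_height \<longlongrightarrow> 0) (at z within region)"
      by (rule Lim_null_comparison[rotated]) (use bound in \<open>auto simp: eventually_at_filter\<close>)
    then show ?thesis unfolding continuous_within zb cone_height_b .
  qed
qed

text \<open>The height is linear in the chart on each of the four sectors of the cone, but only up to the
  choice of the sheet on the axis; the pieces inside the axis are therefore discarded.\<close>

lemma cone_height_pl: "pl_map_on region cone_height"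
proof -
  \<comment> \<open>For each sector: a normal vector of its plane and the linear functional that
    gives the height on it.\<close>
  define Q :: "((real^3) \<times> (real^3)) set" where
    "Q = {(vec3 1 (-1) 0, vec3 0 0 (1/2)), (vec3 1 1 0, vec3 0 0 (-1/2)),
       (vec3 2 0 (-1), vec3 0 1 0), (vec3 2 0 1, vec3 0 (-1) 0)}"
  have inner3: "v \<bullet> w = v$1 * w$1 + v$2 * w$2 + v$3 * w$3" for v w :: "real^3"
    by (simp add: inner_vec_def sum_3)
  have Qval: "cone_height z = d \<bullet> f (i z)"
    if z: "z \<in> region" "f (i z) $ 1 \<noteq> 0" and nd: "(n, d) \<in> Q" "n \<bullet> f (i z) = 0" for z n d
  proof -
    have h: "cone_height z = f (i z) $ 2 * f (i z) $ 3 / (2 * f (i z) $ 1)" using z(2) unfolding cone_height_def by simp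
    consider "n = vec3 1 (-1) 0" "d = vec3 0 0 (1/2)" | "n = vec3 1 1 0" "d = vec3 0 0 (-1/2)" |
      "n = vec3 2 0 (-1)" "d = vec3 0 1 0" | "n = vec3 2 0 1" "d = vec3 0 (-1) 0"
      using nd(1) unfolding Q_def by auto
    then show ?thesis
    proof cases
      case 1
      then have "f (i z) $ 2 = f (i z) $ 1" using nd(2) by (simp add: inner3)
      then show ?thesis unfolding h 1 using z(2) by (simp add: inner3)
    next
      case 2
      then have "f (i z) $ 2 = - f (i z) $ 1" using nd(2) by (simp add: inner3)
      then show ?thesis unfolding h 2 using z(2) by (simp add: inner3)
    next
      case 3
      then have "f (i z) $ 3 = 2 * f (i z) $ 1" using nd(2) by (simp add: inner3)
      then show ?thesis unfolding h 3 using z(2) by (simp add: inner3)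
    next
      case 4
      then have "f (i z) $ 3 = - 2 * f (i z) $ 1" using nd(2) by (simp add: inner3)
      then show ?thesis unfolding h 4 using z(2) by (simp add: inner3)
    qed
  qed
  have Qex: "\<exists>(n, d)\<in>Q. n \<bullet> f (i z) = 0" if z: "z \<in> region" for z
    using cone_height_cases[of z] z unfolding region_def Q_def by (auto simp: inner3)
  have "pl_at region cone_height z" if z: "z \<in> region" for z
  proof -
    have "pl_at region (\<lambda>z. f (i z)) z" using fi_pl z unfolding pl_map_on_iff by blast
    then obtain \<C> where C: "finite \<C>" "nbhd_in region z (\<Union>\<C>)" "\<And>C. C \<in> \<C> \<Longrightarrow> polytope C"
      "\<And>C. C \<in> \<C> \<Longrightarrow> affine_map_on C (\<lambda>z. f (i z))" unfolding pl_at_def by auto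
    obtain W where W: "openin (top_of_set region) W" "z \<in> W" "W \<subseteq> \<Union>\<C>" and CR: "\<Union>\<C> \<subseteq> region"
      using C(2) unfolding nbhd_in_def by blast
    define P where "P = (\<lambda>(C, n, d :: real^3). C \<inter> (\<lambda>z. f (i z)) -` (pl_ball \<inter> {v. n \<bullet> v = (0::real)}))"
    define \<E> where "\<E> = {E \<in> P ` (\<C> \<times> Q). \<exists>w\<in>E. f (i w) $ 1 \<noteq> 0}"
    have "finite Q" by (simp add: Q_def)
    then have fin: "finite \<E>" using C(1) by (simp add: \<E>_def)
    have E: "polytope E \<and> affine_map_on E cone_height \<and> E \<subseteq> region" if EE: "E \<in> \<E>" for E
    proof -
      from EE obtain C' n d z0 where E: "C' \<in> \<C>" "(n, d) \<in> Q" "E = P (C', n, d)"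
        and z0: "z0 \<in> E" "f (i z0) $ 1 \<noteq> 0" unfolding \<E>_def by auto
      have E': "E = C' \<inter> (\<lambda>z. f (i z)) -` (pl_ball \<inter> {v. n \<bullet> v = 0})" using E(3) by (simp add: P_def)
      have "polytope (pl_ball \<inter> {v. n \<bullet> v = 0})"
        using polytope_pl_ball[where 'n=3] polyhedron_hyperplane[of n 0]
        by (auto simp: bounded_Int polytope_eq_bounded_polyhedron)
      then have pE: "polytope E" unfolding E' by (rule polytope_affine_preimage[OF C(3,4)[OF E(1)]])
      have ER: "E \<subseteq> region" using E' E(1) CR by blast
      have aff: "affine_map_on E (\<lambda>z. f (i z))" using affine_map_on_subset[OF C(4)[OF E(1)]] E' by blast
      have nE: "n \<bullet> f (i w) = 0" if "w \<in> E" for w using that E' by blast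
      obtain A a where A: "linear A" "\<And>w. w \<in> E \<Longrightarrow> f (i w) = A w + a"
        using aff unfolding affine_map_on_def by blast
      \<comment> \<open>At points of \<open>E\<close> off the axis this is \<open>Qval\<close>. A
        failure on the axis would persist for a while along the segment to \<open>z0\<close>, which
        leaves the axis at once because the chart is affine on \<open>E\<close>.\<close>
      have eq: "d \<bullet> f (i w) = cone_height w" if w: "w \<in> E" for w
      proof (rule ccontr)
        assume ne: "d \<bullet> f (i w) \<noteq> cone_height w"
        let ?D = "region \<inter> (\<lambda>w. d \<bullet> f (i w) - cone_height w) -` (- {0})"
        let ?\<gamma> = "\<lambda>t. (1 - t) *\<^sub>R w + t *\<^sub>R z0"
        have \<gamma>E: "?\<gamma> t \<in> E" if "t \<in> {0..1}" for t
          using convexD_alt[OF polytope_imp_convex[OF pE] w z0(1)] that by auto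
        have "openin (top_of_set region) ?D"
          by (rule continuous_openin_preimage_gen) (auto intro!: continuous_intros fi_cont cone_height_cont)
        moreover have "continuous_on {0..1} ?\<gamma>" by (intro continuous_intros)
        moreover have "?\<gamma> ` {0..1} \<subseteq> region" using \<gamma>E ER by blast
        moreover have "?\<gamma> 0 \<in> ?D" using ne w ER by auto
        ultimately obtain s where s: "0 < s" "s \<le> 1" "\<forall>t. 0 \<le> t \<longrightarrow> t \<le> s \<longrightarrow> ?\<gamma> t \<in> ?D"
          using path_enters[of 1 ?\<gamma> region ?D] by auto
        have s01: "s \<in> {0..1}" using s by auto
        have sD: "?\<gamma> s \<in> ?D" using s(1) s(3)[rule_format, of s] by simp
        have A': "A (?\<gamma> s) = (1 - s) *\<^sub>R A w + s *\<^sub>R A z0"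
          by (simp only: linear_add[OF A(1)] linear_scale[OF A(1)])
        have "f (i (?\<gamma> s)) = (1 - s) *\<^sub>R f (i w) + s *\<^sub>R f (i z0)"
          unfolding A(2)[OF \<gamma>E[OF s01]] A(2)[OF w] A(2)[OF z0(1)] A' by (simp add: algebra_simps)
        moreover have "f (i w) $ 1 = 0"
          using Qval[OF _ _ E(2) nE[OF w]] w ER ne by auto
        ultimately have "f (i (?\<gamma> s)) $ 1 \<noteq> 0" using z0(2) s(1) by simp
        then have "cone_height (?\<gamma> s) = d \<bullet> f (i (?\<gamma> s))"
          using Qval[OF _ _ E(2) nE[OF \<gamma>E[OF s01]]] \<gamma>E[OF s01] ER by blast
        then show False using sD by simp
      qed
      have "affine_map_on UNIV (\<lambda>v. d \<bullet> v)"
        using affine_map_on_affine[OF bounded_linear.linear[OF bounded_linear_inner_right[of d]], of UNIV 0] by simp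
      then have "affine_map_on E (\<lambda>w. d \<bullet> f (i w))"
        using affine_map_on_compose[OF aff, of UNIV] by blast
      then have "affine_map_on E cone_height" by (rule affine_map_on_cong) (rule eq)
      then show ?thesis using pE ER by blast
    qed
    \<comment> \<open>The retained pieces suffice: their union is closed and contains every off-axis
      point of \<open>W\<close>, and these are dense.\<close>
    have WE: "W \<subseteq> \<Union>\<E>"
    proof (rule ccontr)
      assume "\<not> W \<subseteq> \<Union>\<E>"
      then obtain w where w: "w \<in> W" "w \<notin> \<Union>\<E>" by blast
      have "closed (\<Union>\<E>)" using fin E polytope_imp_closed by blast
      then have "openin (top_of_set region) (W - \<Union>\<E>)"
        using W(1) by (metis Diff_eq closed_def openin_Int_open)
      then have "openin (top_of_set F) (W - \<Union>\<E>)" using region_open openin_trans by blast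
      moreover have "w \<in> F" "i w \<in> nb" using w(1) W(3) CR unfolding region_def by auto
      ultimately obtain w' where w': "w' \<in> W - \<Union>\<E>" "f (i w') $ 1 \<noteq> 0"
        using dense_off_axis[of w "W - \<Union>\<E>"] w by blast
      obtain C' where C': "C' \<in> \<C>" "w' \<in> C'" using w'(1) W(3) by blast
      have w'R: "w' \<in> region" using C' CR by blast
      then obtain n d where nd: "(n, d) \<in> Q" "n \<bullet> f (i w') = 0" using Qex by blast
      have "f (i w') \<in> pl_ball" using w'R fD(3) nb_N unfolding region_def by blast
      then have "w' \<in> P (C', n, d)" using C'(2) nd(2) by (simp add: P_def)
      moreover have "P (C', n, d) \<in> P ` (\<C> \<times> Q)" using C'(1) nd(1) by blast
      ultimately have "P (C', n, d) \<in> \<E>" using w'(2) unfolding \<E>_def by blast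
      then show False using w'(1) \<open>w' \<in> P (C', n, d)\<close> by blast
    qed
    have "nbhd_in region z (\<Union>\<E>)" unfolding nbhd_in_def using W(1,2) WE E by blast
    then show ?thesis unfolding pl_at_def using fin E by blast
  qed
  then show ?thesis using cone_height_cont by (simp add: pl_map_on_iff)
qed

text \<open>The right-hand side is the surface flattened in \<open>locally_flat_cone\<close>: first
  coordinate and height determine the point. Over the axis both heights \<open>v$3 / 2\<close> and
  \<open>- (v$3 / 2)\<close> have to occur, which is where the two sheets enter.\<close>

lemma cone_height_graph:
  assumes m: "m \<in> nb"
  defines "v \<equiv> f m"
  shows "(\<exists>x\<in>F. i x = m \<and> cone_height x = s) \<longleftrightarrow>
    v$2 = (\<bar>v$1 + s\<bar> - \<bar>v$1 - s\<bar>) / 2 \<and> v$3 = \<bar>v$1 + s\<bar> + \<bar>v$1 - s\<bar>" (is "?L \<longleftrightarrow> ?R")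
proof
  assume ?L
  then obtain x where x: "x \<in> F" "i x = m" "cone_height x = s" by blast
  have "v$2 = v$1 \<and> 2 * \<bar>v$1\<bar> \<le> v$3 \<and> s = v$3 / 2 \<or>
    v$2 = - v$1 \<and> 2 * \<bar>v$1\<bar> \<le> v$3 \<and> s = - (v$3 / 2) \<or>
    2 * v$1 = v$3 \<and> 2 * \<bar>v$2\<bar> \<le> v$3 \<and> s = v$2 \<or>
    2 * v$1 = - v$3 \<and> 2 * \<bar>v$2\<bar> \<le> v$3 \<and> s = - v$2"
    using cone_height_cases[of x] x m unfolding v_def by simp
  then show ?R by (elim disjE conjE) (auto simp: abs_if field_simps split: if_splits)
next
  assume R: ?R
  have cases: "\<bar>v$1\<bar> \<le> s \<and> v$2 = v$1 \<and> v$3 = 2 * s \<or> \<bar>v$1\<bar> \<le> - s \<and> v$2 = - v$1 \<and> v$3 = - 2 * s \<or>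
      \<bar>s\<bar> \<le> v$1 \<and> v$2 = s \<and> v$3 = 2 * v$1 \<or> \<bar>s\<bar> \<le> - v$1 \<and> v$2 = - s \<and> v$3 = - 2 * v$1"
    using R by (auto simp: abs_if field_simps split: if_splits)
  have "v$3 < 1" using nb_less[OF m, of 3] \<rho> unfolding v_def by auto
  then have "v \<in> figure_eight_cone" unfolding figure_eight_cone_iff using cases by (elim disjE conjE) auto
  then have mS: "m \<in> i ` F" using surface_iff[OF nb_N[OF m]] v_def by simp
  show ?L
  proof (cases "v$1 = 0")
    case False
    obtain x where x: "x \<in> F" "i x = m" using mS by blast
    have "cone_height x = v$2 * v$3 / (2 * v$1)" using x False unfolding cone_height_def v_def by simp
    also have "\<dots> = s" using cases False by (elim disjE conjE) (simp_all add: field_simps)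
    finally show ?thesis using x by blast
  next
    case True
    then have v: "v$2 = 0" "v$3 = 2 * \<bar>s\<bar>" using R by auto
    show ?thesis
    proof (cases "s = 0")
      case s0: True
      then have "f m = 0" using True v unfolding v_def by (simp add: vec3_eq_iff)
      then have "m = p" using fp fD(5) p_N nb_N[OF m] by metis
      then show ?thesis using b cone_height_b s0 by blast
    next
      case False
      then have mp: "m \<noteq> p" using v(2) fp unfolding v_def by auto
      have m1: "f m $ 1 = 0" using True v_def by simp
      obtain x y Wx Wy where A: "x \<in> Wx" "y \<in> Wy" "{z' \<in> F. i z' = m} = {x, y}"
        "\<And>z. z \<in> Wx \<Longrightarrow> above z \<and> on_diagonal z \<and> cone_height z = f (i z) $ 3 / 2"
        "\<And>z. z \<in> Wy \<Longrightarrow> above z \<and> \<not> on_diagonal z \<and> cone_height z = - (f (i z) $ 3 / 2)"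
        by (rule axis_sheets[OF m mS m1 mp]) (rule that; assumption)
      have xy: "x \<in> F" "i x = m" "y \<in> F" "i y = m" using A(3) by blast+
      have "cone_height x = \<bar>s\<bar>" "cone_height y = - \<bar>s\<bar>"
        using A(4)[OF A(1)] A(5)[OF A(2)] xy v(2) unfolding v_def by auto
      then show ?thesis using xy by (cases "0 \<le> s") (auto intro: bexI[of _ x] bexI[of _ y])
    qed
  qed
qed

end


section \<open>Existence of liftings\<close>

context height_order
begin

text \<open>Local flatness at the points over \<open>p\<close> depends on the heights near these points only.\<close>

definition flat_over :: "'m \<Rightarrow> ('f \<Rightarrow> real) \<Rightarrow> bool" where
  "flat_over p g \<longleftrightarrow> (\<forall>h Z. openin (top_of_set M) Z \<longrightarrow> p \<in> Z \<longrightarrow> (\<forall>x\<in>F. i x \<in> Z \<longrightarrow> h x = g x) \<longrightarrow>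
        (\<forall>x\<in>F. i x = p \<longrightarrow> locally_flat_at (M \<times> UNIV) ((\<lambda>x. (i x, h x)) ` F) (i x, h x)))"

end

locale branch_order = branch_chart M F i p N f g b \<rho> + height_order M F i Hi
  for M :: "'m::euclidean_space set" and F :: "'f::euclidean_space set" and i :: "'f \<Rightarrow> 'm"
    and p N f g b \<rho> Hi
begin

text \<open>Over neighbouring points of the axis the pairs formed by the two sheets are joined by
  paths of double pairs, so whether the diagonal sheet is the higher one is locally constant. The
  axis without \<open>p\<close> is an interval, hence one sign \<open>e\<close> serves for all of
  it.\<close>

lemma order_on_axis:
  "\<exists>e. (e = 1 \<or> e = -1) \<and> (\<forall>(x, y)\<in>Hi. i x \<in> nb \<longrightarrow> e * cone_height y < e * cone_height x)"
proof -
  let ?\<gamma> = "\<lambda>t. g (vec3 0 0 t)"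
  define \<phi> where "\<phi> t \<longleftrightarrow> (\<exists>x y. (x, y) \<in> Hi \<and> i x = ?\<gamma> t \<and> on_diagonal x \<and> \<not> on_diagonal y)" for t
  have \<gamma>: "?\<gamma> t \<in> nb" "?\<gamma> t \<in> i ` F" "f (?\<gamma> t) $ 1 = 0" "?\<gamma> t \<noteq> p" if t: "t \<in> {0<..<\<rho>}" for t
  proof -
    have 0: "0 \<le> t" "t < \<rho>" using t by auto
    note ga = g_axis[OF 0]
    show "?\<gamma> t \<in> nb" "?\<gamma> t \<in> i ` F" by (rule ga)+
    show "f (?\<gamma> t) $ 1 = 0" using ga(3) by simp
    show "?\<gamma> t \<noteq> p"
    proof
      assume "?\<gamma> t = p"
      then have "vec3 0 0 t = 0" using ga(3) fp by simp
      then show False using t by (simp add: vec3_eq_iff)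
    qed
  qed
  have \<phi>_iff: "\<phi> t \<longleftrightarrow> (x, y) \<in> Hi"
    if xy: "{z \<in> F. i z = ?\<gamma> t} = {x, y}" "on_diagonal x" "\<not> on_diagonal y" for t x y
  proof
    assume "\<phi> t"
    then obtain x' y' where H: "(x', y') \<in> Hi" "i x' = ?\<gamma> t" "on_diagonal x'" "\<not> on_diagonal y'"
      unfolding \<phi>_def by blast
    have "x' \<in> {z \<in> F. i z = ?\<gamma> t}" "y' \<in> {z \<in> F. i z = ?\<gamma> t}" using Hi_D[OF H(1)] H(2) by auto
    then have "x' \<in> {x, y}" "y' \<in> {x, y}" unfolding xy(1) .
    then show "(x, y) \<in> Hi" using H xy by blast
  next
    assume "(x, y) \<in> Hi"
    moreover have "i x = ?\<gamma> t" using xy(1) by blast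
    ultimately show "\<phi> t" unfolding \<phi>_def using xy(2,3) by blast
  qed
  have cont: "continuous_on {0<..<\<rho>} ?\<gamma>"
    by (rule continuous_on_compose2[OF fD(11)])
      (use \<rho> in \<open>auto intro!: continuous_intros simp: mem_pl_ball forall_3\<close>)
  have loc: "eventually (\<lambda>t'. \<phi> t = \<phi> t') (at t within {0<..<\<rho>})" if t: "t \<in> {0<..<\<rho>}" for t
  proof -
    obtain x y Wx Wy where A: "x \<in> Wx" "y \<in> Wy" "openin (top_of_set F) Wx" "openin (top_of_set F) Wy"
      "{z \<in> F. i z = ?\<gamma> t} = {x, y}" "x \<noteq> y"
      "\<And>z. z \<in> Wx \<Longrightarrow> above z \<and> on_diagonal z \<and> cone_height z = f (i z) $ 3 / 2"
      "\<And>z. z \<in> Wy \<Longrightarrow> above z \<and> \<not> on_diagonal z \<and> cone_height z = - (f (i z) $ 3 / 2)"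
      "\<And>x' y'. x' \<in> Wx \<Longrightarrow> y' \<in> Wy \<Longrightarrow> i x' = i y' \<Longrightarrow> path_component (double_pairs F i) (x', y') (x, y)"
      by (rule axis_sheets[OF \<gamma>[OF t]]) (rule that; assumption)
    have "{z \<in> F. i z = ?\<gamma> t} \<subseteq> Wx \<union> Wy" unfolding A(5) using A(1,2) by blast
    moreover have "?\<gamma> t \<in> M" using \<gamma>(1)[OF t] nb_N N_M by blast
    ultimately obtain V where V: "openin (top_of_set M) V" "?\<gamma> t \<in> V" "{z \<in> F. i z \<in> V} \<subseteq> Wx \<union> Wy"
      using preimage_nbhd[OF openin_Un[OF A(3,4)]] by blast
    have "openin (top_of_set {0<..<\<rho>}) ({0<..<\<rho>} \<inter> ?\<gamma> -` V)"
      by (rule continuous_openin_preimage[OF cont _ V(1)]) (use \<gamma>(1) nb_N N_M in blast)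
    then have oJ: "open ({0<..<\<rho>} \<inter> ?\<gamma> -` V)" by (rule openin_open_trans) simp
    have "\<phi> t = \<phi> t'" if t': "t' \<in> {0<..<\<rho>} \<inter> ?\<gamma> -` V" for t'
    proof -
      have t'I: "t' \<in> {0<..<\<rho>}" using t' by blast
      obtain x' y' Wx' Wy' where A': "x' \<in> Wx'" "y' \<in> Wy'" "{z \<in> F. i z = ?\<gamma> t'} = {x', y'}"
        "\<And>z. z \<in> Wx' \<Longrightarrow> above z \<and> on_diagonal z \<and> cone_height z = f (i z) $ 3 / 2"
        "\<And>z. z \<in> Wy' \<Longrightarrow> above z \<and> \<not> on_diagonal z \<and> cone_height z = - (f (i z) $ 3 / 2)"
        by (rule axis_sheets[OF \<gamma>[OF t'I]]) (rule that; assumption)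
      have xy': "x' \<in> F" "y' \<in> F" "i x' = ?\<gamma> t'" "i y' = ?\<gamma> t'" using A'(3) by blast+
      have "x' \<in> Wx \<union> Wy" "y' \<in> Wx \<union> Wy" using V(3) xy' t' by auto
      then have W: "x' \<in> Wx" "y' \<in> Wy" using A(7,8) A'(1,2,4,5) by blast+
      have "path_component (double_pairs F i) (x', y') (x, y)" using A(9)[OF W] xy' by simp
      then have "(x', y') \<in> Hi \<longleftrightarrow> (x, y) \<in> Hi" using Hi_path path_component_sym by blast
      then show ?thesis
        using \<phi>_iff[OF A(5)] \<phi>_iff[OF A'(3)] A(7)[OF A(1)] A(8)[OF A(2)] A'(4)[OF A'(1)] A'(5)[OF A'(2)] by blast
    qed
    then show ?thesis
      unfolding eventually_at_topological using oJ t V(2)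
      by (intro exI[of _ "{0<..<\<rho>} \<inter> ?\<gamma> -` V"]) auto
  qed
  have const: "\<phi> t = \<phi> t'" if "t \<in> {0<..<\<rho>}" "t' \<in> {0<..<\<rho>}" for t t'
    by (rule connected_local_const[of "{0<..<\<rho>}"]) (use that loc in auto)
  \<comment> \<open>The midpoint is only a sample; by \<open>const\<close> every point of the
    interval gives the same sign.\<close>
  define e :: real where "e = (if \<phi> (\<rho>/2) then 1 else -1)"
  have "e * cone_height y < e * cone_height x" if H: "(x, y) \<in> Hi" and nb: "i x \<in> nb" for x y
  proof -
    note D = Hi_D[OF H]
    have m: "multi (i x)" using D unfolding multi_def double_pairs_def by blast
    have S: "i x \<in> i ` F" using D by blast
    have ax: "f (i x) $ 1 = 0" "i x \<noteq> p" using multi_iff[OF nb S] m by auto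
    define t where "t = f (i x) $ 3"
    have t: "t \<in> {0<..<\<rho>}" using axis_pos[OF nb S ax] nb_less[OF nb, of 3] by (auto simp: t_def)
    have ix: "i x = ?\<gamma> t" using axis_eq(3)[OF nb S ax(1)] by (simp add: t_def)
    obtain x0 y0 Wx Wy where A: "x0 \<in> Wx" "y0 \<in> Wy" "{z \<in> F. i z = i x} = {x0, y0}"
      "\<And>z. z \<in> Wx \<Longrightarrow> above z \<and> on_diagonal z \<and> cone_height z = f (i z) $ 3 / 2"
      "\<And>z. z \<in> Wy \<Longrightarrow> above z \<and> \<not> on_diagonal z \<and> cone_height z = - (f (i z) $ 3 / 2)"
      by (rule axis_sheets[OF nb S ax]) (rule that; assumption)
    have "i x0 = i x" "i y0 = i x" using A(3) by blast+
    then have h: "cone_height x0 = t / 2" "cone_height y0 = - (t / 2)"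
      using A(4)[OF A(1)] A(5)[OF A(2)] by (simp_all add: t_def)
    have xy: "x \<in> {x0, y0}" "y \<in> {x0, y0}" using D A(3) by auto
    have iff: "\<phi> t \<longleftrightarrow> (x0, y0) \<in> Hi"
      using \<phi>_iff[of t x0 y0] A(3) ix A(4)[OF A(1)] A(5)[OF A(2)] by simp
    have "\<phi> t = \<phi> (\<rho>/2)" using const[OF t, of "\<rho>/2"] \<rho> by simp
    show ?thesis
    proof (cases "\<phi> t")
      case True
      then have "(y0, x0) \<notin> Hi" using iff Hi_total Hi_sub by blast
      then have "x = x0" "y = y0" using xy H D True iff by blast+
      then show ?thesis using h t True \<open>\<phi> t = \<phi> (\<rho>/2)\<close> by (simp add: e_def)
    next
      case False
      then have "x = y0" "y = x0" using xy H D iff by blast+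
      then show ?thesis using h t False \<open>\<phi> t = \<phi> (\<rho>/2)\<close> by (simp add: e_def)
    qed
  qed
  then show ?thesis by (intro exI[of _ e]) (auto simp: e_def)
qed

text \<open>Near \<open>p\<close> the function from \<open>bump\<close> is
  \<open>e * cone_height\<close> plus a constant, so the shape required by
  \<open>locally_flat_cone\<close> survives. The argument looks at heights near \<open>p\<close>
  only and thus applies to any \<open>h\<close> agreeing there, in particular to a later
  sum.\<close>

lemma branch_chart_height:
  assumes W: "openin (top_of_set M) W" "p \<in> W"
  shows "\<exists>g V. local_height p W g V \<and> flat_over p g"
proof -
  obtain e :: real where e: "e = 1 \<or> e = -1"
    "\<forall>(x, y)\<in>Hi. i x \<in> nb \<longrightarrow> e * cone_height y < e * cone_height x"
    using order_on_axis by blast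
  define \<delta> where "\<delta> = \<rho> / 2"
  have \<delta>: "0 < \<delta>" "\<delta> < \<rho>" using \<rho> by (auto simp: \<delta>_def)
  define X where "X = {x \<in> F. i x \<in> N \<and> maxnorm (f (i x)) \<le> \<delta>}"
  have XR: "X \<subseteq> region" using \<delta> unfolding X_def region_def nb_def by auto
  have "pl_map_on {z \<in> {x \<in> F. i x \<in> N}. f (i z) \<in> cbox (vec3 (-\<delta>) (-\<delta>) (-\<delta>)) (vec3 \<delta> \<delta> \<delta>)} (\<lambda>z. f (i z))"
    by (rule pl_map_on_preimage[OF pl_map_on_compose[OF i_pl fD(1)] pl_map_on_polytope[OF polytope_interval]])
  moreover have "{z \<in> {x \<in> F. i x \<in> N}. f (i z) \<in> cbox (vec3 (-\<delta>) (-\<delta>) (-\<delta>)) (vec3 \<delta> \<delta> \<delta>)} = X"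
    unfolding X_def maxnorm_le_iff by (auto simp: mem_box_cart forall_3 abs_le_iff)
  ultimately have "pl_map_on X (\<lambda>z. f (i z))" by simp
  then have "pl_map_on X cone_height"
    by (intro pl_map_on_restrict[OF cone_height_pl pl_map_on_id XR])
  then have pl: "pl_map_on {x \<in> F. i x \<in> N \<and> maxnorm (f (i x)) \<le> \<delta>} (\<lambda>x. e * cone_height x)"
    unfolding X_def by (rule pl_map_on_cmult)
  have 1: "\<forall>(x, y)\<in>Hi. x \<in> F \<and> y \<in> F \<and> i x = i y" using Hi_D by blast
  have 2: "\<forall>(x, y)\<in>Hi. i x \<in> N \<longrightarrow> maxnorm (f (i x)) \<le> \<delta> \<longrightarrow> e * cone_height y < e * cone_height x"
    using e(2) \<delta> unfolding nb_def by auto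
  have comp: "compact (pl_ball :: (real^3) set)" by (simp add: polytope_pl_ball polytope_imp_compact)
  from bump[OF N f fp comp \<delta>(1) pl 1 2 W]
  obtain g' r \<kappa> where g': "pl_map_on F g'" "\<forall>x\<in>F. (0::real) \<le> g' x"
     "\<forall>x y. (x, y) \<in> Hi \<longrightarrow> g' y < g' x \<or> g' x = 0 \<and> g' y = 0" "(0::real) < r"
     "openin (top_of_set M) {m \<in> N. maxnorm (f m) < r}"
     "\<forall>x\<in>F. i x \<in> N \<longrightarrow> maxnorm (f (i x)) \<le> r \<longrightarrow> g' x = e * cone_height x + \<kappa> \<and> 0 < g' x"
     "\<forall>x\<in>F. g' x \<noteq> 0 \<longrightarrow> i x \<in> W"
    by (elim exE conjE) (rule that; assumption)
  let ?V = "{m \<in> N. maxnorm (f m) < r}"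
  have flat: "locally_flat_at (M \<times> UNIV) ((\<lambda>x. (i x, h x)) ` F) (i x, h x)"
    if Z: "openin (top_of_set M) Z" "p \<in> Z" "\<forall>x\<in>F. i x \<in> Z \<longrightarrow> h x = g' x" and x: "x \<in> F" "i x = p" for h Z x
  proof -
    obtain r' where r': "0 < r'" "{m \<in> N. maxnorm (f m) < r'} \<subseteq> Z"
      using chart_small[OF N fD(9) fp Z(1,2)] by blast
    define d where "d = min (min r r') \<rho> / 2"
    have d: "0 < d" "d < r" "d < r'" "d < \<rho>" using r'(1) g'(4) \<rho> unfolding d_def by auto
    have xb: "x = b" by (rule single[OF x])
    have hk: "h y = e * cone_height y + \<kappa>" if y: "y \<in> F" "i y \<in> N" "maxnorm (f (i y)) \<le> d" for y
    proof -
      have "i y \<in> Z" using r'(2) y d by auto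
      moreover have "maxnorm (f (i y)) \<le> r" using y d by auto
      ultimately show ?thesis using Z(3) g'(6) y by auto
    qed
    have "h b = \<kappa>"
      using hk[of b] b p_N fp d cone_height_b by simp
    moreover have "locally_flat_at (M \<times> UNIV) ((\<lambda>x. (i x, h x)) ` F) (p, \<kappa>)"
    proof (rule locally_flat_cone[OF N f fp e(1) d(1)])
      fix m s assume m: "m \<in> N" and le: "\<forall>j. \<bar>f m $ j\<bar> \<le> d"
      have mle: "maxnorm (f m) \<le> d" using le maxnorm_le_iff by blast
      have mnb: "m \<in> nb" using m mle d unfolding nb_def by auto
      have ee: "e * cone_height y + \<kappa> = s \<longleftrightarrow> cone_height y = e * (s - \<kappa>)" for y
        using e(1) by auto
      have "(m, s) \<in> (\<lambda>x. (i x, h x)) ` F \<longleftrightarrow> (\<exists>y\<in>F. i y = m \<and> h y = s)" by auto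
      also have "\<dots> \<longleftrightarrow> (\<exists>y\<in>F. i y = m \<and> cone_height y = e * (s - \<kappa>))"
        using hk m mle ee by metis
      also have "\<dots> \<longleftrightarrow> f m $ 2 = (\<bar>f m $ 1 + e * (s - \<kappa>)\<bar> - \<bar>f m $ 1 - e * (s - \<kappa>)\<bar>) / 2 \<and>
          f m $ 3 = \<bar>f m $ 1 + e * (s - \<kappa>)\<bar> + \<bar>f m $ 1 - e * (s - \<kappa>)\<bar>"
        by (rule cone_height_graph[OF mnb])
      finally show "(m, s) \<in> (\<lambda>x. (i x, h x)) ` F \<longleftrightarrow>
          f m $ 2 = (\<bar>f m $ 1 + e * (s - \<kappa>)\<bar> - \<bar>f m $ 1 - e * (s - \<kappa>)\<bar>) / 2 \<and>
          f m $ 3 = \<bar>f m $ 1 + e * (s - \<kappa>)\<bar> + \<bar>f m $ 1 - e * (s - \<kappa>)\<bar>" .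
    qed
    ultimately show ?thesis using x(2) xb by simp
  qed
  have "p \<in> ?V" using p_N fp g'(4) by simp
  moreover have "\<forall>x\<in>F. i x \<in> ?V \<longrightarrow> 0 < g' x" using g'(6) by auto
  ultimately show ?thesis using g'(1,2,3,5,7) flat unfolding local_height_def flat_over_def
    by (rule_tac exI[of _ g'], rule_tac exI[of _ ?V], intro conjI) (assumption | simp)+
qed

end

section \<open>Isolation of branch values\<close>

context generic_surface_map
begin

text \<open>Around a branch value this is \<open>isolated_branch\<close>. In a chart with plane
  sheets there is none at all: a branch value is not multiple but is a limit of multiple values,
  whereas in such a chart the points close to a value that is not multiple are not multiple
  either.\<close>

lemma branch_values_isolated:
  assumes q: "q \<in> i ` F"
  shows "\<exists>\<epsilon>>0. \<forall>p. branch_value M F i p \<longrightarrow> p \<noteq> q \<longrightarrow> \<epsilon> \<le> dist p q"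
proof -
  have "\<exists>V. openin (top_of_set M) V \<and> q \<in> V \<and> (\<forall>p\<in>V. branch_value M F i p \<longrightarrow> p = q)"
    using q
  proof (cases rule: value_cases)
    case branch
    then obtain N f g b \<rho> where "branch_chart M F i q N f g b \<rho>" using branch_value_chart by blast
    then interpret branch_chart M F i q N f g b \<rho> .
    have "p = q" if "p \<in> nb" "branch_value M F i p" for p
    proof -
      have "p \<in> i ` F" using that(2) unfolding branch_value_def by blast
      then show ?thesis using isolated_branch that by blast
    qed
    then show ?thesis using nb_openin p_nb by blast
  next
    case (planes B L N f g U u)
    then interpret plane_chart M F i q B L N f g U u by simp
    obtain V where V: "openin (top_of_set M) V" "q \<in> V" "V \<subseteq> N"
      using N unfolding nbhd_in_def by blast
    have "\<not> branch_value M F i p" if pV: "p \<in> V" for p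
    proof
      assume br: "branch_value M F i p"
      then obtain N' f' g' b' \<rho>' where "branch_chart M F i p N' f' g' b' \<rho>'" using branch_value_chart by blast
      then interpret p: branch_chart M F i p N' f' g' b' \<rho>' .
      have pN: "p \<in> N" using pV V(3) by blast
      have "p \<in> i ` F" using p.b by blast
      then obtain l where l: "l \<in> L" "f p $ l = 0" using surface_iff[OF pN] by blast
      have "\<not> multi p" using p.single unfolding multi_def double_pairs_def by auto
      then have nz: "f p $ l' \<noteq> 0" if "l' \<in> L - {l}" for l' using multi_iff[OF pN] l that by blast
      \<comment> \<open>Inside \<open>Y\<close> no plane other than the \<open>l\<close>-th passes,
        so no value is multiple.\<close>
      define Y where "Y = V \<inter> f -` {v. \<forall>l'\<in>L - {l}. v $ l' \<noteq> 0}"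
      have "{v :: real^3. \<forall>l'\<in>L - {l}. v $ l' \<noteq> 0} = (\<Inter>l'\<in>L - {l}. {v. v $ l' \<noteq> 0})" by blast
      then have "open {v :: real^3. \<forall>l'\<in>L - {l}. v $ l' \<noteq> 0}"
        by (simp only:) (intro open_INT ballI open_Collect_neq continuous_intros finite)
      then have "openin (top_of_set V) Y"
        unfolding Y_def using continuous_on_subset[OF fD(10) V(3)] by (intro continuous_openin_preimage_gen)
      then have Y: "openin (top_of_set M) Y" using V(1) openin_trans by blast
      have notmulti: "\<not> multi m" if "m \<in> Y" for m
        using that multi_iff[of m] V(3) unfolding Y_def by blast
      let ?\<gamma> = "\<lambda>t. g' (vec3 0 0 t)"
      have "continuous_on {0..\<rho>'/2} ?\<gamma>"
        by (rule continuous_on_compose2[OF p.fD(11)])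
          (use p.\<rho> in \<open>auto intro!: continuous_intros simp: mem_pl_ball forall_3\<close>)
      moreover have "?\<gamma> ` {0..\<rho>'/2} \<subseteq> M" using p.g_axis(1) p.\<rho> p.nb_N p.N_M by fastforce
      moreover have "?\<gamma> 0 \<in> Y"
      proof -
        have "vec3 0 0 0 = 0" by (simp add: vec3_eq_iff)
        then have "?\<gamma> 0 = p" using p.fp p.fD(5)[OF p.p_N] by simp
        then show ?thesis using pV nz unfolding Y_def by simp
      qed
      ultimately obtain s where s: "0 < s" "s \<le> \<rho>'/2" "\<forall>t. 0 \<le> t \<longrightarrow> t \<le> s \<longrightarrow> ?\<gamma> t \<in> Y"
        using path_enters[of "\<rho>'/2" ?\<gamma> M Y] Y p.\<rho> by auto
      have s0: "0 \<le> s" "s < \<rho>'" using s p.\<rho> by auto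
      note ga = p.g_axis[OF s0]
      have "?\<gamma> s \<noteq> p"
      proof
        assume "?\<gamma> s = p"
        then have "vec3 0 0 s = 0" using ga(3) p.fp by simp
        then show False using s(1) by (simp add: vec3_eq_iff)
      qed
      then have "multi (?\<gamma> s)" using p.multi_iff[OF ga(1,2)] ga(3) by simp
      moreover have "?\<gamma> s \<in> Y" using s by auto
      ultimately show False using notmulti by blast
    qed
    then show ?thesis using V by blast
  qed
  then obtain V where V: "openin (top_of_set M) V" "q \<in> V" "\<And>p. p \<in> V \<Longrightarrow> branch_value M F i p \<Longrightarrow> p = q" by blast
  obtain e where e: "0 < e" "ball q e \<inter> M \<subseteq> V" using V(1,2) unfolding openin_contains_ball by blast
  have "e \<le> dist p q" if "branch_value M F i p" "p \<noteq> q" for p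
  proof (rule ccontr)
    assume "\<not> e \<le> dist p q"
    moreover have "p \<in> M" using that(1) unfolding branch_value_def nbhd_in_def by blast
    ultimately have "p \<in> V" using e(2) by (auto simp: dist_commute)
    then show False using V(3) that by blast
  qed
  then show ?thesis using e(1) by blast
qed

end

section \<open>Gluing of local heights\<close>

context height_order
begin

lemma local_height_exists:
  assumes q: "q \<in> i ` F" and W: "openin (top_of_set M) W" "q \<in> W"
  shows "\<exists>g V. local_height q W g V \<and> (branch_value M F i q \<longrightarrow> flat_over q g)"
proof (cases "branch_value M F i q")
  case True
  then obtain N f g b \<rho> where "branch_chart M F i q N f g b \<rho>" using branch_value_chart by blast
  then interpret branch_order M F i q N f g b \<rho> Hi
    by (intro branch_order.intro height_order_axioms)
  from branch_chart_height[OF W] show ?thesis by blast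
next
  case False
  from q show ?thesis
  proof (cases rule: value_cases)
    case (planes B L N f g U u)
    from plane_height[OF planes(1) W] show ?thesis using False by blast
  qed (use False in blast)
qed

text \<open>By compactness finitely many local heights cover the surface. Their sum is strict on
  every pair in \<open>Hi\<close>, and this also gives injectivity of the lift, since any two points
  over one value form a pair that \<open>Hi\<close> orders.\<close>

theorem lifting_exists:
  assumes M: "pl_manifold TYPE(3) M"
  shows "\<exists>h. lifting M F i h \<and> (\<forall>(x, y)\<in>Hi. h y < h x)"
proof -
  have "\<forall>q\<in>i ` F. \<exists>\<epsilon>. 0 < \<epsilon> \<and> (\<forall>p. branch_value M F i p \<longrightarrow> p \<noteq> q \<longrightarrow> \<epsilon> \<le> dist p q)"
    using branch_values_isolated by blast
  then obtain \<epsilon> where \<epsilon>: "\<And>q. q \<in> i ` F \<Longrightarrow> 0 < \<epsilon> q"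
    "\<And>q p. q \<in> i ` F \<Longrightarrow> branch_value M F i p \<Longrightarrow> p \<noteq> q \<Longrightarrow> \<epsilon> q \<le> dist p q"
    by (metis (no_types, lifting) bchoice)
  \<comment> \<open>Half the distance to other branch values: the support around \<open>q\<close>
    then stays at least as far from each of them again.\<close>
  define W where "W q = M \<inter> ball q (\<epsilon> q / 2)" for q
  have W: "openin (top_of_set M) (W q)" for q unfolding W_def by (rule openin_open_Int) simp
  have "\<exists>g V. local_height q (W q) g V \<and> (branch_value M F i q \<longrightarrow> flat_over q g)" if q: "q \<in> i ` F" for q
  proof -
    have "q \<in> W q" using q i_M \<epsilon>(1)[OF q] unfolding W_def by auto
    from local_height_exists[OF q W this] show ?thesis .
  qed
  then obtain g V where gV: "\<And>q. q \<in> i ` F \<Longrightarrow> local_height q (W q) (g q) (V q)"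
    "\<And>q. q \<in> i ` F \<Longrightarrow> branch_value M F i q \<Longrightarrow> flat_over q (g q)" by metis
  have "\<exists>T. open T \<and> V q = M \<inter> T" if "q \<in> i ` F" for q
    using gV(1)[OF that] unfolding local_height_def openin_open by blast
  then obtain T where T: "\<And>q. q \<in> i ` F \<Longrightarrow> open (T q)" "\<And>q. q \<in> i ` F \<Longrightarrow> V q = M \<inter> T q" by metis
  have "i ` F \<subseteq> (\<Union>q\<in>i ` F. T q)"
  proof
    fix q assume q: "q \<in> i ` F"
    then have "q \<in> V q" using gV(1) unfolding local_height_def by blast
    then show "q \<in> (\<Union>q\<in>i ` F. T q)" using T(2)[OF q] q by blast
  qed
  then obtain D where D: "D \<subseteq> i ` F" "finite D" "i ` F \<subseteq> (\<Union>q\<in>D. T q)"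
    using compactE_image[OF image_compact, of "i ` F" T] T(1) by metis
  have gD: "pl_map_on F (g q)" "\<And>x. x \<in> F \<Longrightarrow> 0 \<le> g q x"
    "\<And>x y. (x, y) \<in> Hi \<Longrightarrow> g q y < g q x \<or> g q x = 0 \<and> g q y = 0"
    "\<And>x. x \<in> F \<Longrightarrow> i x \<in> V q \<Longrightarrow> 0 < g q x" "\<And>x. x \<in> F \<Longrightarrow> g q x \<noteq> 0 \<Longrightarrow> i x \<in> W q"
    if "q \<in> D" for q
  proof -
    have "local_height q (W q) (g q) (V q)" using gV(1) D(1) that by blast
    then have "pl_map_on F (g q)" "\<forall>x\<in>F. 0 \<le> g q x"
      "\<forall>x y. (x, y) \<in> Hi \<longrightarrow> g q y < g q x \<or> g q x = 0 \<and> g q y = 0"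
      "\<forall>x\<in>F. i x \<in> V q \<longrightarrow> 0 < g q x" "\<forall>x\<in>F. g q x \<noteq> 0 \<longrightarrow> i x \<in> W q"
      unfolding local_height_def by - (elim conjE, assumption)+
    then show "pl_map_on F (g q)" "\<And>x. x \<in> F \<Longrightarrow> 0 \<le> g q x"
      "\<And>x y. (x, y) \<in> Hi \<Longrightarrow> g q y < g q x \<or> g q x = 0 \<and> g q y = 0"
      "\<And>x. x \<in> F \<Longrightarrow> i x \<in> V q \<Longrightarrow> 0 < g q x" "\<And>x. x \<in> F \<Longrightarrow> g q x \<noteq> 0 \<Longrightarrow> i x \<in> W q"
      by auto
  qed
  have cover: "\<exists>q\<in>D. i x \<in> V q" if x: "x \<in> F" for x
  proof -
    obtain q where "q \<in> D" "i x \<in> T q" using D(3) x by blast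
    then show ?thesis using T(2)[of q] D(1) i_M[OF x] by blast
  qed
  define h where "h x = (\<Sum>q\<in>D. g q x)" for x
  have h_pl: "pl_map_on F h"
    unfolding h_def by (rule pl_map_on_sum[OF pl_map_on_id[OF i_pl] gD(1)])
  have mono: "h y < h x" if xy: "(x, y) \<in> Hi" for x y
  proof -
    have xF: "x \<in> F" using Hi_D[OF xy] by blast
    obtain q where q: "q \<in> D" "i x \<in> V q" using cover[OF xF] by blast
    have "g q' y \<le> g q' x" if "q' \<in> D" for q' using gD(3)[OF that xy] by linarith
    moreover have "g q y < g q x" using gD(3)[OF q(1) xy] gD(4)[OF q(1) xF q(2)] by linarith
    ultimately show ?thesis unfolding h_def using D(2) q(1) by (intro sum_strict_mono_ex1) auto
  qed
  have inj: "inj_on (\<lambda>x. (i x, h x)) F"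
  proof (rule inj_onI)
    fix x y assume xy: "x \<in> F" "y \<in> F" "(i x, h x) = (i y, h y)"
    show "x = y"
    proof (rule ccontr)
      assume "x \<noteq> y"
      then have dp: "(x, y) \<in> double_pairs F i" using xy unfolding double_pairs_def by auto
      then show False using Hi_total[OF dp] mono[of x y] mono[of y x] xy(3) by auto
    qed
  qed
  have flat: "locally_flat_at (M \<times> UNIV) ((\<lambda>x. (i x, h x)) ` F) (i x, h x)" if x: "x \<in> F" for x
  proof (cases "branch_value M F i (i x)")
    case False
    have "i x \<in> i ` F" using x by blast
    then show ?thesis
    proof (cases rule: value_cases)
      case (planes B L N f g' U u)
      from plane_chart.locally_flat_at_plane_value[OF planes(1) h_pl inj x refl] show ?thesis .
    qed (use False in blast)
  next
    case True
    let ?p = "i x"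
    obtain q where q: "q \<in> D" "?p \<in> V q" using cover[OF x] by blast
    have dist: "\<epsilon> q' \<le> dist ?p q'" if "q' \<in> D" "q' \<noteq> ?p" for q' by (rule \<epsilon>(2)[OF subsetD[OF D(1) that(1)] True that(2)[symmetric]])
    have "0 < g q x" using gD(4)[OF q(1) x q(2)] .
    then have "?p \<in> W q" using gD(5)[OF q(1) x] by simp
    then have "dist ?p q < \<epsilon> q / 2" unfolding W_def by (simp add: dist_commute)
    \<comment> \<open>A centre different from the branch value would be at distance at least
      \<open>\<epsilon> q\<close> from it. So the summand that is positive there is the one centred
      at the branch value itself.\<close>
    then have qp: "q = ?p" using dist[OF q(1)] zero_le_dist[of ?p q] by (cases "q = ?p") auto
    \<comment> \<open>In this neighbourhood all other summands vanish: a point in the support around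
      \<open>q'\<close> and within \<open>\<epsilon> q' / 2\<close> of the branch value would put
      the two centres too close.\<close>
    define Z where "Z = M \<inter> (\<Inter>q'\<in>D - {?p}. ball ?p (\<epsilon> q' / 2))"
    have "open (\<Inter>q'\<in>D - {?p}. ball ?p (\<epsilon> q' / 2))" using D(2) by (intro open_INT) auto
    then have Z: "openin (top_of_set M) Z" unfolding Z_def by (rule openin_open_Int)
    have pZ: "?p \<in> Z" unfolding Z_def using i_M[OF x] \<epsilon>(1) D(1) by auto
    have hg: "\<forall>y\<in>F. i y \<in> Z \<longrightarrow> h y = g ?p y"
    proof (intro ballI impI)
      fix y assume y: "y \<in> F" "i y \<in> Z"
      have "g q' y = 0" if q': "q' \<in> D - {?p}" for q'
      proof (rule ccontr)
        assume "g q' y \<noteq> 0"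
        then have "dist q' (i y) < \<epsilon> q' / 2" using gD(5)[of q' y] q' y unfolding W_def by auto
        moreover have "dist ?p (i y) < \<epsilon> q' / 2" using y(2) q' unfolding Z_def by auto
        moreover have "\<epsilon> q' \<le> dist ?p q'" using dist q' by blast
        moreover have "dist ?p q' \<le> dist ?p (i y) + dist q' (i y)" by (rule dist_triangle2)
        ultimately show False by linarith
      qed
      then have "(\<Sum>q'\<in>D. g q' y) = (\<Sum>q'\<in>{?p}. g q' y)"
        using D(2) q(1) qp by (intro sum.mono_neutral_right) auto
      then show "h y = g ?p y" by (simp add: h_def)
    qed
    have "flat_over ?p (g ?p)" using gV(2) True x by blast
    then show ?thesis using Z pZ x hg unfolding flat_over_def by blast
  qed
  have "lifting M F i h"
    unfolding lifting_def Let_def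
  proof (intro conjI ballI)
    have "(i x, h x) \<in> mf_boundary TYPE(4) (M \<times> UNIV) \<longleftrightarrow> x \<in> mf_boundary TYPE(2) F" if x: "x \<in> F" for x
      using mf_boundary_Times_line[OF M i_M[OF x]] i_proper x unfolding proper_pl_map_def by blast
    then show "proper_pl_map TYPE(2) TYPE(4) F (M \<times> UNIV) (\<lambda>x. (i x, h x))"
      unfolding proper_pl_map_def using pl_map_on_pair[OF i_pl h_pl] i_M by auto
    show "inj_on (\<lambda>x. (i x, h x)) F" by (rule inj)
    fix z assume "z \<in> (\<lambda>x. (i x, h x)) ` F"
    then show "locally_flat_at (M \<times> UNIV) ((\<lambda>x. (i x, h x)) ` F) z" using flat by blast
  qed
  then show ?thesis using mono by blast
qed

end


section \<open>The formula\<close>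

text \<open>Two different pairs among three points share exactly one point. \<open>P\<close> is
  shared by segments 1 and 2, \<open>Q\<close> by 2 and 3, \<open>R\<close> by 1 and 3; these are
  the sheets named in the definition of \<open>s\<close>.\<close>

lemma pairs_of_three:
  fixes \<sigma> :: "nat \<Rightarrow> 'a set"
  assumes abc: "a \<noteq> b" "b \<noteq> c" "a \<noteq> c" and \<sigma>: "bij_betw \<sigma> {1, 2, 3} {{a, b}, {b, c}, {a, c}}"
  obtains P Q R where "P \<noteq> Q" "Q \<noteq> R" "P \<noteq> R" "{P, Q, R} = {a, b, c}"
    "\<sigma> 1 = {R, P}" "\<sigma> 2 = {P, Q}" "\<sigma> 3 = {Q, R}"
proof -
  have im: "\<sigma> ` {1, 2, 3} = {{a, b}, {b, c}, {a, c}}" and inj: "inj_on \<sigma> {1, 2, 3}"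
    using \<sigma> unfolding bij_betw_def by auto
  have mem: "\<sigma> 1 \<in> {{a, b}, {b, c}, {a, c}}" "\<sigma> 2 \<in> {{a, b}, {b, c}, {a, c}}" "\<sigma> 3 \<in> {{a, b}, {b, c}, {a, c}}"
    using im by blast+
  have ne: "\<sigma> 1 \<noteq> \<sigma> 2" "\<sigma> 2 \<noteq> \<sigma> 3" "\<sigma> 1 \<noteq> \<sigma> 3"
    using inj unfolding inj_on_def by auto
  consider "\<sigma> 1 = {a, b}" "\<sigma> 2 = {b, c}" "\<sigma> 3 = {a, c}" | "\<sigma> 1 = {a, b}" "\<sigma> 2 = {a, c}" "\<sigma> 3 = {b, c}"
    | "\<sigma> 1 = {b, c}" "\<sigma> 2 = {a, b}" "\<sigma> 3 = {a, c}" | "\<sigma> 1 = {b, c}" "\<sigma> 2 = {a, c}" "\<sigma> 3 = {a, b}"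
    | "\<sigma> 1 = {a, c}" "\<sigma> 2 = {a, b}" "\<sigma> 3 = {b, c}" | "\<sigma> 1 = {a, c}" "\<sigma> 2 = {b, c}" "\<sigma> 3 = {a, b}"
    using mem ne by (metis empty_iff insert_iff)
  then show thesis
  proof cases
    case 1 then show thesis using abc by (intro that[of b c a]) auto
  next
    case 2 then show thesis using abc by (intro that[of a c b]) auto
  next
    case 3 then show thesis using abc by (intro that[of b a c]) auto
  next
    case 4 then show thesis using abc by (intro that[of c a b]) auto
  next
    case 5 then show thesis using abc by (intro that[of a b c]) auto
  next
    case 6 then show thesis using abc by (intro that[of c b a]) auto
  qed
qed

section \<open>Arcs and strips as sets of double pairs\<close>

context generic_surface_map
begin

lemma double_pairs_swap: "(x, y) \<in> double_pairs F i \<longleftrightarrow> (y, x) \<in> double_pairs F i"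
  unfolding double_pairs_def by auto

lemma path_component_swap:
  assumes "path_component (double_pairs F i) (x, y) (x', y')"
  shows "path_component (double_pairs F i) (y, x) (y', x')"
proof -
  obtain \<gamma> where \<gamma>: "path \<gamma>" "path_image \<gamma> \<subseteq> double_pairs F i" "pathstart \<gamma> = (x, y)" "pathfinish \<gamma> = (x', y')"
    using assms unfolding path_component_def by blast
  have "path (prod.swap \<circ> \<gamma>)"
    by (rule path_continuous_image[OF \<gamma>(1)]) (auto intro!: continuous_intros simp: prod.swap_def)
  moreover have "path_image (prod.swap \<circ> \<gamma>) \<subseteq> double_pairs F i"
    using \<gamma>(2) double_pairs_swap unfolding path_image_compose by force
  ultimately show ?thesis
    unfolding path_component_def using \<gamma>(3,4)
    by (intro exI[of _ "prod.swap \<circ> \<gamma>"]) (auto simp: pathstart_compose pathfinish_compose)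
qed

lemma strip_through_self: "e \<in> double_pairs F i \<Longrightarrow> e \<in> strip_through F i e"
  unfolding strip_through_def by (simp add: path_component_refl)

lemma strip_through_eq: "e' \<in> strip_through F i e \<Longrightarrow> strip_through F i e' = strip_through F i e"
  unfolding strip_through_def by (metis mem_Collect_eq path_component_eq)

lemma strip_through_swap:
  assumes "(x', y') \<in> strip_through F i (x, y)" shows "(y', x') \<in> strip_through F i (y, x)"
  using assms path_component_swap unfolding strip_through_def by simp

lemma strip_through_sub: "strip_through F i e \<subseteq> double_pairs F i"
  unfolding strip_through_def by (rule path_component_subset)

text \<open>The double arc that contains a given double pair; with it, \<open>double_arcs\<close>
  becomes an image and its members are determined by any of their pairs.\<close>

definition arc_of :: "'f \<times> 'f \<Rightarrow> ('f \<times> 'f) set" where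
  "arc_of e = strip_through F i e \<union> strip_through F i (prod.swap e)"

lemma double_arcs_eq: "double_arcs F i = arc_of ` double_pairs F i"
  unfolding double_arcs_def arc_of_def by force

lemma arc_of_self: "e \<in> double_pairs F i \<Longrightarrow> e \<in> arc_of e"
  unfolding arc_of_def using strip_through_self by blast

lemma arc_of_swap: "arc_of (prod.swap e) = arc_of e"
  unfolding arc_of_def by auto

text \<open>Swapping the points carries one strip of the arc to the other, so a pair on either strip
  generates the same two strips.\<close>

lemma arc_of_eq:
  assumes "e' \<in> arc_of e" shows "arc_of e' = arc_of e"
proof -
  have "e' \<in> strip_through F i e \<or> e' \<in> strip_through F i (prod.swap e)" using assms unfolding arc_of_def by blast
  then show ?thesis
  proof
    assume 1: "e' \<in> strip_through F i e"
    then have "prod.swap e' \<in> strip_through F i (prod.swap e)"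
      using strip_through_swap[of "fst e'" "snd e'" "fst e" "snd e"] by (simp add: prod.swap_def)
    then show ?thesis unfolding arc_of_def using strip_through_eq 1 by metis
  next
    assume 1: "e' \<in> strip_through F i (prod.swap e)"
    then have "prod.swap e' \<in> strip_through F i e"
      using strip_through_swap[of "fst e'" "snd e'" "snd e" "fst e"] by (simp add: prod.swap_def)
    then show ?thesis unfolding arc_of_def using strip_through_eq 1 by (metis Un_commute)
  qed
qed

lemma arc_unique:
  assumes "A \<in> double_arcs F i" "e \<in> A" shows "A = arc_of e"
  using assms arc_of_eq unfolding double_arcs_eq by blast

lemma arc_of_arc: "e \<in> double_pairs F i \<Longrightarrow> arc_of e \<in> double_arcs F i"
  unfolding double_arcs_eq by blast

lemma strips_arc_of:
  assumes "e \<in> double_pairs F i"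
  shows "strips F i (arc_of e) = {strip_through F i e, strip_through F i (prod.swap e)}"
proof -
  have "prod.swap e \<in> double_pairs F i" using assms double_pairs_swap[of "fst e" "snd e"] by (simp add: prod.swap_def)
  then have "e \<in> arc_of e" "prod.swap e \<in> arc_of e" using arc_of_self[OF assms] arc_of_self arc_of_swap by metis+
  moreover have "strip_through F i e' \<in> {strip_through F i e, strip_through F i (prod.swap e)}" if "e' \<in> arc_of e" for e'
    using that strip_through_eq unfolding arc_of_def by blast
  ultimately show ?thesis unfolding strips_def by blast
qed

lemma triple_value_preimages:
  assumes "triple_value M F i p"
  obtains a b c where "a \<noteq> b" "b \<noteq> c" "a \<noteq> c" "{x \<in> F. i x = p} = {a, b, c}"
proof -
  obtain N f g U u where "plane_chart M F i p pl_ball {1, 2, 3} N f g U u"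
    using planes_at_chart[of pl_ball "{1,2,3}" p] assms unfolding triple_value_def by auto
  then interpret plane_chart M F i p pl_ball "{1, 2, 3}" N f g U u .
  have "x \<in> F \<and> i x = p \<longleftrightarrow> x = u 1 0 \<or> x = u 2 0 \<or> x = u 3 0" for x
    using preimage_iff[OF p_N] fp by auto
  then have "{x \<in> F. i x = p} = {u 1 0, u 2 0, u 3 0}" by blast
  moreover have "u l 0 \<noteq> u l' 0" if "l \<noteq> l'" for l l'
    using u_neq[OF _ _ that B0 _ B0] exhaust_3[of l] exhaust_3[of l'] by auto
  ultimately show thesis by (intro that[of "u 1 0" "u 2 0" "u 3 0"]) auto
qed

text \<open>Each plane through the centre contributes one point over the value and a branch value
  has only one, so three points force three planes.\<close>

lemma triple_valueI:
  assumes "x \<in> F" "y \<in> F" "z \<in> F" "i y = i x" "i z = i x" "x \<noteq> y" "y \<noteq> z" "x \<noteq> z"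
  shows "triple_value M F i (i x)"
proof -
  have "i x \<in> i ` F" using assms(1) by blast
  then show ?thesis
  proof (cases rule: value_cases)
    case branch
    then show ?thesis using assms unfolding branch_value_def by blast
  next
    case (planes B L N f g U u)
    interpret plane_chart M F i "i x" B L N f g U u by (rule planes(1))
    have "\<exists>l\<in>L. w = u l 0" if "w \<in> F" "i w = i x" for w
      using preimage_iff[OF p_N] fp that by auto
    then obtain l1 l2 l3 where "l1 \<in> L" "l2 \<in> L" "l3 \<in> L" "x = u l1 0" "y = u l2 0" "z = u l3 0"
      using assms by metis
    then have "l1 \<in> L" "l2 \<in> L" "l3 \<in> L" "l1 \<noteq> l2" "l2 \<noteq> l3" "l1 \<noteq> l3" using assms(6-8) by auto
    then have "L = {1, 2, 3}" using planes(2) by auto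
    then show ?thesis by (rule planes(3))
  qed
qed

end

section \<open>Labelled arcs, lifting attempts and clauses\<close>

locale double_arc_labels = generic_surface_map M F i
  for M :: "'m::euclidean_space set" and F :: "'f::euclidean_space set" and i :: "'f \<Rightarrow> 'm" +
  fixes N K :: nat and DA :: "nat \<Rightarrow> ('f \<times> 'f) set" and strip :: "nat \<Rightarrow> nat \<Rightarrow> ('f \<times> 'f) set"
    and TV :: "nat \<Rightarrow> 'm" and seg :: "nat \<Rightarrow> nat \<Rightarrow> 'f set"
    and j :: "nat \<Rightarrow> nat \<Rightarrow> nat" and s :: "nat \<Rightarrow> nat \<Rightarrow> bool"
  assumes DA: "bij_betw DA {..<N} (double_arcs F i)"
    and strip: "n < N \<Longrightarrow> bij_betw (strip n) {0, 1} (strips F i (DA n))"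
    and TV: "bij_betw TV {..<K} {p \<in> i ` F. triple_value M F i p}"
    and seg: "k < K \<Longrightarrow> bij_betw (seg k) {1, 2, 3} (segments F i (TV k))"
    and j: "k < K \<Longrightarrow> l \<in> {1, 2, 3} \<Longrightarrow> j k l = arc_index N DA (seg k) l"
    and s: "k < K \<Longrightarrow> l \<in> {1, 2, 3} \<Longrightarrow> s k l = strip_parameter N DA strip (seg k) l"
begin

lemma arc_number:
  assumes "e \<in> double_pairs F i"
  shows "\<exists>!n. n < N \<and> e \<in> DA n" "\<And>n. n < N \<Longrightarrow> e \<in> DA n \<Longrightarrow> DA n = arc_of e"
proof -
  show 1: "DA n = arc_of e" if "n < N" "e \<in> DA n" for n
    using arc_unique[of "DA n" e] DA that unfolding bij_betw_def by blast
  have "arc_of e \<in> DA ` {..<N}" using arc_of_arc[OF assms] DA unfolding bij_betw_def by blast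
  then obtain n where n: "n < N" "DA n = arc_of e" by auto
  then have "e \<in> DA n" using arc_of_self[OF assms] by blast
  moreover have "n' = n" if "n' < N" "e \<in> DA n'" for n'
    using 1[OF that] n DA that unfolding bij_betw_def inj_on_def by auto
  ultimately show "\<exists>!n. n < N \<and> e \<in> DA n" using n(1) by blast
qed

lemma strip_cases:
  assumes e: "e \<in> double_pairs F i" and n: "n < N" "DA n = arc_of e"
  shows "{strip n 0, strip n 1} = {strip_through F i e, strip_through F i (prod.swap e)}"
    "strip n 0 \<noteq> strip n 1"
  using strip[OF n(1)] strips_arc_of[OF e] n(2) unfolding bij_betw_def by auto

text \<open>The labelling by 0 and 1 is a bijection onto the strips of the arc, so the arc has two
  of them and following it never interchanges the two points.\<close>

lemma strips_distinct:
  assumes "(x, y) \<in> double_pairs F i" shows "strip_through F i (x, y) \<noteq> strip_through F i (y, x)"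
proof -
  obtain n where "n < N" "(x, y) \<in> DA n" using arc_number(1)[OF assms] by blast
  then have "{strip n 0, strip n 1} = {strip_through F i (x, y), strip_through F i (y, x)}" "strip n 0 \<noteq> strip n 1"
    using strip_cases[OF assms] arc_number(2)[OF assms] by auto
  then show ?thesis by auto
qed

text \<open>The attempt as a relation between points of \<open>F\<close>; once it is acyclic it is
  an instance of \<open>height_order\<close>.\<close>

definition higher :: "(('f \<times> 'f) set \<Rightarrow> ('f \<times> 'f) set) \<Rightarrow> ('f \<times> 'f) set" where
  "higher att = (\<Union>A\<in>double_arcs F i. att A)"

context
  fixes att assumes att: "lifting_attempt F i att"
begin

lemma att_cases:
  assumes "(x, y) \<in> double_pairs F i"
  shows "att (arc_of (x, y)) = strip_through F i (x, y) \<or> att (arc_of (x, y)) = strip_through F i (y, x)"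
proof -
  have "att (arc_of (x, y)) \<in> strips F i (arc_of (x, y))"
    using att arc_of_arc[OF assms] unfolding lifting_attempt_def by blast
  then show ?thesis unfolding strips_arc_of[OF assms] by simp
qed

lemma higher_iff:
  assumes xy: "(x, y) \<in> double_pairs F i"
  shows "(x, y) \<in> higher att \<longleftrightarrow> att (arc_of (x, y)) = strip_through F i (x, y)"
proof
  assume "(x, y) \<in> higher att"
  then obtain A where A: "A \<in> double_arcs F i" "(x, y) \<in> att A" unfolding higher_def by blast
  have "att A \<in> strips F i A" using att A(1) unfolding lifting_attempt_def by blast
  then obtain e where e: "e \<in> A" "att A = strip_through F i e" unfolding strips_def by blast
  have "(x, y) \<in> arc_of e" using A(2) e(2) unfolding arc_of_def by blast
  then have "A = arc_of (x, y)" using arc_of_eq arc_unique[OF A(1) e(1)] by metis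
  moreover have "strip_through F i (x, y) = strip_through F i e" using strip_through_eq A(2) e(2) by metis
  ultimately show "att (arc_of (x, y)) = strip_through F i (x, y)" using e(2) by simp
next
  assume "att (arc_of (x, y)) = strip_through F i (x, y)"
  then show "(x, y) \<in> higher att"
    unfolding higher_def using arc_of_arc[OF xy] strip_through_self[OF xy] by blast
qed

lemma higher_sub: "higher att \<subseteq> double_pairs F i"
proof
  fix e assume "e \<in> higher att"
  then obtain A where A: "A \<in> double_arcs F i" "e \<in> att A" unfolding higher_def by blast
  then have "att A \<in> strips F i A" using att unfolding lifting_attempt_def by blast
  then show "e \<in> double_pairs F i" using A(2) strip_through_sub unfolding strips_def by blast
qed

lemma higher_total:
  assumes xy: "(x, y) \<in> double_pairs F i"
  shows "(x, y) \<in> higher att \<longleftrightarrow> (y, x) \<notin> higher att"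
proof -
  have yx: "(y, x) \<in> double_pairs F i" using xy double_pairs_swap by blast
  have "arc_of (y, x) = arc_of (x, y)" using arc_of_swap[of "(x, y)"] by simp
  then show ?thesis
    using higher_iff[OF xy] higher_iff[OF yx] att_cases[OF xy] strips_distinct[OF xy] by auto
qed

lemma higher_path:
  assumes "path_component (double_pairs F i) e e'" "e \<in> higher att" shows "e' \<in> higher att"
proof -
  have e': "e' \<in> strip_through F i e" using assms(1) unfolding strip_through_def by simp
  obtain x y x' y' where xy: "e = (x, y)" "e' = (x', y')" by (metis surj_pair)
  have dp: "e \<in> double_pairs F i" "e' \<in> double_pairs F i" using assms(2) higher_sub e' strip_through_sub by blast+
  have "e' \<in> arc_of e" using e' unfolding arc_of_def by blast
  then have "arc_of e' = arc_of e" by (rule arc_of_eq)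
  then show ?thesis
    using higher_iff dp assms(2) strip_through_eq[OF e'] unfolding xy by metis
qed

text \<open>\<open>s k l\<close> names the strip containing the first sheet of the segment, and the
  entry of the vector names the strip chosen as higher. They agree precisely when the first sheet is
  the higher one, whichever way the strips are numbered.\<close>

lemma clause_iff:
  assumes uv: "(x, y) \<in> double_pairs F i" and k: "k < K" and l: "l \<in> {1, 2, 3}"
    and seg_l: "seg k l = {x, y}" and sheets: "first_sheet (seg k) l = x" "second_sheet (seg k) l = y"
  shows "attempt_vector DA strip att (j k l) = s k l \<longleftrightarrow> (x, y) \<in> higher att"
    and "j k l < N"
proof -
  have vu: "(y, x) \<in> double_pairs F i" using uv double_pairs_swap by blast
  obtain n where n: "n < N" "(x, y) \<in> DA n" using arc_number(1)[OF uv] by blast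
  have DAn: "DA n = arc_of (x, y)" by (rule arc_number(2)[OF uv n])
  have "(y, x) \<in> DA n" using DAn arc_of_self[OF vu] arc_of_swap[of "(x, y)"] by simp
  have "n' = n" if n': "n' < N" "\<exists>x' y'. seg k l = {x', y'} \<and> (x', y') \<in> DA n'" for n'
  proof -
    obtain x' y' where "{x, y} = {x', y'}" "(x', y') \<in> DA n'" using n'(2) seg_l by auto
    then have "(x, y) \<in> DA n' \<or> (y, x) \<in> DA n'" by (auto simp: doubleton_eq_iff)
    then show ?thesis
      using arc_number(1)[OF uv] arc_number(1)[OF vu] n \<open>(y, x) \<in> DA n\<close> n'(1) by blast
  qed
  then have jn: "j k l = n"
    unfolding j[OF k l] arc_index_def using n seg_l by (intro the_equality) blast+
  then show "j k l < N" using n(1) by simp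
  have jn': "arc_index N DA (seg k) l = n" using jn j[OF k l] by simp
  note sc = strip_cases[OF uv n(1) DAn, unfolded prod.swap_def fst_conv snd_conv]
  have ne: "strip_through F i (x, y) \<noteq> strip_through F i (y, x)" by (rule strips_distinct[OF uv])
  have self: "(x, y) \<in> strip_through F i (x, y)" "(y, x) \<in> strip_through F i (y, x)"
    using strip_through_self uv vu by blast+
  have notin: "(x, y) \<notin> strip_through F i (y, x)" using strip_through_eq ne by blast
  have "s k l \<longleftrightarrow> \<not> ((x, y) \<in> strip n 0 \<and> (y, x) \<in> strip n 1)"
    unfolding s[OF k l] strip_parameter_def sheets jn' ..
  moreover have "strip n 0 = strip_through F i (x, y) \<and> strip n 1 = strip_through F i (y, x) \<or>
      strip n 0 = strip_through F i (y, x) \<and> strip n 1 = strip_through F i (x, y)"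
    using sc(1) by (simp add: doubleton_eq_iff)
  ultimately have "(s k l \<longleftrightarrow> strip n 1 = strip_through F i (x, y)) \<and>
      (att (DA n) = strip n 1 \<longleftrightarrow> (att (DA n) = strip_through F i (x, y) \<longleftrightarrow> strip n 1 = strip_through F i (x, y)))"
    using self notin ne att_cases[OF uv] unfolding DAn by auto
  then show "attempt_vector DA strip att (j k l) = s k l \<longleftrightarrow> (x, y) \<in> higher att"
    unfolding attempt_vector_def jn higher_iff[OF uv] DAn[symmetric] by blast
qed

end

text \<open>\<open>P\<close>, \<open>Q\<close>, \<open>R\<close> are the sheets containing the
  segments 1 and 2, 2 and 3, 1 and 3. Along the three segments the pairs of first and second sheet
  go round one cycle: from \<open>R\<close> to \<open>P\<close>, from \<open>P\<close> to
  \<open>Q\<close>, from \<open>Q\<close> to \<open>R\<close>.\<close>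

definition labelled_sheets :: "nat \<Rightarrow> 'f \<Rightarrow> 'f \<Rightarrow> 'f \<Rightarrow> bool" where
  "labelled_sheets k P Q R \<longleftrightarrow> P \<noteq> Q \<and> Q \<noteq> R \<and> P \<noteq> R \<and> {x \<in> F. i x = TV k} = {P, Q, R} \<and>
     seg k 1 = {R, P} \<and> seg k 2 = {P, Q} \<and> seg k 3 = {Q, R} \<and>
     first_sheet (seg k) 1 = R \<and> second_sheet (seg k) 1 = P \<and>
     first_sheet (seg k) 2 = P \<and> second_sheet (seg k) 2 = Q \<and>
     first_sheet (seg k) 3 = Q \<and> second_sheet (seg k) 3 = R"

lemma labelled_sheets_exist:
  assumes k: "k < K"
  obtains P Q R where "labelled_sheets k P Q R"
proof -
  have "triple_value M F i (TV k)" using TV k unfolding bij_betw_def by blast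
  then obtain a b c where abc: "a \<noteq> b" "b \<noteq> c" "a \<noteq> c" "{x \<in> F. i x = TV k} = {a, b, c}"
    by (rule triple_value_preimages)
  have mem: "x \<in> F \<and> i x = TV k \<longleftrightarrow> x = a \<or> x = b \<or> x = c" for x using abc(4) by blast
  have "segments F i (TV k) = {{a, b}, {b, c}, {a, c}}"
  proof -
    have "segments F i (TV k) = {{x, y} |x y. (x = a \<or> x = b \<or> x = c) \<and> (y = a \<or> y = b \<or> y = c) \<and> x \<noteq> y}"
      unfolding segments_def double_pairs_def mem[symmetric] by fastforce
    also have "\<dots> = {{a, b}, {b, c}, {a, c}}" using abc(1-3) by (auto simp: insert_commute)
    finally show ?thesis .
  qed
  then obtain P Q R where PQR: "P \<noteq> Q" "Q \<noteq> R" "P \<noteq> R" "{P, Q, R} = {a, b, c}"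
    "seg k 1 = {R, P}" "seg k 2 = {P, Q}" "seg k 3 = {Q, R}"
    using pairs_of_three[OF abc(1-3), of "seg k"] seg[OF k] by metis
  have sh: "sheet (seg k) 1 2 = P" "sheet (seg k) 2 3 = Q" "sheet (seg k) 1 3 = R"
    unfolding sheet_def PQR(5-7) using PQR(1-3) by (auto intro!: the_equality)
  show thesis
    by (rule that[of P Q R], unfold labelled_sheets_def)
      (use PQR abc(4) sh in \<open>simp add: first_sheet_def second_sheet_def\<close>)
qed

lemma clauses_iff:
  assumes att: "lifting_attempt F i att" and k: "k < K" and T: "labelled_sheets k P Q R"
  shows "(attempt_vector DA strip att (j k 1) \<longleftrightarrow> s k 1) \<longleftrightarrow> (R, P) \<in> higher att"
    "(attempt_vector DA strip att (j k 2) \<longleftrightarrow> s k 2) \<longleftrightarrow> (P, Q) \<in> higher att"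
    "(attempt_vector DA strip att (j k 3) \<longleftrightarrow> s k 3) \<longleftrightarrow> (Q, R) \<in> higher att"
    "(P, R) \<in> higher att \<longleftrightarrow> (R, P) \<notin> higher att"
    "(Q, P) \<in> higher att \<longleftrightarrow> (P, Q) \<notin> higher att"
    "(R, Q) \<in> higher att \<longleftrightarrow> (Q, R) \<notin> higher att"
    "j k 1 < N" "j k 2 < N" "j k 3 < N"
proof -
  have T': "{x \<in> F. i x = TV k} = {P, Q, R}" "seg k 1 = {R, P}" "seg k 2 = {P, Q}" "seg k 3 = {Q, R}"
    "first_sheet (seg k) 1 = R" "second_sheet (seg k) 1 = P"
    "first_sheet (seg k) 2 = P" "second_sheet (seg k) 2 = Q"
    "first_sheet (seg k) 3 = Q" "second_sheet (seg k) 3 = R"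
    using T unfolding labelled_sheets_def by - (elim conjE, assumption)+
  have "P \<in> F" "i P = TV k" "Q \<in> F" "i Q = TV k" "R \<in> F" "i R = TV k" using T'(1) by blast+
  then have dp: "(R, P) \<in> double_pairs F i" "(P, Q) \<in> double_pairs F i" "(Q, R) \<in> double_pairs F i"
    using T unfolding double_pairs_def labelled_sheets_def by auto
  have l: "1 \<in> {1, 2, 3::nat}" "2 \<in> {1, 2, 3::nat}" "3 \<in> {1, 2, 3::nat}" by simp_all
  note c = clause_iff[OF att dp(1) k l(1) T'(2,5,6)] clause_iff[OF att dp(2) k l(2) T'(3,7,8)]
    clause_iff[OF att dp(3) k l(3) T'(4,9,10)]
  show "(attempt_vector DA strip att (j k 1) \<longleftrightarrow> s k 1) \<longleftrightarrow> (R, P) \<in> higher att"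
    "(attempt_vector DA strip att (j k 2) \<longleftrightarrow> s k 2) \<longleftrightarrow> (P, Q) \<in> higher att"
    "(attempt_vector DA strip att (j k 3) \<longleftrightarrow> s k 3) \<longleftrightarrow> (Q, R) \<in> higher att"
    "j k 1 < N" "j k 2 < N" "j k 3 < N" by (rule c)+
  show "(P, R) \<in> higher att \<longleftrightarrow> (R, P) \<notin> higher att"
    "(Q, P) \<in> higher att \<longleftrightarrow> (P, Q) \<notin> higher att"
    "(R, Q) \<in> higher att \<longleftrightarrow> (Q, R) \<notin> higher att"
    using higher_total[OF att dp(1)] higher_total[OF att dp(2)] higher_total[OF att dp(3)] by blast+
qed

text \<open>A cycle of three pairs lies over a triple value and runs in one of two directions. If
  every first sheet is above the second, all literals of the second clause fail; in the opposite
  direction all literals of the first clause fail.\<close>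

lemma formula_iff:
  assumes att: "lifting_attempt F i att"
  shows "lifting_formula K j s (attempt_vector DA strip att) \<longleftrightarrow>
    (\<forall>x y z. (x, y) \<in> higher att \<longrightarrow> (y, z) \<in> higher att \<longrightarrow> (z, x) \<notin> higher att)"
    (is "?formula \<longleftrightarrow> ?acyclic")
proof -
  let ?H = "higher att"
  show ?thesis
  proof
    assume formula: ?formula
    show ?acyclic
    proof (intro allI impI notI)
      fix x y z assume H: "(x, y) \<in> ?H" "(y, z) \<in> ?H" "(z, x) \<in> ?H"
      have dp: "(x, y) \<in> double_pairs F i" "(y, z) \<in> double_pairs F i" "(z, x) \<in> double_pairs F i"
        using H higher_sub[OF att] by blast+
      then have xyz: "x \<in> F" "y \<in> F" "z \<in> F" "i y = i x" "i z = i x" "x \<noteq> y" "y \<noteq> z" "x \<noteq> z"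
        unfolding double_pairs_def by auto
      have "triple_value M F i (i x)" by (rule triple_valueI[OF xyz])
      then have "i x \<in> TV ` {..<K}" using TV xyz(1) unfolding bij_betw_def by blast
      then obtain k where k: "k < K" "i x = TV k" by auto
      obtain P Q R where T: "labelled_sheets k P Q R" by (rule labelled_sheets_exist[OF k(1)])
      have "x \<in> {P, Q, R}" "y \<in> {P, Q, R}" "z \<in> {P, Q, R}" using xyz k(2) T unfolding labelled_sheets_def by auto
      then have "(R, P) \<in> ?H \<and> (P, Q) \<in> ?H \<and> (Q, R) \<in> ?H \<or> (P, R) \<in> ?H \<and> (Q, P) \<in> ?H \<and> (R, Q) \<in> ?H"
        using H xyz(6-8) by auto
      then show False using clauses_iff(1-6)[OF att k(1) T] formula k(1) unfolding lifting_formula_def by blast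
    qed
  next
    assume acyclic: ?acyclic
    show ?formula
      unfolding lifting_formula_def
    proof (intro allI impI)
      fix k assume k: "k < K"
      obtain P Q R where T: "labelled_sheets k P Q R" by (rule labelled_sheets_exist[OF k])
      have "\<not> ((R, P) \<in> ?H \<and> (P, Q) \<in> ?H \<and> (Q, R) \<in> ?H)" "\<not> ((P, R) \<in> ?H \<and> (R, Q) \<in> ?H \<and> (Q, P) \<in> ?H)"
        using acyclic by blast+
      then show "((attempt_vector DA strip att (j k 1) \<longleftrightarrow> s k 1) \<or> (attempt_vector DA strip att (j k 2) \<longleftrightarrow> s k 2) \<or>
          (attempt_vector DA strip att (j k 3) \<longleftrightarrow> s k 3)) \<and>
        ((attempt_vector DA strip att (j k 1) \<longleftrightarrow> \<not> s k 1) \<or> (attempt_vector DA strip att (j k 2) \<longleftrightarrow> \<not> s k 2) \<or>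
          (attempt_vector DA strip att (j k 3) \<longleftrightarrow> \<not> s k 3))"
        using clauses_iff(1-6)[OF att k T] by blast
    qed
  qed
qed

lemma successful_iff:
  assumes M: "pl_manifold TYPE(3) M" and att: "lifting_attempt F i att"
  shows "successful M F i att \<longleftrightarrow> lifting_formula K j s (attempt_vector DA strip att)"
  unfolding formula_iff[OF att]
proof
  assume "successful M F i att"
  then obtain h where h: "lifting M F i h" "\<forall>A\<in>double_arcs F i. \<forall>(x, y)\<in>att A. h y < h x"
    unfolding successful_def by (elim exE conjE) (rule that; assumption)
  have "h y < h x" if "(x, y) \<in> higher att" for x y using that h(2) unfolding higher_def by blast
  then show "\<forall>x y z. (x, y) \<in> higher att \<longrightarrow> (y, z) \<in> higher att \<longrightarrow> (z, x) \<notin> higher att"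
    by (meson less_asym' order_less_trans)
next
  assume acyclic: "\<forall>x y z. (x, y) \<in> higher att \<longrightarrow> (y, z) \<in> higher att \<longrightarrow> (z, x) \<notin> higher att"
  interpret height_order M F i "higher att"
    by unfold_locales (use higher_sub[OF att] higher_total[OF att] higher_path[OF att] acyclic in blast)+
  obtain h where "lifting M F i h" "\<forall>(x, y)\<in>higher att. h y < h x" using lifting_exists[OF M] by blast
  then show "successful M F i att" unfolding successful_def higher_def by blast
qed

text \<open>Strips are path connected, and on them the difference of the two heights is continuous
  and never 0 by injectivity. So a lifting selects one strip of every arc.\<close>

lemma liftable_successful:
  assumes "liftable M F i"
  shows "\<exists>att. lifting_attempt F i att \<and> successful M F i att"
proof -
  obtain h where h: "lifting M F i h" using assms unfolding liftable_def by blast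
  have pl: "pl_map_on F (\<lambda>x. (i x, h x))" and inj: "inj_on (\<lambda>x. (i x, h x)) F"
    using h unfolding lifting_def proper_pl_map_def Let_def by auto
  have cont: "continuous_on F h"
    using continuous_on_snd[OF pl_map_on_continuous[OF pl]] by simp
  have ne: "h x \<noteq> h y" if "(x, y) \<in> double_pairs F i" for x y
    using inj that unfolding inj_on_def double_pairs_def by auto
  let ?d = "\<lambda>e. h (fst e) - h (snd e)"
  have sign: "0 < ?d e'" if e': "e' \<in> strip_through F i e" and e: "e \<in> double_pairs F i" "0 < ?d e" for e e'
  proof (rule ccontr)
    assume neg: "\<not> 0 < ?d e'"
    have sub: "strip_through F i e \<subseteq> double_pairs F i" by (rule strip_through_sub)
    have "path_connected (strip_through F i e)" unfolding strip_through_def by (rule path_connected_path_component)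
    then have "connected (strip_through F i e)" by (rule path_connected_imp_connected)
    moreover have "continuous_on (strip_through F i e) ?d"
    proof (intro continuous_intros continuous_on_compose2[OF cont])
      show "fst ` strip_through F i e \<subseteq> F" "snd ` strip_through F i e \<subseteq> F"
        using sub unfolding double_pairs_def by fastforce+
    qed
    ultimately have "connected (?d ` strip_through F i e)" by (rule connected_continuous_image[rotated])
    moreover have "?d e' \<in> ?d ` strip_through F i e" "?d e \<in> ?d ` strip_through F i e"
      using e' strip_through_self[OF e(1)] by blast+
    ultimately have "0 \<in> ?d ` strip_through F i e"
      using connectedD_interval[of _ "?d e'" "?d e" 0] neg e(2) by simp
    then obtain e0 where "e0 \<in> strip_through F i e" "?d e0 = 0" by auto
    then show False using ne[of "fst e0" "snd e0"] sub by auto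
  qed
  have "\<exists>S\<in>strips F i A. \<forall>(x, y)\<in>S. h y < h x" if A: "A \<in> double_arcs F i" for A
  proof -
    obtain e where e: "e \<in> double_pairs F i" "A = arc_of e" using A unfolding double_arcs_eq by blast
    obtain x y where xy: "e = (x, y)" by fastforce
    have sw: "(y, x) \<in> double_pairs F i" using e(1) xy double_pairs_swap by blast
    have st: "strips F i A = {strip_through F i (x, y), strip_through F i (y, x)}"
      using strips_arc_of[OF e(1)] e(2) xy by simp
    show ?thesis
    proof (cases "h y < h x")
      case True
      then have "\<forall>(x', y')\<in>strip_through F i (x, y). h y' < h x'" using sign[of _ "(x, y)"] e(1) xy by fastforce
      then show ?thesis using st by blast
    next
      case False
      then have "h x < h y" using ne[of x y] e(1) xy by auto
      then have "\<forall>(x', y')\<in>strip_through F i (y, x). h y' < h x'" using sign[of _ "(y, x)"] sw by fastforce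
      then show ?thesis using st by blast
    qed
  qed
  then obtain att where "\<forall>A\<in>double_arcs F i. att A \<in> strips F i A \<and> (\<forall>(x, y)\<in>att A. h y < h x)"
    by (metis (no_types, lifting) bchoice)
  then show ?thesis using h unfolding lifting_attempt_def successful_def by blast
qed

text \<open>Passing from attempts to vectors is onto as far as the entries below \<open>N\<close>
  are concerned, which turns satisfiability into the existence of an attempt.\<close>

lemma attempt_of_vector:
  "\<exists>att. lifting_attempt F i att \<and> (\<forall>n<N. attempt_vector DA strip att n \<longleftrightarrow> x n)"
proof -
  define att where "att A = (let n = the_inv_into {..<N} DA A in strip n (if x n then 1 else 0))" for A
  have att: "att (DA n) = strip n (if x n then 1 else 0)" if "n < N" for n
    using DA that unfolding att_def bij_betw_def by (simp add: the_inv_into_f_f)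
  have "lifting_attempt F i att"
    unfolding lifting_attempt_def
  proof
    fix A assume "A \<in> double_arcs F i"
    then have "A \<in> DA ` {..<N}" using DA unfolding bij_betw_def by blast
    then obtain n where n: "n < N" "A = DA n" by blast
    have "strip n ` {0, 1} = strips F i A" using strip[OF n(1)] n(2) unfolding bij_betw_def by blast
    then show "att A \<in> strips F i A" using att[OF n(1)] n(2) by auto
  qed
  moreover have "attempt_vector DA strip att n \<longleftrightarrow> x n" if "n < N" for n
    using strip[OF that] att[OF that] unfolding attempt_vector_def bij_betw_def inj_on_def by auto
  ultimately show ?thesis by blast
qed

text \<open>A satisfying vector is arbitrary beyond \<open>N\<close>, while an attempt reproduces
  only the entries below \<open>N\<close>. The bounds on \<open>j\<close> come from
  \<open>clauses_iff\<close>, for which any attempt will do.\<close>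

lemma formula_cong:
  assumes "\<forall>n<N. x n \<longleftrightarrow> x' n" shows "lifting_formula K j s x \<longleftrightarrow> lifting_formula K j s x'"
proof -
  obtain att where att: "lifting_attempt F i att" using attempt_of_vector by blast
  have "j k 1 < N \<and> j k 2 < N \<and> j k 3 < N" if k: "k < K" for k
  proof -
    obtain P Q R where T: "labelled_sheets k P Q R" by (rule labelled_sheets_exist[OF k])
    show ?thesis using clauses_iff(7-9)[OF att k T] by blast
  qed
  then show ?thesis using assms unfolding lifting_formula_def by auto
qed

lemma liftable_iff:
  assumes M: "pl_manifold TYPE(3) M"
  shows "liftable M F i \<longleftrightarrow> (\<exists>x. lifting_formula K j s x)"
proof
  assume "liftable M F i"
  then show "\<exists>x. lifting_formula K j s x" using liftable_successful successful_iff[OF M] by blast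
next
  assume "\<exists>x. lifting_formula K j s x"
  then obtain x where x: "lifting_formula K j s x" by blast
  obtain att where att: "lifting_attempt F i att" "\<forall>n<N. attempt_vector DA strip att n \<longleftrightarrow> x n"
    using attempt_of_vector by blast
  have "lifting_formula K j s (attempt_vector DA strip att)" using formula_cong[OF att(2)] x by blast
  then show "liftable M F i" using successful_iff[OF M att(1)] unfolding successful_def liftable_def by blast
qed

end

theorem theorem4p2p4:
  fixes M :: "'m::euclidean_space set" and F :: "'f::euclidean_space set" and i :: "'f \<Rightarrow> 'm"
    and N K :: nat
    and DA :: "nat \<Rightarrow> ('f \<times> 'f) set"
    and strip :: "nat \<Rightarrow> nat \<Rightarrow> ('f \<times> 'f) set"
    and TV :: "nat \<Rightarrow> 'm"
    and seg :: "nat \<Rightarrow> nat \<Rightarrow> 'f set"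
    and j :: "nat \<Rightarrow> nat \<Rightarrow> nat"
    and s :: "nat \<Rightarrow> nat \<Rightarrow> bool"
  assumes "pl_manifold TYPE(3) M"
    and "generic_surface M F i"
    and "\<And>A. A \<in> double_arcs F i \<Longrightarrow> closed_arc M F i A \<Longrightarrow> trivial_arc F i A"
    and "bij_betw DA {..<N} (double_arcs F i)"
    and "\<And>n. n < N \<Longrightarrow> bij_betw (strip n) {0, 1} (strips F i (DA n))"
    and "bij_betw TV {..<K} {p \<in> i ` F. triple_value M F i p}"
    and "\<And>k. k < K \<Longrightarrow> bij_betw (seg k) {1, 2, 3} (segments F i (TV k))"
    and "\<And>k l. k < K \<Longrightarrow> l \<in> {1, 2, 3} \<Longrightarrow> j k l = arc_index N DA (seg k) l"
    and "\<And>k l. k < K \<Longrightarrow> l \<in> {1, 2, 3} \<Longrightarrow> s k l = strip_parameter N DA strip (seg k) l"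
  shows "(\<forall>att. lifting_attempt F i att \<longrightarrow>
             (successful M F i att \<longleftrightarrow> lifting_formula K j s (attempt_vector DA strip att))) \<and>
         (liftable M F i \<longleftrightarrow> (\<exists>x. lifting_formula K j s x))"
proof -
  interpret double_arc_labels M F i N K DA strip TV seg j s
    by unfold_locales (fact assms)+
  show ?thesis using successful_iff[OF assms(1)] liftable_iff[OF assms(1)] by blast
qed

end
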